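(* Let $V$ be $\mathbb R^n$, $\mathbb C^n$ or $\mathbb H^n$, and let $\mathrm{St}_k^n(V)$ carry the homogeneous metric induced by the quasi-geodesic horizontal distribution on $G_n\times G_k$. 1. Quasi-geodesic curves on $\mathrm{St}_k^n(V)$ coincide with the projections $\pi(g(t))$ of those sub-Riemannian geodesics $$g(t)=g_0\exp\big(t(P_{\mathfrak p}+P_{\mathfrak p^\perp})\big)\exp(-tP_{\mathfrak p^\perp})=g_0\Big(\exp\Big(t\begin{pmatrix}E&B\\-B^*&F\end{pmatrix}\Big)\begin{pmatrix}e^{-tE}&0\\0&e^{-tF}\end{pmatrix},e^{tA}\Big)$$ of the quasi-geodesic distribution for which $P_{\mathfrak p^\perp}=0$; here $g_0\in G_n\times G_k$, $P_{\mathfrak p}=\Big(\begin{pmatrix}0&B\\-B^*&0\end{pmatrix},A\Big)\in\mathfrak p$ and $P_{\mathfrak p^\perp}=\Big(\begin{pmatrix}E&0\\0&F\end{pmatrix},0\Big)\in\mathfrak p^\perp$. 2. Quasi-geodesic curves are curves of constant geodesic curvature. 3. A quasi-geodesic is a Riemannian geodesic on $\mathrm{St}_k^n(V)$ if either $P_{\mathfrak p}=(0,A)$ or $P_{\mathfrak p}=\Big(\begin{pmatrix}0&B\\-B^*&0\end{pmatrix},0\Big)$.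
   Context: $G_n$ denotes $\mathrm{SO}(n)$, $\mathrm{SU}(n)$, $\mathrm{Sp}(n)$ for $V=\mathbb R^n,\mathbb C^n,\mathbb H^n$ respectively (with $\mathrm{Sp}(n)$ the quaternionic $n\times n$ matrices $\Theta$ with $\Theta^*\Theta=\Theta\Theta^*=I_n$), with Lie algebra $\mathfrak g_n$; ${}^*$ is the transpose or (complex, quaternionic) conjugate transpose. $\mathrm{St}_k^n(V)$ is the set of ordered $k$-tuples of orthonormal vectors in $V$, identified with the $n\times k$ matrices $m$ over $\mathbb R$, $\mathbb C$ or $\mathbb H$ with $m^*m=I_k$, and $I_{nk}=\begin{pmatrix}I_k\\0\end{pmatrix}$. $G=G_n\times G_k$ acts on $\mathrm{St}_k^n(V)$ by $((r,s),m)\mapsto rms^{-1}$, and $\pi(r,s)=rI_{nk}s^*$. The trace form is $\langle A,B\rangle=-\frac12\mathrm{Tr}(AB)$ on $\mathfrak g_n$ in the real and complex cases, and $\langle A,B\rangle=-\frac14\mathrm{Tr}(AB+(AB)^* )$ on $\mathfrak{sp}(n)$; on $\mathfrak g_n\times\mathfrak g_k$ it is the sum of the trace forms of the factors. The quasi-geodesic distribution is $\mathcal H_{\mathfrak p}(g)=\{gX:X\in\mathfrak p\}$ on $G_n\times G_k$ with $\mathfrak p=\{(\begin{pmatrix}0&B\\-B^*&0\end{pmatrix},A):A\in\mathfrak g_k\}$ ($B$ a $k\times(n-k)$ matrix), with left-invariant sub-Riemannian metric the restriction of the trace form to $\mathfrak p$; $\mathfrak p^\perp=\{(\begin{pmatrix}E&0\\0&F\end{pmatrix},0):E\in\mathfrak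 g_k,F\in\mathfrak g_{n-k}\}$ is the orthogonal complement of $\mathfrak p$ for the trace form. A sub-Riemannian geodesic is a horizontal curve (absolutely continuous, $\dot g\in\mathcal H_{\mathfrak p}(g)$ a.e.) that is locally length-minimizing among horizontal curves; arc-length parametrization of the displayed curves corresponds to $\|P_{\mathfrak p}\|=1$. The homogeneous metric on $\mathrm{St}_k^n(V)$ is the push-forward of the sub-Riemannian metric: the length of a curve in $\mathrm{St}_k^n(V)$ is the length of any horizontal curve in $G$ projecting onto it by $\pi$. Quasi-geodesic curves through a point $m=rI_{nk}s^*$ ($r\in G_n$, $s\in G_k$) are by definition the curves $\gamma(t)=r\exp(t\Psi)I_{nk}e^{-tA}s^*$ with $\Psi=\begin{pmatrix}0&B\\-B^*&0\end{pmatrix}$, $B$ a $k\times(n-k)$ matrix and $A\in\mathfrak g_k$. The geodesic curvature of a curve parametrized by arc length is the length of the covariant derivative of its velocity along the curve, relative to the homogeneous metric.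
   Formalization: Over C the pushed-forward metric misses one tangent direction (A in su(k)), so it is extended by the same formula to all skew-Hermitian A. Throughout 1 <= k < n, and the constant quasi-geodesic, which has no arc-length parametrization, is left out of part 2. *)

theory Defs
  imports "HOL-Analysis.Analysis"
begin

section \<open>Quaternions\<close>

datatype quat = Quat (qre: real) (qi: real) (qj: real) (qk: real)

lemma quat_eq_iff: "x = y \<longleftrightarrow> qre x = qre y \<and> qi x = qi y \<and> qj x = qj y \<and> qk x = qk y"
  by (cases x; cases y) auto

instantiation quat :: real_normed_div_algebra
begin

definition "0 = Quat 0 0 0 0"
definition "1 = Quat 1 0 0 0"
definition "x + y = Quat (qre x + qre y) (qi x + qi y) (qj x + qj y) (qk x + qk y)"
definition "- x = Quat (- qre x) (- qi x) (- qj x) (- qk x)"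
definition "x - y = Quat (qre x - qre y) (qi x - qi y) (qj x - qj y) (qk x - qk y)"
definition "x * y = Quat
  (qre x * qre y - qi x * qi y - qj x * qj y - qk x * qk y)
  (qre x * qi y + qi x * qre y + qj x * qk y - qk x * qj y)
  (qre x * qj y - qi x * qk y + qj x * qre y + qk x * qi y)
  (qre x * qk y + qi x * qj y - qj x * qi y + qk x * qre y)"
definition "scaleR c x = Quat (c * qre x) (c * qi x) (c * qj x) (c * qk x)"
definition norm_quat_def: "norm x = sqrt ((qre x)\<^sup>2 + (qi x)\<^sup>2 + (qj x)\<^sup>2 + (qk x)\<^sup>2)"
definition "inverse x = scaleR (1 / (norm x)\<^sup>2) (Quat (qre x) (- qi x) (- qj x) (- qk x))"
definition divide_quat_def: "x div y = x * inverse (y :: quat)"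
definition dist_quat_def: "dist x y = norm (x - y :: quat)"
definition sgn_quat_def: "sgn x = scaleR (inverse (norm x)) (x :: quat)"
definition uniformity_quat_def [code del]:
  "(uniformity :: (quat \<times> quat) filter) = (INF e\<in>{0 <..}. principal {(x, y). dist x y < e})"
definition open_quat_def [code del]:
  "open (U :: quat set) \<longleftrightarrow> (\<forall>x\<in>U. eventually (\<lambda>(x', y). x' = x \<longrightarrow> y \<in> U) uniformity)"

lemmas quat_defs = zero_quat_def one_quat_def plus_quat_def uminus_quat_def minus_quat_def
  times_quat_def scaleR_quat_def

instance
proof
  fix x y z :: quat and a b :: real
  let ?n = "\<lambda>x. (qre x)\<^sup>2 + (qi x)\<^sup>2 + (qj x)\<^sup>2 + (qk x)\<^sup>2"
  have n0: "?n x = 0 \<longleftrightarrow> x = 0" for x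
    by (simp add: quat_eq_iff quat_defs add_nonneg_eq_0_iff)
  have nsq: "(norm x)\<^sup>2 = ?n x" for x :: quat
    by (simp add: norm_quat_def)
  show "x + y + z = x + (y + z)" "x + y = y + x" "0 + x = x" "- x + x = 0" "x - y = x + - y"
    "x * y * z = x * (y * z)" "1 * x = x" "x * 1 = x"
    "(x + y) * z = x * z + y * z" "x * (y + z) = x * y + x * z" "(0::quat) \<noteq> 1"
    "a *\<^sub>R (x + y) = a *\<^sub>R x + a *\<^sub>R y" "(a + b) *\<^sub>R x = a *\<^sub>R x + b *\<^sub>R x"
    "1 *\<^sub>R x = x"
    unfolding quat_eq_iff quat_defs quat.sel by (auto simp: algebra_simps)
  have scl: "a *\<^sub>R x * y = a *\<^sub>R (x * y)" and scr: "x * a *\<^sub>R y = a *\<^sub>R (x * y)"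
    and sca: "a *\<^sub>R b *\<^sub>R x = (a * b) *\<^sub>R x" for a b and x y :: quat
    unfolding quat_eq_iff quat_defs quat.sel by (auto simp: algebra_simps)
  show "a *\<^sub>R b *\<^sub>R x = (a * b) *\<^sub>R x" "a *\<^sub>R x * y = a *\<^sub>R (x * y)" "x * a *\<^sub>R y = a *\<^sub>R (x * y)"
    by (rule sca scl scr)+
  show "inverse x * x = 1" "x * inverse x = 1" if "x \<noteq> 0"
  proof -
    let ?c = "Quat (qre x) (- qi x) (- qj x) (- qk x)"
    have "?c * x = ?n x *\<^sub>R 1" "x * ?c = ?n x *\<^sub>R 1"
      unfolding quat_eq_iff quat_defs quat.sel by (auto simp: algebra_simps power2_eq_square)
    moreover have "?n x \<noteq> 0" using that n0 by blast
    moreover have "1 *\<^sub>R (1 :: quat) = 1" by (simp add: quat_defs)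
    ultimately show "inverse x * x = 1" "x * inverse x = 1"
      unfolding inverse_quat_def nsq scl scr by (simp_all add: sca)
  qed
  show "inverse (0::quat) = 0"
    by (simp add: inverse_quat_def quat_eq_iff quat_defs)
  show "x div y = x * inverse y" by (rule divide_quat_def)
  show "dist x y = norm (x - y)" by (rule dist_quat_def)
  show "sgn x = inverse (norm x) *\<^sub>R x" by (rule sgn_quat_def)
  show "(uniformity :: (quat \<times> quat) filter) = (INF e\<in>{0 <..}. principal {(x, y). dist x y < e})"
    by (rule uniformity_quat_def)
  show "open U \<longleftrightarrow> (\<forall>x\<in>U. eventually (\<lambda>(x', y). x' = x \<longrightarrow> y \<in> U) uniformity)" for U :: "quat set"
    by (rule open_quat_def)
  show "norm x = 0 \<longleftrightarrow> x = 0"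
    using n0 by (simp add: norm_quat_def)
  show "norm (a *\<^sub>R x) = \<bar>a\<bar> * norm x"
    by (simp add: norm_quat_def quat_defs power_mult_distrib flip: distrib_left)
       (simp add: real_sqrt_mult)
  show "norm (x * y) = norm x * norm y"
    unfolding norm_quat_def real_sqrt_mult[symmetric]
    by (rule arg_cong[where f = sqrt]) (simp add: quat_defs power2_eq_square algebra_simps)
  have four: "sqrt (p\<^sup>2 + q\<^sup>2 + r\<^sup>2 + s\<^sup>2) = norm ((p, q), (r, s))" for p q r s :: real
    by (simp add: norm_Pair real_sqrt_pow2)
  have eq: "norm x = norm ((qre x, qi x), (qj x, qk x))" for x :: quat
    unfolding norm_quat_def four ..
  show "norm (x + y) \<le> norm x + norm y"
    unfolding eq
    using norm_triangle_ineq[of "((qre x, qi x), (qj x, qk x))" "((qre y, qi y), (qj y, qk y))"]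
    by (simp add: quat_defs)
qed

end

instantiation quat :: euclidean_space
begin

definition inner_quat_def: "x \<bullet> y = qre x * qre y + qi x * qi y + qj x * qj y + qk x * qk y"
definition Basis_quat_def: "Basis = {Quat 1 0 0 0, Quat 0 1 0 0, Quat 0 0 1 0, Quat 0 0 0 1}"

instance
proof
  fix x y z :: quat and r :: real
  show "x \<bullet> y = y \<bullet> x" "(x + y) \<bullet> z = x \<bullet> z + y \<bullet> z" "(r *\<^sub>R x) \<bullet> y = r * (x \<bullet> y)"
    by (simp_all add: inner_quat_def quat_defs algebra_simps)
  show "0 \<le> x \<bullet> x"
    by (simp add: inner_quat_def)
  show "x \<bullet> x = 0 \<longleftrightarrow> x = 0"
    by (simp add: inner_quat_def quat_eq_iff quat_defs add_nonneg_eq_0_iff)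
  show "norm x = sqrt (x \<bullet> x)"
    by (simp add: norm_quat_def inner_quat_def power2_eq_square)
  show "(Basis :: quat set) \<noteq> {}" "finite (Basis :: quat set)"
    by (simp_all add: Basis_quat_def)
  show "u \<bullet> v = (if u = v then 1 else 0)" if "u \<in> Basis" "v \<in> Basis" for u v :: quat
    using that unfolding Basis_quat_def inner_quat_def by (elim insertE emptyE) simp_all
  show "(\<forall>u\<in>Basis. x \<bullet> u = 0) \<longleftrightarrow> x = 0"
    unfolding Basis_quat_def inner_quat_def quat_eq_iff[of x] zero_quat_def by auto
qed

end


section \<open>Matrices over the three scalar algebras\<close>

text \<open>
  In \<open>\<real>\<close>, \<open>\<complex>\<close> and \<open>\<bbbH>\<close> the real part of \<open>x\<close> is \<open>1 \<bullet> x\<close>, so conjugation is \<open>2 Re x - x\<close>.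
\<close>

definition hconj :: "'a::{real_normed_algebra_1, euclidean_space} \<Rightarrow> 'a" where
  "hconj x = (2 * (1 \<bullet> x)) *\<^sub>R 1 - x"

lemma hconj_real: "hconj (x :: real) = x"
  by (simp add: hconj_def)

lemma hconj_complex: "hconj (z :: complex) = cnj z"
  by (simp add: hconj_def complex_eq_iff inner_complex_def)

lemma hconj_quat: "hconj (Quat a b c d) = Quat a (- b) (- c) (- d)"
  by (simp add: hconj_def inner_quat_def quat_defs)

definition adj :: "'a::{real_normed_algebra_1, euclidean_space}^'n^'m \<Rightarrow> 'a^'m^'n" where
  "adj A = (\<chi> i j. hconj (A $ j $ i))"

text \<open>The library multiplication on vectors is entrywise, hence so would be its \<open>exp\<close> and \<open>^\<close>.\<close>

definition mexp :: "'a::{real_normed_algebra_1, euclidean_space}^'n^'n \<Rightarrow> 'a^'n^'n" where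
  "mexp A = (\<Sum>j. (1 / fact j) *\<^sub>R (((**) A ^^ j) (mat 1)))"

definition SO :: "(real^'n^'n) set" where
  "SO = {r. adj r ** r = mat 1 \<and> r ** adj r = mat 1 \<and> det r = 1}"

definition SU :: "(complex^'n^'n) set" where
  "SU = {r. adj r ** r = mat 1 \<and> r ** adj r = mat 1 \<and> det r = 1}"

definition Sp :: "(quat^'n^'n) set" where
  "Sp = {r. adj r ** r = mat 1 \<and> r ** adj r = mat 1}"

definition skew_hermitian :: "('a::{real_normed_algebra_1, euclidean_space}^'n^'n) set" where
  "skew_hermitian = {A. adj A = - A}"

definition so :: "(real^'n^'n) set" where
  "so = skew_hermitian"

definition su :: "(complex^'n^'n) set" where
  "su = {A \<in> skew_hermitian. trace A = 0}"

definition sp :: "(quat^'n^'n) set" where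
  "sp = skew_hermitian"

definition trace_form ::
  "'a::{real_normed_algebra_1, euclidean_space}^'n^'n \<Rightarrow> 'a^'n^'n \<Rightarrow> real" where
  "trace_form A B = - (1 / 2) * (1 \<bullet> trace (A ** B))"

text \<open>The trace form is \<open>-1/2 Tr(AB)\<close> on \<open>so\<close> and \<open>su\<close>, and \<open>-1/4 Tr(AB + (AB)*)\<close> on \<open>sp\<close>.\<close>

lemma trace_form_real: "trace_form (A :: real^'n^'n) B = - (1 / 2) * trace (A ** B)"
  by (simp add: trace_form_def)

lemma trace_form_complex:
  fixes A B :: "complex^'n^'n"
  assumes "A \<in> skew_hermitian" "B \<in> skew_hermitian"
  shows "complex_of_real (trace_form A B) = - (1 / 2) * trace (A ** B)"
proof -
  have *: "cnj (A $ i $ j) = - (A $ j $ i)" "cnj (B $ i $ j) = - (B $ j $ i)" for i j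
    using assms by (auto simp: skew_hermitian_def adj_def vec_eq_iff hconj_complex)
  have "cnj (trace (A ** B)) = (\<Sum>i\<in>UNIV. \<Sum>j\<in>UNIV. A $ j $ i * B $ i $ j)"
    by (simp add: trace_def matrix_matrix_mult_def *)
  also have "\<dots> = trace (A ** B)"
    unfolding trace_def matrix_matrix_mult_def by (simp, subst sum.swap, rule refl)
  finally have "Im (trace (A ** B)) = 0"
    by (metis Reals_cnj_iff complex_is_Real_iff)
  then show ?thesis
    by (simp add: trace_form_def complex_eq_iff inner_complex_def)
qed

lemma trace_form_quat:
  fixes A B :: "quat^'n^'n"
  shows "(of_real (trace_form A B) :: quat) = - ((1 / 4) *\<^sub>R trace (A ** B + adj (A ** B)))"
proof -
  have "trace (M + adj M) = (2 * (1 \<bullet> trace M)) *\<^sub>R 1" for M :: "quat^'n^'n"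
    by (simp add: trace_def adj_def hconj_def inner_sum_right sum_distrib_left scaleR_sum_left)
  then show ?thesis
    by (simp add: trace_form_def of_real_def)
qed


section \<open>Block matrices and the quasi-geodesic distribution\<close>

text \<open>
  The \<open>n\<close> coordinates are indexed by the sum type \<open>'k + 'l\<close>, with \<open>k = CARD('k)\<close> and
  \<open>n - k = CARD('l)\<close>.
\<close>

definition block :: "'a^'k^'k \<Rightarrow> 'a^'l^'k \<Rightarrow> 'a^'k^'l \<Rightarrow> 'a^'l^'l \<Rightarrow> 'a^('k::finite + 'l::finite)^('k + 'l)" where
  "block E B C F = (\<chi> i j. case i of
      Inl i' \<Rightarrow> (case j of Inl j' \<Rightarrow> E $ i' $ j' | Inr j' \<Rightarrow> B $ i' $ j')
    | Inr i' \<Rightarrow> (case j of Inl j' \<Rightarrow> C $ i' $ j' | Inr j' \<Rightarrow> F $ i' $ j'))"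

definition Ink :: "'a::{zero, one}^'k^('k::finite + 'l::finite)" where
  "Ink = (\<chi> i j. case i of Inl i' \<Rightarrow> (if i' = j then 1 else 0) | Inr _ \<Rightarrow> 0)"

definition offdiag ::
  "'a::{real_normed_algebra_1, euclidean_space}^'l^'k \<Rightarrow> 'a^('k::finite + 'l::finite)^('k + 'l)" where
  "offdiag B = block 0 B (- adj B) 0"

text \<open>
  Pairs \<open>(r, s)\<close> represent elements both of \<open>G\<^sub>n \<times> G\<^sub>k\<close> and of its Lie algebra.  On the
  group, the inverse is the componentwise adjoint.
\<close>

definition pmul :: "('a::semiring_1^'n^'n) \<times> ('a^'k^'k) \<Rightarrow> ('a^'n^'n) \<times> ('a^'k^'k) \<Rightarrow>
    ('a^'n^'n) \<times> ('a^'k^'k)" where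
  "pmul g h = (fst g ** fst h, snd g ** snd h)"

definition padj :: "('a::{real_normed_algebra_1, euclidean_space}^'n^'n) \<times> ('a^'k^'k) \<Rightarrow>
    ('a^'n^'n) \<times> ('a^'k^'k)" where
  "padj g = (adj (fst g), adj (snd g))"

definition pexp :: "('a::{real_normed_algebra_1, euclidean_space}^'n^'n) \<times> ('a^'k^'k) \<Rightarrow>
    ('a^'n^'n) \<times> ('a^'k^'k)" where
  "pexp X = (mexp (fst X), mexp (snd X))"

definition ptrace_form :: "('a::{real_normed_algebra_1, euclidean_space}^'n^'n) \<times> ('a^'k^'k) \<Rightarrow>
    ('a^'n^'n) \<times> ('a^'k^'k) \<Rightarrow> real" where
  "ptrace_form X Y = trace_form (fst X) (fst Y) + trace_form (snd X) (snd Y)"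

text \<open>The arguments \<open>gk\<close> and \<open>gl\<close> stand for the Lie algebras of \<open>G\<^sub>k\<close> and \<open>G\<^bsub>n-k\<^esub>\<close>.\<close>

definition pspace :: "('a::{real_normed_algebra_1, euclidean_space}^'k^'k) set \<Rightarrow>
    (('a^('k::finite + 'l::finite)^('k + 'l)) \<times> ('a^'k^'k)) set" where
  "pspace gk = {(offdiag B, A) | B A. A \<in> gk}"

definition pperp :: "('a::{real_normed_algebra_1, euclidean_space}^'k^'k) set \<Rightarrow> ('a^'l^'l) set \<Rightarrow>
    (('a^('k::finite + 'l::finite)^('k + 'l)) \<times> ('a^'k^'k)) set" where
  "pperp gk gl = {(block E 0 0 F, 0) | E F. E \<in> gk \<and> F \<in> gl}"


section \<open>Sub-Riemannian geodesics\<close>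

definition absolutely_continuous_curve :: "real \<Rightarrow> real \<Rightarrow> (real \<Rightarrow> 'b::metric_space) \<Rightarrow> bool" where
  "absolutely_continuous_curve a b c \<longleftrightarrow>
    (\<forall>\<epsilon>>0. \<exists>\<delta>>0. \<forall>D :: (real \<times> real) set.
      finite D \<and> (\<forall>(u, v)\<in>D. a \<le> u \<and> u < v \<and> v \<le> b) \<and>
      pairwise (\<lambda>(u, v) (u', v'). {u<..<v} \<inter> {u'<..<v'} = {}) D \<and>
      (\<Sum>(u, v)\<in>D. v - u) < \<delta> \<longrightarrow>
      (\<Sum>(u, v)\<in>D. dist (c u) (c v)) < \<epsilon>)"

definition horizontal :: "(('a::{real_normed_algebra_1, euclidean_space}^'n^'n) \<times> ('a^'k^'k)) set \<Rightarrow>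
    (('a^'n^'n) \<times> ('a^'k^'k)) set \<Rightarrow> real \<Rightarrow> real \<Rightarrow>
    (real \<Rightarrow> ('a^'n^'n) \<times> ('a^'k^'k)) \<Rightarrow> bool" where
  "horizontal G p a b g \<longleftrightarrow>
    absolutely_continuous_curve a b g \<and> (\<forall>t\<in>{a..b}. g t \<in> G) \<and>
    (AE t in lebesgue. t \<in> {a..b} \<longrightarrow>
      (\<exists>X\<in>p. (g has_vector_derivative pmul (g t) X) (at t)))"

definition sr_length :: "real \<Rightarrow> real \<Rightarrow>
    (real \<Rightarrow> ('a::{real_normed_algebra_1, euclidean_space}^'n^'n) \<times> ('a^'k^'k)) \<Rightarrow> ennreal" where
  "sr_length a b g = (\<integral>\<^sup>+t\<in>{a..b}.
    (let X = pmul (padj (g t)) (vector_derivative g (at t)) in ennreal (sqrt (ptrace_form X X)))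
    \<partial>lebesgue)"

definition sr_geodesic :: "(('a::{real_normed_algebra_1, euclidean_space}^'n^'n) \<times> ('a^'k^'k)) set \<Rightarrow>
    (('a^'n^'n) \<times> ('a^'k^'k)) set \<Rightarrow> (real \<Rightarrow> ('a^'n^'n) \<times> ('a^'k^'k)) \<Rightarrow> bool" where
  "sr_geodesic G p g \<longleftrightarrow>
    (\<forall>a b. a \<le> b \<longrightarrow> horizontal G p a b g) \<and>
    (\<forall>t. \<exists>\<epsilon>>0. \<forall>a b. t - \<epsilon> \<le> a \<and> a \<le> b \<and> b \<le> t + \<epsilon> \<longrightarrow>
      (\<forall>c a' b'. a' \<le> b' \<and> horizontal G p a' b' c \<and> c a' = g a \<and> c b' = g b \<longrightarrow>
        sr_length a b g \<le> sr_length a' b' c))"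

definition sr_curve :: "('a::{real_normed_algebra_1, euclidean_space}^'n^'n) \<times> ('a^'k^'k) \<Rightarrow>
    ('a^'n^'n) \<times> ('a^'k^'k) \<Rightarrow> ('a^'n^'n) \<times> ('a^'k^'k) \<Rightarrow> real \<Rightarrow> ('a^'n^'n) \<times> ('a^'k^'k)" where
  "sr_curve g0 P Q t = pmul (pmul g0 (pexp (t *\<^sub>R (P + Q)))) (pexp (- t *\<^sub>R Q))"


section \<open>Riemannian geometry of a submanifold of a Euclidean space\<close>

text \<open>
  \<open>M\<close> is a closed embedded submanifold and \<open>met m\<close> an inner product on its tangent space at \<open>m\<close>;
  values of \<open>met m\<close> on non-tangent vectors are irrelevant.  Since \<open>M\<close> is closed, its smooth
  functions and vector fields are the restrictions of smooth maps on the ambient space.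
\<close>

definition tangent_space :: "'b::euclidean_space set \<Rightarrow> 'b \<Rightarrow> 'b set" where
  "tangent_space M m =
    {v. \<exists>c. (\<forall>t::real. c t \<in> M) \<and> c 0 = m \<and> (c has_vector_derivative v) (at 0)}"

primrec Ck :: "nat \<Rightarrow> ('b::euclidean_space \<Rightarrow> 'c::euclidean_space) \<Rightarrow> bool" where
  "Ck 0 = (\<lambda>f. continuous_on UNIV f)"
| "Ck (Suc n) = (\<lambda>f. (\<forall>x. f differentiable (at x)) \<and>
    (\<forall>v. Ck n (\<lambda>x. frechet_derivative f (at x) v)))"

definition smooth :: "('b::euclidean_space \<Rightarrow> 'c::euclidean_space) \<Rightarrow> bool" where
  "smooth f \<longleftrightarrow> (\<forall>n. Ck n f)"

definition vector_fields :: "'b::euclidean_space set \<Rightarrow> ('b \<Rightarrow> 'b) set" where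
  "vector_fields M = {X. smooth X \<and> (\<forall>m\<in>M. X m \<in> tangent_space M m)}"

definition lie_bracket :: "('b::euclidean_space \<Rightarrow> 'b) \<Rightarrow> ('b \<Rightarrow> 'b) \<Rightarrow> 'b \<Rightarrow> 'b" where
  "lie_bracket X Y m =
    frechet_derivative Y (at m) (X m) - frechet_derivative X (at m) (Y m)"

text \<open>\<open>has_derivative_along M f m v d\<close>: the derivative \<open>v(f)\<close> of \<open>f\<close> along the tangent vector \<open>v\<close>
  at \<open>m\<close> is \<open>d\<close>; only the values of \<open>f\<close> on \<open>M\<close> matter.\<close>

definition has_derivative_along ::
  "'b::euclidean_space set \<Rightarrow> ('b \<Rightarrow> real) \<Rightarrow> 'b \<Rightarrow> 'b \<Rightarrow> real \<Rightarrow> bool" where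
  "has_derivative_along M f m v d \<longleftrightarrow>
    (\<forall>c. (\<forall>t::real. c t \<in> M) \<and> c 0 = m \<and> (c has_vector_derivative v) (at 0) \<longrightarrow>
      ((\<lambda>t. f (c t)) has_real_derivative d) (at 0))"

definition levi_civita :: "'b::euclidean_space set \<Rightarrow> ('b \<Rightarrow> 'b \<Rightarrow> 'b \<Rightarrow> real) \<Rightarrow>
    (('b \<Rightarrow> 'b) \<Rightarrow> ('b \<Rightarrow> 'b) \<Rightarrow> 'b \<Rightarrow> 'b) \<Rightarrow> bool" where
  "levi_civita M met nabla \<longleftrightarrow>
    (\<forall>X\<in>vector_fields M. \<forall>Y\<in>vector_fields M. nabla X Y \<in> vector_fields M) \<and>
    (\<forall>X\<in>vector_fields M. \<forall>Y\<in>vector_fields M. \<forall>Z\<in>vector_fields M. \<forall>m\<in>M.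
      nabla (\<lambda>x. X x + Y x) Z m = nabla X Z m + nabla Y Z m \<and>
      nabla Z (\<lambda>x. X x + Y x) m = nabla Z X m + nabla Z Y m) \<and>
    (\<forall>X\<in>vector_fields M. \<forall>Y\<in>vector_fields M. \<forall>f. smooth f \<longrightarrow> (\<forall>m\<in>M.
      nabla (\<lambda>x. f x *\<^sub>R X x) Y m = f m *\<^sub>R nabla X Y m \<and>
      nabla X (\<lambda>x. f x *\<^sub>R Y x) m =
        frechet_derivative f (at m) (X m) *\<^sub>R Y m + f m *\<^sub>R nabla X Y m)) \<and>
    (\<forall>X\<in>vector_fields M. \<forall>Y\<in>vector_fields M. \<forall>m\<in>M.
      nabla X Y m - nabla Y X m = lie_bracket X Y m) \<and>
    (\<forall>X\<in>vector_fields M. \<forall>Y\<in>vector_fields M. \<forall>Z\<in>vector_fields M. \<forall>m\<in>M.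
      has_derivative_along M (\<lambda>x. met x (Y x) (Z x)) m (X m)
        (met m (nabla X Y m) (Z m) + met m (Y m) (nabla X Z m)))"

text \<open>
  \<open>w\<close> is the covariant derivative at time \<open>t\<close> of the field \<open>V\<close> along \<open>c\<close>: near \<open>t\<close> write
  \<open>V = \<Sum>\<^sub>i f\<^sub>i (W\<^sub>i \<circ> c)\<close> with vector fields \<open>W\<^sub>i\<close>, and differentiate by the Leibniz rule and
  \<open>D(W\<^sub>i \<circ> c)/dt = \<nabla>\<^bsub>c'\<^esub> W\<^sub>i\<close>.
\<close>

definition has_covariant_derivative :: "'b::euclidean_space set \<Rightarrow> ('b \<Rightarrow> 'b \<Rightarrow> 'b \<Rightarrow> real) \<Rightarrow>
    (real \<Rightarrow> 'b) \<Rightarrow> (real \<Rightarrow> 'b) \<Rightarrow> 'b \<Rightarrow> real \<Rightarrow> bool" where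
  "has_covariant_derivative M met c V w t \<longleftrightarrow>
    (\<exists>nabla (N::nat) f f' W X. levi_civita M met nabla \<and>
      X \<in> vector_fields M \<and> (c has_vector_derivative X (c t)) (at t) \<and>
      (\<forall>i<N. W i \<in> vector_fields M \<and> (f i has_real_derivative f' i) (at t)) \<and>
      (\<forall>\<^sub>F \<tau> in nhds t. c \<tau> \<in> M \<and> V \<tau> = (\<Sum>i<N. f i \<tau> *\<^sub>R W i (c \<tau>))) \<and>
      w = (\<Sum>i<N. f' i *\<^sub>R W i (c t) + f i t *\<^sub>R nabla X (W i) (c t)))"

definition velocity :: "(real \<Rightarrow> 'b::real_normed_vector) \<Rightarrow> real \<Rightarrow> 'b" where
  "velocity c t = vector_derivative c (at t)"

definition riemannian_geodesic :: "'b::euclidean_space set \<Rightarrow> ('b \<Rightarrow> 'b \<Rightarrow> 'b \<Rightarrow> real) \<Rightarrow>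
    (real \<Rightarrow> 'b) \<Rightarrow> bool" where
  "riemannian_geodesic M met c \<longleftrightarrow>
    (\<forall>t. c t \<in> M \<and> has_covariant_derivative M met c (velocity c) 0 t)"

definition unit_speed :: "'b::euclidean_space set \<Rightarrow> ('b \<Rightarrow> 'b \<Rightarrow> 'b \<Rightarrow> real) \<Rightarrow> (real \<Rightarrow> 'b) \<Rightarrow> bool" where
  "unit_speed M met c \<longleftrightarrow>
    (\<forall>t. c t \<in> M \<and> c differentiable (at t) \<and> met (c t) (velocity c t) (velocity c t) = 1)"

definition geodesic_curvature :: "'b::euclidean_space set \<Rightarrow> ('b \<Rightarrow> 'b \<Rightarrow> 'b \<Rightarrow> real) \<Rightarrow>
    (real \<Rightarrow> 'b) \<Rightarrow> real \<Rightarrow> real" where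
  "geodesic_curvature M met c t =
    (let w = (THE w. has_covariant_derivative M met c (velocity c) w t) in sqrt (met (c t) w w))"

definition constant_geodesic_curvature :: "'b::euclidean_space set \<Rightarrow> ('b \<Rightarrow> 'b \<Rightarrow> 'b \<Rightarrow> real) \<Rightarrow>
    (real \<Rightarrow> 'b) \<Rightarrow> bool" where
  "constant_geodesic_curvature M met c \<longleftrightarrow>
    (\<exists>\<phi> :: real \<Rightarrow> real. strict_mono \<phi> \<and> surj \<phi> \<and> (\<forall>t. \<phi> differentiable (at t)) \<and>
      unit_speed M met (c \<circ> \<phi>) \<and>
      (\<exists>\<kappa>. \<forall>t. \<exists>w. has_covariant_derivative M met (c \<circ> \<phi>) (velocity (c \<circ> \<phi>)) w t \<and>
        geodesic_curvature M met (c \<circ> \<phi>) t = \<kappa>))"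


section \<open>The Stiefel manifold\<close>

definition stiefel :: "('a::{real_normed_algebra_1, euclidean_space}^'k^'n) set" where
  "stiefel = {m. adj m ** m = mat 1}"

definition stiefel_proj ::
  "('a::{real_normed_algebra_1, euclidean_space}^('k::finite + 'l::finite)^('k + 'l)) \<times> ('a^'k^'k) \<Rightarrow>
    'a^'k^('k + 'l)" where
  "stiefel_proj g = fst g ** Ink ** adj (snd g)"

text \<open>
  The push-forward of the left-invariant metric on the distribution \<open>g \<mapsto> g \<cdot> pspace\<close>.  Over
  \<open>\<real>\<close> and \<open>\<bbbH>\<close>, \<open>skew_hermitian\<close> is \<open>so\<close> resp. \<open>sp\<close>.  Over \<open>\<complex>\<close> the image of \<open>pspace su\<close> has
  codimension one in the tangent space; admitting all skew-Hermitian \<open>A\<close> extends the push-forward,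
  by the same formula, to a Riemannian metric.
\<close>

definition homogeneous_metric ::
  "('a::{real_normed_algebra_1, euclidean_space}^('k::finite + 'l::finite)^('k + 'l)) set \<Rightarrow>
    ('a^'k^'k) set \<Rightarrow> 'a^'k^('k + 'l) \<Rightarrow> 'a^'k^('k + 'l) \<Rightarrow> 'a^'k^('k + 'l) \<Rightarrow> real" where
  "homogeneous_metric Gn Gk m v w =
    (THE d. \<exists>g \<in> Gn \<times> Gk. \<exists>X \<in> pspace skew_hermitian. \<exists>Y \<in> pspace skew_hermitian.
      stiefel_proj g = m \<and>
      frechet_derivative stiefel_proj (at g) (pmul g X) = v \<and>
      frechet_derivative stiefel_proj (at g) (pmul g Y) = w \<and>
      d = ptrace_form X Y)"

definition quasi_geodesic ::
  "'a::{real_normed_algebra_1, euclidean_space}^('k::finite + 'l::finite)^('k + 'l) \<Rightarrow>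
    'a^'k^'k \<Rightarrow> 'a^'l^'k \<Rightarrow> 'a^'k^'k \<Rightarrow> real \<Rightarrow> 'a^'k^('k + 'l)" where
  "quasi_geodesic r s B A t = r ** mexp (t *\<^sub>R offdiag B) ** Ink ** mexp (- t *\<^sub>R A) ** adj s"

definition quasi_geodesics ::
  "('a::{real_normed_algebra_1, euclidean_space}^('k::finite + 'l::finite)^('k + 'l)) set \<Rightarrow>
    ('a^'k^'k) set \<Rightarrow> ('a^'k^'k) set \<Rightarrow> (real \<Rightarrow> 'a^'k^('k + 'l)) set" where
  "quasi_geodesics Gn Gk gk = {quasi_geodesic r s B A | r s B A. r \<in> Gn \<and> s \<in> Gk \<and> A \<in> gk}"

end

theory Submission
  imports Defs
begin

text \<open>
  The trace form is bi-invariant and half the Frobenius inner product, so the length of a horizontal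
  curve is its Frobenius length up to the factor \<open>1 / \<surd>2\<close>, and the one-parameter subgroups \<open>g\<^sub>0 exp (t P)\<close>
  with \<open>P \<in> \<pp>\<close> are locally minimizing even among all curves of the group.  This gives part 1.

  On tangent vectors the push-forward metric is \<open>\<langle>v, w\<rangle> - 1/2 \<langle>m\<^sup>* v, m\<^sup>* w\<rangle>\<close>, whose Levi-Civita connection has
  a Christoffel form that is polynomial in the ambient coordinates.  A quasi-geodesic is an orbit of a
  linear Killing field, so its acceleration is carried along by the unitary action and has constant
  length; at \<open>I\<^sub>n\<^sub>k\<close> it is the tangent vector with blocks \<open>0\<close> and \<open>B\<^sup>* A\<close>, which vanishes if \<open>A = 0\<close> or \<open>B = 0\<close>.
\<close>


section \<open>Composition algebras and matrices over them\<close>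

text \<open>The quaternions have no determinant, so the argument runs over one scalar class in which
  product and inner product are linked solely by the multiplicative norm; determinants return only
  at the end, to pass from unitary groups to \<open>SO\<close> and \<open>SU\<close>. Competitors of
  a sub-Riemannian geodesic are merely absolutely continuous, with a derivative almost everywhere.
  Minimality is therefore proved by a scalar function whose growth along any competitor is bounded
  by length and whose total increase equals the length of the subgroup segment. To build it, the
  group acts orthogonally on a real Euclidean space, where the square of a skew generator is
  diagonalizable and the subgroup turns each eigenvector in a plane. The angle is measured by a
  modified arcsine that agrees with arcsin only up to angle pi / 4, which is the source of the
  explicit time bound. In part 2 constant curves are set aside because they have no arc-length
  parametrization; all others are brought to unit speed by scaling \<open>B\<close> and
  \<open>A\<close> together.\<close>

class hurwitz_algebra = real_normed_div_algebra + euclidean_space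

instance real :: hurwitz_algebra ..
instance complex :: hurwitz_algebra ..
instance quat :: hurwitz_algebra ..

text \<open>Polarization of |x y| = |x| |y| in one factor.\<close>

lemma inner_mult_mult_same:
  fixes x y z :: "'a::hurwitz_algebra"
  shows "(x * y) \<bullet> (x * z) = (norm x)\<^sup>2 * (y \<bullet> z)" "(y * x) \<bullet> (z * x) = (norm x)\<^sup>2 * (y \<bullet> z)"
proof -
  have "norm (x * y + x * z) = norm x * norm (y + z)" "norm (y * x + z * x) = norm x * norm (y + z)"
    by (simp_all add: distrib_left [symmetric] distrib_right [symmetric] norm_mult)
  then show "(x * y) \<bullet> (x * z) = (norm x)\<^sup>2 * (y \<bullet> z)" "(y * x) \<bullet> (z * x) = (norm x)\<^sup>2 * (y \<bullet> z)"
    by (simp_all add: dot_norm norm_mult power_mult_distrib right_diff_distrib)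
qed

text \<open>Second polarization. Setting \<open>w = 1\<close> shows that multiplication by
  \<open>hconj x\<close> is adjoint to multiplication by \<open>x\<close>; the isometry and
  anti-multiplicativity of conjugation follow from this adjointness.\<close>

lemma inner_mult_mult_cross:
  fixes x y z w :: "'a::hurwitz_algebra"
  shows "(x * y) \<bullet> (w * z) + (w * y) \<bullet> (x * z) = 2 * (x \<bullet> w) * (y \<bullet> z)"
    and "(y * x) \<bullet> (z * w) + (y * w) \<bullet> (z * x) = 2 * (x \<bullet> w) * (y \<bullet> z)"
proof -
  have n: "(norm (x + w))\<^sup>2 = (norm x)\<^sup>2 + (norm w)\<^sup>2 + 2 * (x \<bullet> w)"
    using dot_norm[of x w] by simp
  show "(x * y) \<bullet> (w * z) + (w * y) \<bullet> (x * z) = 2 * (x \<bullet> w) * (y \<bullet> z)"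
    using inner_mult_mult_same(1)[of "x + w" y z]
    unfolding n by (simp add: distrib_right inner_mult_mult_same inner_add_left inner_add_right algebra_simps)
  show "(y * x) \<bullet> (z * w) + (y * w) \<bullet> (z * x) = 2 * (x \<bullet> w) * (y \<bullet> z)"
    using inner_mult_mult_same(2)[of y "x + w" z]
    unfolding n by (simp add: distrib_left inner_mult_mult_same inner_add_left inner_add_right algebra_simps)
qed

lemma inner_mult_left_hconj:
  fixes x y z :: "'a::hurwitz_algebra"
  shows "(x * y) \<bullet> z = y \<bullet> (hconj x * z)"
  using inner_mult_mult_cross(1)[of x y 1 z]
  by (simp add: hconj_def left_diff_distrib inner_diff_right inner_commute)

lemma inner_mult_right_hconj:
  fixes x y z :: "'a::hurwitz_algebra"
  shows "(x * y) \<bullet> z = x \<bullet> (z * hconj y)"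
  using inner_mult_mult_cross(2)[of x y z 1]
  using inner_mult_mult_cross(2)[of y x z 1]
  by (simp add: hconj_def right_diff_distrib inner_diff_right inner_commute)

lemma hconj_add: "hconj (x + y) = hconj x + hconj y"
  and hconj_minus: "hconj (- x) = - hconj x"
  and hconj_scaleR: "hconj (c *\<^sub>R x) = c *\<^sub>R hconj x"
  and hconj_0 [simp]: "hconj 0 = 0"
  by (simp_all add: hconj_def inner_add_right algebra_simps)

lemma hconj_1 [simp]: "hconj (1::'a::hurwitz_algebra) = 1"
  by (simp add: hconj_def dot_square_norm scaleR_2)

lemma hconj_hconj [simp]: "hconj (hconj (x::'a::hurwitz_algebra)) = x"
proof -
  have "(1::'a) \<bullet> 1 = 1"
    by (simp add: dot_square_norm)
  then show ?thesis
    by (simp add: hconj_def inner_diff_right algebra_simps)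
qed

lemma inner_hconj: "hconj (x::'a::hurwitz_algebra) \<bullet> hconj y = x \<bullet> y"
  using inner_mult_left_hconj[of "hconj x" 1 "hconj y"] inner_mult_right_hconj[of x "hconj y" 1]
  by (simp add: inner_commute)

text \<open>Factors move across the inner product: paired with \<open>z\<close>, both sides become
  \<open>(x * y * z) \<bullet> 1\<close>.\<close>

lemma hconj_mult: "hconj (x * y) = hconj y * hconj (x::'a::hurwitz_algebra)"
proof (rule vector_eq_rdot[THEN iffD1], rule allI)
  fix z
  have "hconj (x * y) \<bullet> z = (x * y * z) \<bullet> 1"
    using inner_mult_left_hconj[of "x * y" z 1] by (simp add: inner_commute)
  also have "\<dots> = (hconj y * hconj x) \<bullet> z"
    using inner_mult_left_hconj[of x "y * z" 1] inner_mult_left_hconj[of y z "hconj x"]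
    by (simp add: mult.assoc inner_commute)
  finally show "hconj (x * y) \<bullet> z = (hconj y * hconj x) \<bullet> z" .
qed

lemma hconj_sum: "hconj (\<Sum>i\<in>I. f i) = (\<Sum>i\<in>I. hconj (f i))"
  by (induction I rule: infinite_finite_induct) (simp_all add: hconj_add)

lemma matrix_mult_nth: "(A ** B) $ i $ j = (\<Sum>k\<in>UNIV. A $ i $ k * B $ k $ j)"
  by (simp add: matrix_matrix_mult_def)

lemma bounded_bilinear_matrix_mult:
  "bounded_bilinear ((**) :: 'a::hurwitz_algebra^'n^'m \<Rightarrow> 'a^'p^'n \<Rightarrow> 'a^'p^'m)"
  unfolding bilinear_conv_bounded_bilinear [symmetric] bilinear_def
  by (intro conjI allI linearI)
    (simp_all add: vec_eq_iff matrix_mult_nth distrib_left distrib_right sum.distrib scaleR_sum_right)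

text \<open>Since \<open>*\<close> on vectors is entrywise, bilinearity takes the place of ring
  arithmetic for the matrix product and supplies its product rules.\<close>

interpretation matrix_mult: bounded_bilinear
  "(**) :: 'a::hurwitz_algebra^'n^'m \<Rightarrow> 'a^'p^'n \<Rightarrow> 'a^'p^'m"
  by (rule bounded_bilinear_matrix_mult)

lemmas matrix_mult_linear_simps =
  matrix_mult.add_left matrix_mult.add_right matrix_mult.diff_left matrix_mult.diff_right
  matrix_mult.minus_left matrix_mult.minus_right matrix_mult.scaleR_left matrix_mult.scaleR_right
  matrix_mult.zero_left matrix_mult.zero_right

lemma adj_nth: "adj A $ i $ j = hconj (A $ j $ i)"
  by (simp add: adj_def)

lemma adj_add: "adj (A + B) = adj A + adj B"
  and adj_minus: "adj (- A) = - adj A"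
  and adj_diff: "adj (A - B) = adj A - adj B"
  and adj_scaleR: "adj (c *\<^sub>R A) = c *\<^sub>R adj A"
  and adj_0 [simp]: "adj 0 = 0"
  by (simp_all add: vec_eq_iff adj_nth hconj_add hconj_minus hconj_scaleR
        diff_conv_add_uminus del: add_uminus_conv_diff)

lemma adj_mat_1 [simp]: "adj (mat 1 :: 'a::hurwitz_algebra^'n^'n) = mat 1"
  by (simp add: vec_eq_iff adj_nth mat_def)

lemma adj_adj [simp]: "adj (adj (A :: 'a::hurwitz_algebra^'n^'m)) = A"
  by (simp add: vec_eq_iff adj_nth)

lemma adj_mult: "adj (A ** B) = adj B ** adj (A :: 'a::hurwitz_algebra^'n^'m)"
  by (simp add: vec_eq_iff adj_nth matrix_mult_nth hconj_sum hconj_mult)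

lemmas adj_simps = adj_add adj_minus adj_diff adj_scaleR adj_mult

lemma bounded_linear_adj: "bounded_linear (adj :: 'a::hurwitz_algebra^'n^'m \<Rightarrow> _)"
  unfolding linear_conv_bounded_linear [symmetric] by (rule linearI) (simp_all add: adj_simps)

lemma inner_matrix_eq: "A \<bullet> B = (\<Sum>i\<in>UNIV. \<Sum>j\<in>UNIV. A $ i $ j \<bullet> B $ i $ j)"
  by (simp add: inner_vec_def)

lemma inner_adj: "adj (A :: 'a::hurwitz_algebra^'n^'m) \<bullet> adj B = A \<bullet> B"
  unfolding inner_matrix_eq adj_nth inner_hconj by (rule sum.swap)

text \<open>The scalar adjointness summed over entries: \<open>adj A\<close> is the adjoint of left
  multiplication by \<open>A\<close> for the Frobenius inner product.\<close>

lemma inner_matrix_mult_left: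
  fixes A :: "'a::hurwitz_algebra^'n^'m"
  shows "(A ** B) \<bullet> C = B \<bullet> (adj A ** C)"
proof -
  have "(A ** B) \<bullet> C = (\<Sum>i\<in>UNIV. \<Sum>j\<in>UNIV. \<Sum>k\<in>UNIV. (A $ i $ k * B $ k $ j) \<bullet> C $ i $ j)"
    by (simp add: inner_matrix_eq matrix_mult_nth inner_sum_left)
  also have "\<dots> = (\<Sum>i\<in>UNIV. \<Sum>k\<in>UNIV. \<Sum>j\<in>UNIV. (A $ i $ k * B $ k $ j) \<bullet> C $ i $ j)"
    by (intro sum.cong refl sum.swap)
  also have "\<dots> = (\<Sum>k\<in>UNIV. \<Sum>i\<in>UNIV. \<Sum>j\<in>UNIV. (A $ i $ k * B $ k $ j) \<bullet> C $ i $ j)"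
    by (rule sum.swap)
  also have "\<dots> = (\<Sum>k\<in>UNIV. \<Sum>j\<in>UNIV. \<Sum>i\<in>UNIV. (A $ i $ k * B $ k $ j) \<bullet> C $ i $ j)"
    by (intro sum.cong refl sum.swap)
  also have "\<dots> = B \<bullet> (adj A ** C)"
    by (simp add: inner_matrix_eq matrix_mult_nth inner_sum_right adj_nth inner_mult_left_hconj)
  finally show ?thesis .
qed

lemma inner_matrix_mult_right:
  fixes A :: "'a::hurwitz_algebra^'n^'m"
  shows "(A ** B) \<bullet> C = A \<bullet> (C ** adj B)"
  using inner_adj[of "A ** B" C] inner_matrix_mult_left[of "adj B" "adj A" "adj C"]
    inner_adj[of A "C ** adj B"]
  by (simp add: adj_mult)

text \<open>The common ambient group: \<open>Sp\<close> is this set, while \<open>SO\<close> and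
  \<open>SU\<close> are its parts of determinant 1.\<close>

definition unitary :: "('a::hurwitz_algebra^'n^'n) set" where
  "unitary = {r. adj r ** r = mat 1 \<and> r ** adj r = mat 1}"

lemma unitaryD:
  assumes "r \<in> unitary"
  shows "adj r ** r = mat 1" "r ** adj r = mat 1"
    "adj r ** (r ** A) = A" "r ** (adj r ** B) = B"
    "C ** adj r ** r = C" "D ** r ** adj r = D"
proof -
  show 1: "adj r ** r = mat 1" "r ** adj r = mat 1"
    using assms by (simp_all add: unitary_def)
  show "adj r ** (r ** A) = A" "r ** (adj r ** B) = B"
    by (simp_all add: matrix_mul_assoc 1)
  show "C ** adj r ** r = C" "D ** r ** adj r = D"
    by (simp_all add: matrix_mul_assoc[symmetric] 1)
qed

lemma unitary_mult: "r \<in> unitary \<Longrightarrow> q \<in> unitary \<Longrightarrow> r ** q \<in> unitary"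
  by (auto simp: unitary_def adj_mult)
    (metis matrix_mul_assoc matrix_mul_rid)+

lemma unitary_adj: "r \<in> unitary \<Longrightarrow> adj r \<in> unitary"
  by (simp add: unitary_def)

lemma unitary_mat_1: "mat 1 \<in> unitary"
  by (simp add: unitary_def)

lemma inner_unitary_left: "r \<in> unitary \<Longrightarrow> (r ** A) \<bullet> (r ** B) = A \<bullet> B"
  by (simp add: inner_matrix_mult_left unitaryD)

lemma inner_unitary_right: "r \<in> unitary \<Longrightarrow> (A ** r) \<bullet> (B ** r) = A \<bullet> B"
  by (simp add: inner_matrix_mult_right unitaryD)

lemma skew_hermitianD: "A \<in> skew_hermitian \<Longrightarrow> adj A = - A"
  by (simp add: skew_hermitian_def)

lemma skew_hermitian_scaleR: "A \<in> skew_hermitian \<Longrightarrow> c *\<^sub>R A \<in> skew_hermitian"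
  by (simp add: skew_hermitian_def adj_scaleR)

lemma trace_form_skew:
  fixes A B :: "'a::hurwitz_algebra^'n^'n"
  assumes "A \<in> skew_hermitian"
  shows "trace_form A B = 1 / 2 * (A \<bullet> B)"
proof -
  \<comment> \<open>The real trace is the Frobenius pairing with the identity matrix.\<close>
  have "1 \<bullet> trace M = mat 1 \<bullet> M" for M :: "'a^'n^'n"
  proof -
    have "mat 1 \<bullet> M = (\<Sum>i\<in>UNIV. \<Sum>j\<in>UNIV. (if i = j then 1 \<bullet> M $ i $ j else 0))"
      unfolding inner_matrix_eq by (intro sum.cong refl) (simp add: mat_def)
    then show ?thesis
      by (simp add: trace_def inner_sum_right)
  qed
  then have "1 \<bullet> trace (A ** B) = (A ** B) \<bullet> mat 1"
    by (simp add: inner_commute)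
  also have "\<dots> = - (A \<bullet> B)"
    using assms by (simp add: inner_matrix_mult_left skew_hermitianD inner_commute[of B]
        matrix_mult.minus_left)
  finally show ?thesis
    by (simp add: trace_form_def)
qed

section \<open>The matrix exponential\<close>

definition mpow :: "'a::semiring_1^'n^'n \<Rightarrow> nat \<Rightarrow> 'a^'n^'n" where
  "mpow A j = ((**) A ^^ j) (mat 1)"

lemma mpow_simps [simp]: "mpow A 0 = mat 1" "mpow A (Suc j) = A ** mpow A j"
  by (simp_all add: mpow_def)

lemma mpow_scaleR: "mpow (t *\<^sub>R (A :: 'a::hurwitz_algebra^'n^'n)) j = t ^ j *\<^sub>R mpow A j"
  by (induction j) (simp_all add: matrix_mult_linear_simps)

lemma mpow_commute: "A ** C = C ** A \<Longrightarrow> mpow A j ** C = C ** mpow A j"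
  by (induction j) (simp_all, metis matrix_mul_assoc)

text \<open>Boundedness of the bilinear product gives a constant with |X Y| bounded by that constant
  times |X| |Y|, so powers grow at most geometrically. This suffices for the exponential series to
  converge.\<close>

lemma norm_mpow_bound:
  fixes A :: "'a::hurwitz_algebra^'n^'n"
  obtains K where "\<And>j. norm (mpow A j) \<le> norm (mat 1 :: 'a^'n^'n) * K ^ j"
proof -
  obtain K where K: "\<And>(X :: 'a^'n^'n) (Y :: 'a^'n^'n). norm (X ** Y) \<le> norm X * norm Y * K"
    using matrix_mult.nonneg_bounded by blast
  obtain L where L: "L = norm A * \<bar>K\<bar>" "0 \<le> L"
    by simp
  have 1: "norm (A ** Y) \<le> L * norm Y" for Y :: "'a^'n^'n"
    using K[of A Y] mult_left_mono[OF abs_ge_self[of K], of "norm A * norm Y"]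
    by (simp add: L mult_ac)
  have "norm (mpow A j) \<le> norm (mat 1 :: 'a^'n^'n) * L ^ j" for j
  proof (induction j)
    case (Suc j)
    have "norm (mpow A (Suc j)) \<le> L * norm (mpow A j)"
      using 1 by simp
    also have "\<dots> \<le> L * (norm (mat 1 :: 'a^'n^'n) * L ^ j)"
      using Suc L(2) by (rule mult_left_mono)
    finally show ?case
      by (simp add: mult_ac)
  qed simp
  then show ?thesis
    using that by blast
qed

lemma mexp_summable:
  fixes A :: "'a::hurwitz_algebra^'n^'n"
  shows "summable (\<lambda>j. (1 / fact j) *\<^sub>R mpow A j)"
proof -
  obtain K where K: "\<And>j. norm (mpow A j) \<le> norm (mat 1 :: 'a^'n^'n) * K ^ j"
    using norm_mpow_bound by blast
  have "norm ((1 / fact j) *\<^sub>R mpow A j) \<le> norm (mat 1 :: 'a^'n^'n) * (inverse (fact j) * K ^ j)" for j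
    using K[of j] by (simp add: field_simps)
  moreover have "summable (\<lambda>j. norm (mat 1 :: 'a^'n^'n) * (inverse (fact j) * K ^ j))"
    by (intro summable_mult summable_exp)
  ultimately show ?thesis
    by (rule summable_comparison_test'[where N = 0, rotated])
qed

lemma mexp_eq: "mexp A = (\<Sum>j. (1 / fact j) *\<^sub>R mpow A j)"
  by (simp add: mexp_def mpow_def)

lemma mexp_commute:
  fixes A C :: "'a::hurwitz_algebra^'n^'n"
  assumes "A ** C = C ** A"
  shows "mexp A ** C = C ** mexp A"
  unfolding mexp_eq bounded_linear.suminf[OF matrix_mult.bounded_linear_left mexp_summable]
    bounded_linear.suminf[OF matrix_mult.bounded_linear_right mexp_summable]
  by (simp add: matrix_mult_linear_simps mpow_commute[OF assms])

text \<open>Pairing with each basis matrix \<open>b\<close> turns the series into a real power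
  series in \<open>t\<close>, which may be differentiated term by term.\<close>

lemma mexp_has_vector_derivative:
  fixes A :: "'a::hurwitz_algebra^'n^'n"
  shows "((\<lambda>t. mexp (t *\<^sub>R A)) has_vector_derivative A ** mexp (t *\<^sub>R A)) (at t)"
  unfolding has_vector_derivative_def
proof (subst has_derivative_componentwise_within, intro ballI)
  fix b :: "'a^'n^'n"
  define c where "c j = (mpow A j \<bullet> b) / fact j" for j
  have tm: "((1 / fact j) *\<^sub>R mpow (y *\<^sub>R A) j) \<bullet> b = c j * y ^ j" for y j
    by (simp add: c_def mpow_scaleR)
  have summ: "summable (\<lambda>j. c j * y ^ j)" for y
    using bounded_linear.summable[OF bounded_linear_inner_left mexp_summable, of "y *\<^sub>R A" b]
    by (simp add: c_def mpow_scaleR mult.commute)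
  have val: "mexp (y *\<^sub>R A) \<bullet> b = (\<Sum>j. c j * y ^ j)" for y
    unfolding mexp_eq bounded_linear.suminf[OF bounded_linear_inner_left mexp_summable] tm ..
  have "((**) A (mexp (t *\<^sub>R A))) \<bullet> b = (\<Sum>j. (A ** ((1 / fact j) *\<^sub>R mpow (t *\<^sub>R A) j)) \<bullet> b)"
    unfolding mexp_eq
    by (rule bounded_linear.suminf[OF _ mexp_summable])
       (intro bounded_linear_compose[OF bounded_linear_inner_left] matrix_mult.bounded_linear_right)
  also have "\<dots> = (\<Sum>j. diffs c j * t ^ j)"
  proof (intro suminf_cong)
    fix j
    \<comment> \<open>\<open>diffs\<close> shifts the index and multiplies by \<open>j + 1\<close>,
      which cancels against \<open>fact (Suc j)\<close>.\<close>
    have "diffs c j = (mpow A (Suc j) \<bullet> b) / fact j"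
      unfolding diffs_def c_def by (simp del: mpow_simps of_nat_Suc)
    then show "(A ** ((1 / fact j) *\<^sub>R mpow (t *\<^sub>R A) j)) \<bullet> b = diffs c j * t ^ j"
      by (simp add: mpow_scaleR matrix_mult_linear_simps)
  qed
  finally have der: "(A ** mexp (t *\<^sub>R A)) \<bullet> b = (\<Sum>j. diffs c j * t ^ j)" .
  have "((\<lambda>y. \<Sum>j. c j * y ^ j) has_field_derivative (\<Sum>j. diffs c j * t ^ j)) (at t)"
    by (rule termdiffs_strong_converges_everywhere) (rule summ)
  then show "((\<lambda>x. mexp (x *\<^sub>R A) \<bullet> b) has_derivative (\<lambda>x. (x *\<^sub>R (A ** mexp (t *\<^sub>R A))) \<bullet> b)) (at t)"
    unfolding val der[symmetric] has_field_derivative_def by (simp add: mult_commute_abs)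
qed

lemma mexp_0 [simp]: "mexp (0 :: 'a::hurwitz_algebra^'n^'n) = mat 1"
proof -
  have "(1 / fact j) *\<^sub>R mpow (0 :: 'a^'n^'n) j = (if j = 0 then mat 1 else 0)" for j
    by (cases j) simp_all
  then show ?thesis
    using sums_unique[OF sums_single[of 0 "\<lambda>_. mat 1 :: 'a^'n^'n"]] by (simp add: mexp_eq)
qed

lemma has_vector_derivative_matrix_mult:
  fixes f :: "real \<Rightarrow> 'a::hurwitz_algebra^'n^'m"
  assumes "(f has_vector_derivative f') (at t)" "(g has_vector_derivative g') (at t)"
  shows "((\<lambda>t. f t ** g t) has_vector_derivative f' ** g t + f t ** g') (at t)"
  using matrix_mult.has_vector_derivative[OF assms] by (simp add: add.commute)

lemma has_vector_derivative_adj: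
  fixes f :: "real \<Rightarrow> 'a::hurwitz_algebra^'n^'m"
  shows "(f has_vector_derivative f') (at t) \<Longrightarrow>
    ((\<lambda>t. adj (f t)) has_vector_derivative adj f') (at t)"
  by (rule bounded_linear.has_vector_derivative[OF bounded_linear_adj])

lemma has_vector_derivative_0_imp_const:
  fixes f :: "real \<Rightarrow> 'b::real_normed_vector"
  assumes "\<And>t. (f has_vector_derivative 0) (at t)"
  shows "f s = f t"
  using has_vector_derivative_zero_constant[of UNIV f] assms by (metis UNIV_I convex_UNIV)

text \<open>Variation of constants: the derivative cancels because \<open>A\<close> commutes with
  its exponential. \<open>Y\<close> may be rectangular, so single columns are covered as
  well.\<close>

lemma mexp_minus_ode:
  fixes A :: "'a::hurwitz_algebra^'n^'n" and Y :: "real \<Rightarrow> 'a^'k^'n"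
  assumes Y: "\<And>t. (Y has_vector_derivative A ** Y t) (at t)"
  shows "mexp (t *\<^sub>R (- A)) ** Y t = Y 0"
proof -
  have "((\<lambda>t. mexp (t *\<^sub>R (- A)) ** Y t) has_vector_derivative 0) (at t)" for t
  proof -
    have "- A ** mexp (t *\<^sub>R (- A)) = mexp (t *\<^sub>R (- A)) ** (- A)"
      by (rule mexp_commute[symmetric]) (simp add: matrix_mult_linear_simps)
    then have "- A ** mexp (t *\<^sub>R (- A)) ** Y t + mexp (t *\<^sub>R (- A)) ** (A ** Y t) = 0"
      by (simp add: matrix_mult_linear_simps matrix_mul_assoc)
    then show ?thesis
      using has_vector_derivative_matrix_mult[OF mexp_has_vector_derivative[of "- A" t] Y]
      by simp
  qed
  from has_vector_derivative_0_imp_const[OF this, of t 0] show ?thesis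
    by simp
qed

lemma mexp_inverse:
  fixes A :: "'a::hurwitz_algebra^'n^'n"
  shows "mexp (- A) ** mexp A = mat 1" "mexp A ** mexp (- A) = mat 1"
  using mexp_minus_ode[of "\<lambda>t. mexp (t *\<^sub>R A)" A 1, OF mexp_has_vector_derivative]
    mexp_minus_ode[of "\<lambda>t. mexp (t *\<^sub>R (- A))" "- A" 1, OF mexp_has_vector_derivative]
  by simp_all

text \<open>The addition law, the adjoint, block-diagonal exponentials and the action on
  eigenvectors are all obtained from this, by checking that the candidate solves the linear
  equation.\<close>

lemma mexp_ode_unique:
  fixes A :: "'a::hurwitz_algebra^'n^'n" and Y :: "real \<Rightarrow> 'a^'k^'n"
  assumes "\<And>t. (Y has_vector_derivative A ** Y t) (at t)"
  shows "Y t = mexp (t *\<^sub>R A) ** Y 0"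
  using mexp_minus_ode[of Y A t, OF assms] mexp_inverse(2)[of "t *\<^sub>R A"]
  by (metis matrix_mul_assoc matrix_mul_lid scaleR_minus_right)

lemma has_vector_derivative_mexp:
  fixes A :: "'a::hurwitz_algebra^'n^'n"
  assumes "(f has_real_derivative c) (at t)"
  shows "((\<lambda>t. mexp (f t *\<^sub>R A)) has_vector_derivative c *\<^sub>R (A ** mexp (f t *\<^sub>R A))) (at t)"
  using vector_diff_chain_at[OF assms[unfolded has_real_derivative_iff_has_vector_derivative]
      mexp_has_vector_derivative]
  by (simp add: o_def)

lemma mexp_add:
  fixes A :: "'a::hurwitz_algebra^'n^'n"
  shows "mexp ((s + t) *\<^sub>R A) = mexp (s *\<^sub>R A) ** mexp (t *\<^sub>R A)"
proof -
  have "((\<lambda>s. mexp ((s + t) *\<^sub>R A)) has_vector_derivative A ** mexp ((s + t) *\<^sub>R A)) (at s)" for s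
    using has_vector_derivative_mexp[of "\<lambda>s. s + t" 1 s A] 
      DERIV_add[OF DERIV_ident DERIV_const[of t], of s]
    by simp
  from mexp_ode_unique[of "\<lambda>s. mexp ((s + t) *\<^sub>R A)" A, OF this] show ?thesis
    by simp
qed

lemma mexp_self_commute:
  fixes A :: "'a::hurwitz_algebra^'n^'n"
  shows "mexp (t *\<^sub>R A) ** A = A ** mexp (t *\<^sub>R A)"
  by (rule mexp_commute) (simp add: matrix_mult_linear_simps)

lemma adj_mexp:
  fixes A :: "'a::hurwitz_algebra^'n^'n"
  shows "adj (mexp A) = mexp (adj A)"
proof -
  have "((\<lambda>t. adj (mexp (t *\<^sub>R A))) has_vector_derivative adj A ** adj (mexp (t *\<^sub>R A))) (at t)" for t
    using has_vector_derivative_adj[OF mexp_has_vector_derivative[of A t]]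
    by (simp add: adj_mult[symmetric] mexp_self_commute)
  from mexp_ode_unique[of "\<lambda>t. adj (mexp (t *\<^sub>R A))" "adj A", OF this, of 1] show ?thesis
    by simp
qed

lemma mexp_skew_unitary: "A \<in> skew_hermitian \<Longrightarrow> mexp (t *\<^sub>R A) \<in> unitary"
  using mexp_inverse[of "t *\<^sub>R A"]
  by (simp add: unitary_def adj_mexp adj_scaleR skew_hermitianD)

section \<open>Block matrices\<close>

lemma block_nth [simp]:
  "block E B C F $ Inl i $ Inl j = E $ i $ j" "block E B C F $ Inl i $ Inr l = B $ i $ l"
  "block E B C F $ Inr m $ Inl j = C $ m $ j" "block E B C F $ Inr m $ Inr l = F $ m $ l"
  by (simp_all add: block_def)

lemma sum_UNIV_Plus:
  fixes f :: "'k::finite + 'l::finite \<Rightarrow> 'b::comm_monoid_add"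
  shows "(\<Sum>i\<in>UNIV. f i) = (\<Sum>i\<in>UNIV. f (Inl i)) + (\<Sum>i\<in>UNIV. f (Inr i))"
  unfolding UNIV_Plus_UNIV[symmetric] by (subst sum.Plus) simp_all

lemma vec_eq_iff_Plus:
  fixes x y :: "'b^('k::finite + 'l::finite)"
  shows "x = y \<longleftrightarrow> (\<forall>i. x $ Inl i = y $ Inl i) \<and> (\<forall>i. x $ Inr i = y $ Inr i)"
  unfolding vec_eq_iff by (metis sum.exhaust)

lemma block_mult:
  "block E B C F ** block E' B' C' F' =
    block (E ** E' + B ** C') (E ** B' + B ** F') (C ** E' + F ** C') (C ** B' + F ** F')"
  by (simp add: vec_eq_iff_Plus matrix_mult_nth sum_UNIV_Plus)

lemma block_add: "block E B C F + block E' B' C' F' = block (E + E') (B + B') (C + C') (F + F')"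
  and block_scaleR: "c *\<^sub>R block A1 B1 C1 D1 = block (c *\<^sub>R A1) (c *\<^sub>R B1) (c *\<^sub>R C1) (c *\<^sub>R D1)"
  and block_minus: "- block A2 B2 C2 D2 = block (- A2) (- B2) (- C2) (- D2)"
  and block_0: "block 0 0 0 0 = 0"
  and block_mat_1: "block (mat 1) 0 0 (mat 1) = mat 1"
  by (simp_all add: vec_eq_iff_Plus mat_def)

lemma adj_block: "adj (block E B C F) = block (adj E) (adj C) (adj B) (adj F)"
  by (simp add: vec_eq_iff_Plus adj_nth)

lemma bounded_linear_block_diag:
  "bounded_linear (\<lambda>X :: ('a::hurwitz_algebra^'k^'k) \<times> ('a^'l^'l). block (fst X) 0 0 (snd X))"
  unfolding linear_conv_bounded_linear [symmetric]
  by (rule linearI) (simp_all add: block_add block_scaleR)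

lemma mexp_block_diag:
  fixes E :: "'a::hurwitz_algebra^'k^'k" and F :: "'a^'l^'l"
  shows "mexp (block E 0 0 F) = block (mexp E) 0 0 (mexp F)"
proof -
  have "((\<lambda>t. block (mexp (t *\<^sub>R E)) 0 0 (mexp (t *\<^sub>R F))) has_vector_derivative
      block E 0 0 F ** block (mexp (t *\<^sub>R E)) 0 0 (mexp (t *\<^sub>R F))) (at t)" for t
    using bounded_linear.has_vector_derivative[OF bounded_linear_block_diag
        has_vector_derivative_Pair[OF mexp_has_vector_derivative[of E t] mexp_has_vector_derivative[of F t]]]
    by (simp add: block_mult)
  from mexp_ode_unique[of "\<lambda>t. block (mexp (t *\<^sub>R E)) 0 0 (mexp (t *\<^sub>R F))", OF this, of 1]
  show ?thesis
    by (simp add: block_mat_1)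
qed

lemma offdiag_skew: "offdiag (B :: 'a::hurwitz_algebra^'l^'k) \<in> skew_hermitian"
  by (simp add: offdiag_def skew_hermitian_def adj_block adj_minus block_minus)

lemma offdiag_scaleR: "c *\<^sub>R offdiag B = offdiag (c *\<^sub>R B)"
  by (simp add: offdiag_def block_scaleR adj_scaleR)

section \<open>Smooth maps\<close>

text \<open>Used for the product rule: each term of the derivative retains an undifferentiated
  factor, which must be known at the lower order too.\<close>

lemma Ck_Suc_imp_Ck: "Ck (Suc n) f \<Longrightarrow> Ck n f"
proof (induction n arbitrary: f)
  case 0
  then show ?case
    by (auto intro!: continuous_at_imp_continuous_on differentiable_imp_continuous_within)
qed simp

lemma Ck_SucI:
  assumes "\<And>x. (f has_derivative f' x) (at x)" "\<And>v. Ck n (\<lambda>x. f' x v)"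
  shows "Ck (Suc n) f"
proof -
  have "frechet_derivative f (at x) = f' x" for x
    using frechet_derivative_at[OF assms(1)] by simp
  then show ?thesis
    using assms by (auto simp: differentiable_def)
qed

lemma Ck_Suc_has_derivative:
  "Ck (Suc n) f \<Longrightarrow> (f has_derivative frechet_derivative f (at x)) (at x)"
  by (simp add: frechet_derivative_works[symmetric])

lemma Ck_const: "Ck n (\<lambda>_. c)"
proof (induction n arbitrary: c)
  case (Suc n)
  show ?case
    by (rule Ck_SucI[OF has_derivative_const]) (rule Suc.IH)
qed simp

lemma Ck_bounded_linear: "bounded_linear f \<Longrightarrow> Ck n f"
  by (cases n) (auto intro!: Ck_SucI bounded_linear_imp_has_derivative Ck_const linear_continuous_on
      simp del: Ck.simps(2))

lemma Ck_add: "Ck n f \<Longrightarrow> Ck n g \<Longrightarrow> Ck n (\<lambda>x. f x + g x)"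
proof (induction n arbitrary: f g)
  case 0
  then show ?case
    by (simp add: continuous_on_add)
next
  case (Suc n)
  show ?case
    by (rule Ck_SucI[OF has_derivative_add[OF Suc.prems[THEN Ck_Suc_has_derivative]]])
      (use Suc in auto)
qed

lemma Ck_linear_compose: "bounded_linear L \<Longrightarrow> Ck n f \<Longrightarrow> Ck n (\<lambda>x. L (f x))"
proof (induction n arbitrary: f)
  case 0
  then show ?case
    by (simp add: bounded_linear.continuous_on)
next
  case (Suc n)
  show ?case
    by (rule Ck_SucI[OF bounded_linear.has_derivative[OF Suc.prems(1) Ck_Suc_has_derivative[OF Suc.prems(2)]]])
      (use Suc in auto)
qed

lemma Ck_bilinear:
  assumes B: "bounded_bilinear B"
  shows "Ck n f \<Longrightarrow> Ck n g \<Longrightarrow> Ck n (\<lambda>x. B (f x) (g x))"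
proof (induction n arbitrary: f g)
  case 0
  then show ?case
    by (simp add: bounded_bilinear.continuous_on[OF B])
next
  case (Suc n)
  note fg = Suc.prems
  show ?case
    by (rule Ck_SucI[OF bounded_bilinear.FDERIV[OF B fg[THEN Ck_Suc_has_derivative]]], intro Ck_add Suc.IH)
      (use fg fg[THEN Ck_Suc_imp_Ck] in auto)
qed

lemma Ck_sum: "(\<And>i. i \<in> I \<Longrightarrow> Ck n (f i)) \<Longrightarrow> Ck n (\<lambda>x. \<Sum>i\<in>I. f i x)"
  by (induction I rule: infinite_finite_induct) (auto intro: Ck_const Ck_add)

text \<open>\<open>Ck\<close> speaks of derivatives in constant directions only. The variable
  direction \<open>X x\<close> is expanded in the basis, which leaves products of a coordinate of
  \<open>X\<close> with such a derivative.\<close>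

lemma Ck_frechet_derivative:
  fixes Y :: "'b::euclidean_space \<Rightarrow> 'c::euclidean_space"
  assumes Y: "Ck (Suc n) Y" and X: "Ck n X"
  shows "Ck n (\<lambda>x. frechet_derivative Y (at x) (X x))"
proof -
  have "frechet_derivative Y (at x) (X x) = (\<Sum>b\<in>Basis. (X x \<bullet> b) *\<^sub>R frechet_derivative Y (at x) b)" for x
  proof -
    interpret linear "frechet_derivative Y (at x)"
      using Ck_Suc_has_derivative[OF Y] by (rule has_derivative_linear)
    show ?thesis
      by (subst euclidean_representation[of "X x", symmetric]) (simp only: sum scale)
  qed
  moreover have "Ck n (\<lambda>x. (X x \<bullet> b) *\<^sub>R frechet_derivative Y (at x) b)" for b
    using Y by (intro Ck_bilinear[OF bounded_bilinear_scaleR]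
        Ck_linear_compose[OF bounded_linear_inner_left X]) simp
  ultimately show ?thesis
    by (simp add: Ck_sum)
qed

lemma smooth_has_derivative:
  "smooth f \<Longrightarrow> (f has_derivative frechet_derivative f (at x)) (at x)"
  unfolding smooth_def by (rule Ck_Suc_has_derivative) (erule spec)

lemma smooth_bounded_linear: "bounded_linear f \<Longrightarrow> smooth f"
  by (simp add: smooth_def Ck_bounded_linear)

lemma smooth_add: "smooth f \<Longrightarrow> smooth g \<Longrightarrow> smooth (\<lambda>x. f x + g x)"
  by (simp add: smooth_def Ck_add)

lemma smooth_linear_compose: "bounded_linear L \<Longrightarrow> smooth f \<Longrightarrow> smooth (\<lambda>x. L (f x))"
  by (simp add: smooth_def Ck_linear_compose)

lemma smooth_bilinear: "bounded_bilinear B \<Longrightarrow> smooth f \<Longrightarrow> smooth g \<Longrightarrow> smooth (\<lambda>x. B (f x) (g x))"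
  by (simp add: smooth_def Ck_bilinear)

lemma smooth_minus: "smooth f \<Longrightarrow> smooth (\<lambda>x. - f x)"
  by (rule smooth_linear_compose[OF bounded_linear_minus[OF bounded_linear_ident]])

lemma smooth_diff: "smooth f \<Longrightarrow> smooth g \<Longrightarrow> smooth (\<lambda>x. f x - g x)"
  using smooth_add[of f "\<lambda>x. - g x"] smooth_minus[of g] by simp

lemma smooth_frechet_derivative:
  "smooth Y \<Longrightarrow> smooth X \<Longrightarrow> smooth (\<lambda>x. frechet_derivative Y (at x) (X x))"
  unfolding smooth_def using Ck_frechet_derivative by blast

section \<open>The unitary group acts transitively on frames\<close>

lemma inner_eq_mat_1: "u \<bullet> v = mat 1 \<bullet> (adj u ** v)" for u v :: "'a::hurwitz_algebra^'k^'n"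
  using inner_matrix_mult_left[of u "mat 1" v] by simp

text \<open>Scalars are kept as 1 by 1 matrices so that every product with columns in
  \<open>householder\<close> is a matrix product.\<close>

lemma matrix_1_1_inverse:
  fixes a :: "'a::hurwitz_algebra^1^1"
  assumes "a \<noteq> 0"
  obtains b where "a ** b = mat 1" "b ** a = mat 1"
proof -
  have "a $ 1 $ 1 \<noteq> 0"
    using assms by (auto simp: vec_eq_iff)
  then show ?thesis
    by (intro that[of "\<chi> i j. inverse (a $ 1 $ 1)"]) (simp_all add: vec_eq_iff matrix_mult_nth mat_def)
qed

text \<open>
  With \<open>u = x - y\<close>, the usual reflection \<open>1 - 2 u u\<^sup>* / |u|\<^sup>2\<close> maps \<open>x\<close> to \<open>y\<close> only if \<open>u\<^sup>* x\<close> is real.  The map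
  \<open>1 - u (u\<^sup>* x)\<^sup>-\<^sup>1 u\<^sup>*\<close> always does, and it is unitary because \<open>u\<^sup>* u = u\<^sup>* x + (u\<^sup>* x)\<^sup>*\<close>.
\<close>

lemma householder:
  fixes x y :: "'a::hurwitz_algebra^1^'n"
  assumes x: "adj x ** x = mat 1" and y: "adj y ** y = mat 1"
  obtains r where "r \<in> unitary" "r ** x = y"
    "\<And>z :: 'a^1^'n. adj x ** z = 0 \<Longrightarrow> adj y ** z = 0 \<Longrightarrow> r ** z = z"
proof (cases "adj (x - y) ** x = 0")
  case True
  \<comment> \<open>Degenerate case: two columns of equal length with
    \<open>(x - y) \<bullet> x = 0\<close> coincide.\<close>
  have "x \<bullet> x = y \<bullet> y"
    by (simp only: inner_eq_mat_1[of x x] inner_eq_mat_1[of y y] x y)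
  moreover have "(x - y) \<bullet> x = 0"
    using inner_eq_mat_1[of "x - y" x] True by simp
  ultimately have "(x - y) \<bullet> (x - y) = 0"
    using inner_commute[of x y] by (simp add: inner_diff_left inner_diff_right)
  then have "x = y"
    by simp
  then show ?thesis
    by (intro that[of "mat 1"]) (simp_all add: unitary_mat_1)
next
  case False
  define u where "u = x - y"
  define a where "a = adj u ** x"
  obtain b where ab: "a ** b = mat 1" "b ** a = mat 1"
    using matrix_1_1_inverse[of a] False by (auto simp: a_def u_def)
  have ab': "adj b ** adj a = mat 1" "adj a ** adj b = mat 1"
    using ab by (simp_all flip: adj_mult)
  have uu: "adj u ** u = a + adj a"
    by (simp add: a_def u_def adj_simps matrix_mult_linear_simps x y)
  define r where "r = mat 1 - u ** b ** adj u"
  have ar: "adj r = mat 1 - u ** adj b ** adj u"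
    by (simp add: r_def adj_simps matrix_mul_assoc)
  \<comment> \<open>Unitarity is thereby reduced to \<open>c ** (a + adj a) ** d = c + d\<close> for
    \<open>c\<close> and \<open>d\<close> equal to \<open>b\<close> and \<open>adj b\<close> in
    either order.\<close>
  have prod: "(mat 1 - u ** c ** adj u) ** (mat 1 - u ** d ** adj u) =
      mat 1 - u ** (c + d - c ** (a + adj a) ** d) ** adj u" for c d :: "'a^1^1"
  proof -
    have "u ** c ** adj u ** (u ** d ** adj u) = u ** (c ** (adj u ** u) ** d) ** adj u"
      by (simp only: matrix_mul_assoc)
    then show ?thesis
      by (simp add: uu matrix_mult_linear_simps algebra_simps)
  qed
  have 1: "adj b ** (a + adj a) ** b = b + adj b" "b ** (a + adj a) ** adj b = b + adj b"
    by (simp_all add: matrix_mult_linear_simps ab ab') (simp_all add: ab ab' flip: matrix_mul_assoc)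
  show ?thesis
  proof
    show "r \<in> unitary"
      unfolding unitary_def by (simp add: ar) (simp add: r_def prod 1 add.commute)
    have "r ** x = x - u ** (b ** a)"
      by (simp add: r_def a_def matrix_mult_linear_simps matrix_mul_assoc)
    then show "r ** x = y"
      by (simp add: ab u_def)
    show "r ** z = z" if "adj x ** z = 0" "adj y ** z = 0" for z :: "'a^1^'n"
      using that by (simp add: r_def u_def adj_diff matrix_mult_linear_simps flip: matrix_mul_assoc)
  qed
qed

definition basis_column :: "'k \<Rightarrow> 'a::hurwitz_algebra^1^'k" where
  "basis_column j = (\<chi> i _. if i = j then 1 else 0)"

lemma mult_basis_column_nth: "(m ** basis_column j) $ i $ k = m $ i $ j"
  by (simp add: matrix_mult_nth basis_column_def if_distrib cong: if_cong)

lemma adj_basis_column_mult: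
  "adj (basis_column i) ** basis_column j = (if i = j then mat 1 else 0)"
  by (simp add: vec_eq_iff mult_basis_column_nth adj_nth) (simp add: basis_column_def mat_def)

lemma Ink_stiefel: "adj Ink ** (Ink :: 'a::hurwitz_algebra^'k^('k::finite + 'l::finite)) = mat 1"
  by (simp add: vec_eq_iff matrix_mult_nth adj_nth Ink_def sum_UNIV_Plus mat_def
      if_distrib[of hconj] if_distrib[of "\<lambda>x. x * _"] cong: if_cong)

text \<open>Columns are matched one at a time. The reflection that corrects column \<open>j\<close>
  fixes the columns already matched, because these are orthogonal both to the present column
  \<open>j\<close> and to its target.\<close>

lemma unitary_transitive:
  fixes m m' :: "'a::hurwitz_algebra^'k^'n"
  assumes m: "adj m ** m = mat 1" "adj m' ** m' = mat 1"
  obtains r where "r \<in> unitary" "r ** m = m'"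
proof -
  have "\<exists>r\<in>unitary. \<forall>j\<in>J. r ** m ** basis_column j = m' ** basis_column j" if "finite J" for J :: "'k set"
    using that
  proof (induction J)
    case empty
    then show ?case
      using unitary_mat_1 by auto
  next
    case (insert j J)
    then obtain r where r: "r \<in> unitary" "\<And>i. i \<in> J \<Longrightarrow> r ** m ** basis_column i = m' ** basis_column i"
      by blast
    have col: "adj (X ** basis_column i) ** (X ** basis_column j) = (if i = j then mat 1 else 0)"
      if "adj X ** X = mat 1" for X :: "'a^'k^'n" and i j :: 'k
    proof -
      have "adj (X ** basis_column i) ** (X ** basis_column j) = adj (basis_column i) ** (adj X ** X) ** (basis_column j :: 'a^1^'k)"
        by (simp add: adj_mult matrix_mul_assoc)
      then show ?thesis
        by (simp add: that adj_basis_column_mult)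
    qed
    have rm: "adj (r ** m) ** (r ** m) = mat 1"
      using r(1) m(1) by (simp add: adj_mult unitaryD flip: matrix_mul_assoc)
    obtain q where q: "q \<in> unitary" "q ** (r ** m ** basis_column j) = m' ** basis_column j"
      "\<And>z :: 'a^1^'n. adj (r ** m ** basis_column j) ** z = 0 \<Longrightarrow> adj (m' ** basis_column j) ** z = 0 \<Longrightarrow> q ** z = z"
      using householder[of "r ** m ** basis_column j" "m' ** basis_column j"] col[OF rm, of j j] col[OF m(2), of j j]
      by auto
    have "q ** r ** m ** basis_column i = m' ** basis_column i" if "i \<in> J" for i
    proof -
      have "j \<noteq> i"
        using insert that by auto
      then have "q ** (r ** m ** basis_column i) = r ** m ** basis_column i"
        using q(3)[of "r ** m ** basis_column i"] col[OF rm, of j i] col[OF m(2), of j i] r(2)[OF that] by simp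
      then show ?thesis
        using r(2)[OF that] by (simp flip: matrix_mul_assoc)
    qed
    moreover have "q ** r ** m ** basis_column j = m' ** basis_column j"
      using q(2) by (simp add: matrix_mul_assoc)
    ultimately show ?case
      using unitary_mult[OF q(1) r(1)] by auto
  qed
  from this[of UNIV] obtain r where "r \<in> unitary"
    "\<And>j. r ** m ** basis_column j = m' ** basis_column j"
    by auto
  then show ?thesis
    using that[of r] by (metis vec_eq_iff mult_basis_column_nth)
qed

section \<open>The Stiefel manifold and its homogeneous metric\<close>

lemma has_vector_derivative_chain:
  assumes "(c has_vector_derivative v) (at t)" "(Y has_derivative Y') (at (c t))"
  shows "((\<lambda>t. Y (c t)) has_vector_derivative Y' v) (at t)"
proof -
  interpret linear Y' using assms(2) by (rule has_derivative_linear)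
  show ?thesis
    using has_derivative_compose[OF assms(1)[unfolded has_vector_derivative_def] assms(2)]
    by (simp add: has_vector_derivative_def scale)
qed

text \<open>The linearization of \<open>adj m ** m = mat 1\<close>;
  \<open>tangent_space_stiefel\<close> identifies it with the space of velocities of curves.\<close>

definition stiefel_tangent :: "'a::hurwitz_algebra^'k^'n \<Rightarrow> ('a^'k^'n) set" where
  "stiefel_tangent m = {v. adj m ** v \<in> skew_hermitian}"

lemma stiefel_tangent_iff: "v \<in> stiefel_tangent m \<longleftrightarrow> adj v ** m = - (adj m ** v)"
  by (simp add: stiefel_tangent_def skew_hermitian_def adj_mult)

lemma stiefel_tangent_diff:
  "v \<in> stiefel_tangent m \<Longrightarrow> w \<in> stiefel_tangent m \<Longrightarrow> v - w \<in> stiefel_tangent m"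
  by (simp add: stiefel_tangent_iff adj_simps matrix_mult_linear_simps)

lemma stiefelD: "m \<in> stiefel \<Longrightarrow> adj m ** m = mat 1"
  by (simp add: stiefel_def)

lemma velocity_in_stiefel_tangent:
  fixes c :: "real \<Rightarrow> 'a::hurwitz_algebra^'k^'n"
  assumes c: "\<And>t. c t \<in> stiefel" "(c has_vector_derivative v) (at t)"
  shows "v \<in> stiefel_tangent (c t)"
proof -
  have "((\<lambda>t. adj (c t) ** c t) has_vector_derivative adj v ** c t + adj (c t) ** v) (at t)"
    by (intro has_vector_derivative_matrix_mult has_vector_derivative_adj c)
  moreover have "(\<lambda>t. adj (c t) ** c t) = (\<lambda>t. mat 1)"
    using c(1) by (simp add: stiefelD)
  ultimately have "adj v ** c t + adj (c t) ** v = 0"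
    using vector_derivative_unique_at[OF _ has_vector_derivative_const] by metis
  then show ?thesis
    by (simp add: stiefel_tangent_iff add_eq_0_iff2)
qed

lemma bounded_linear_matrix_mult_both:
  "bounded_linear (\<lambda>X :: 'a::hurwitz_algebra^'p^'n. L ** X ** R)"
  by (intro bounded_linear_compose[OF matrix_mult.bounded_linear_left] matrix_mult.bounded_linear_right)

lemma stiefel_mult:
  assumes "m \<in> stiefel" "r \<in> unitary" "s \<in> unitary"
  shows "r ** m ** s \<in> stiefel"
proof -
  have "adj (r ** m ** s) ** (r ** m ** s) = adj s ** (adj m ** (adj r ** r) ** m) ** s"
    by (simp add: adj_mult matrix_mul_assoc)
  then show ?thesis
    using assms by (simp add: stiefel_def unitaryD)
qed

lemma quasi_geodesic_in_stiefel:
  fixes r :: "'a::hurwitz_algebra^('k::finite + 'l::finite)^('k + 'l)"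
  assumes "r \<in> unitary" "s \<in> unitary" "A \<in> skew_hermitian"
  shows "quasi_geodesic r s B A t \<in> stiefel"
proof -
  have "r ** mexp (t *\<^sub>R offdiag B) ** Ink ** (mexp (- t *\<^sub>R A) ** adj s) \<in> stiefel"
    by (intro stiefel_mult unitary_mult unitary_adj assms mexp_skew_unitary offdiag_skew)
      (simp add: stiefel_def Ink_stiefel)
  then show ?thesis
    by (simp add: quasi_geodesic_def matrix_mul_assoc)
qed

text \<open>The generators are conjugated by \<open>r\<close> and \<open>s\<close> so that the
  velocity becomes a function of the current point alone: the curve is an integral curve of a field
  linear in the point.\<close>

lemma quasi_geodesic_has_vector_derivative:
  fixes r :: "'a::hurwitz_algebra^('k::finite + 'l::finite)^('k + 'l)"
  assumes r: "r \<in> unitary" and s: "s \<in> unitary"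
  shows "(quasi_geodesic r s B A has_vector_derivative
      (r ** offdiag B ** adj r) ** quasi_geodesic r s B A t - quasi_geodesic r s B A t ** (s ** A ** adj s)) (at t)"
proof -
  let ?U = "\<lambda>t. mexp (t *\<^sub>R offdiag B)" and ?S = "\<lambda>t. mexp (t *\<^sub>R (- A))"
  have "((\<lambda>t. r ** (?U t ** Ink ** ?S t) ** adj s) has_vector_derivative
      r ** ((offdiag B ** ?U t ** Ink) ** ?S t + ?U t ** Ink ** (- A ** ?S t)) ** adj s) (at t)"
    by (intro bounded_linear.has_vector_derivative[OF bounded_linear_matrix_mult_both]
        has_vector_derivative_matrix_mult mexp_has_vector_derivative
        bounded_linear.has_vector_derivative[OF matrix_mult.bounded_linear_left])
  moreover have "r ** (?U t ** Ink ** ?S t) ** adj s = quasi_geodesic r s B A t" for t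
    by (simp add: quasi_geodesic_def matrix_mul_assoc)
  moreover have "r ** (offdiag B ** ?U t ** Ink ** ?S t) ** adj s =
      (r ** offdiag B ** adj r) ** quasi_geodesic r s B A t"
    using r by (simp add: quasi_geodesic_def matrix_mul_assoc unitaryD)
  moreover have "r ** (?U t ** Ink ** (- A ** ?S t)) ** adj s =
      - (quasi_geodesic r s B A t ** (s ** A ** adj s))"
  proof -
    have "quasi_geodesic r s B A t ** (s ** A ** adj s) =
        r ** ?U t ** Ink ** ?S t ** (adj s ** s) ** A ** adj s"
      by (simp add: quasi_geodesic_def matrix_mul_assoc)
    also have "\<dots> = r ** ?U t ** Ink ** (?S t ** (- (- A))) ** adj s"
      using s by (simp add: unitaryD flip: matrix_mul_assoc)
    also have "\<dots> = r ** ?U t ** Ink ** (A ** ?S t) ** adj s"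
      using mexp_self_commute[of t "- A"] by (simp add: matrix_mult_linear_simps)
    finally show ?thesis
      by (simp add: matrix_mult_linear_simps matrix_mul_assoc)
  qed
  ultimately show ?thesis
    by (simp add: matrix_mult_linear_simps)
qed

section \<open>Frames split into an upper and a lower block, and the tangent space\<close>

definition stack :: "'a^'k^'k \<Rightarrow> 'a^'k^'l \<Rightarrow> 'a^'k^('k::finite + 'l::finite)" where
  "stack A C = (\<chi> i j. case i of Inl i' \<Rightarrow> A $ i' $ j | Inr i' \<Rightarrow> C $ i' $ j)"

lemma stack_nth [simp]: "stack A C $ Inl i $ j = A $ i $ j" "stack A C $ Inr l $ j = C $ l $ j"
  by (simp_all add: stack_def)

lemma Ink_nth: "Ink $ Inl i $ j = (if i = j then 1 else 0)" "Ink $ Inr l $ j = 0"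
  by (simp_all add: Ink_def)

lemma obtain_stack:
  obtains A C where "x = stack A C"
proof
  show "x = stack (\<chi> i. x $ Inl i) (\<chi> i. x $ Inr i)"
    by (simp add: vec_eq_iff_Plus) (simp add: vec_eq_iff)
qed

lemma adj_Ink_mult_stack: "adj Ink ** stack A C = (A :: 'a::hurwitz_algebra^'k^'k)"
  unfolding vec_eq_iff by (simp add: matrix_mult_nth adj_nth Ink_nth sum_UNIV_Plus
      if_distrib[of hconj] if_distrib[of "\<lambda>x. x * _"] cong: if_cong)

lemma block_mult_Ink: "block E B C F ** Ink = stack E (C :: 'a::hurwitz_algebra^'k^'l)"
  by (simp add: vec_eq_iff_Plus matrix_mult_nth Ink_nth sum_UNIV_Plus vec_eq_iff[where 'b = 'k]
      if_distrib[of "\<lambda>x. _ * x"] cong: if_cong)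

lemma Ink_mult: "Ink ** A = stack A (0 :: 'a::hurwitz_algebra^'k^'l)"
  by (simp add: vec_eq_iff_Plus matrix_mult_nth Ink_nth vec_eq_iff[where 'b = 'k]
      if_distrib[of "\<lambda>x. x * _"] cong: if_cong)

lemma stack_diff: "stack A C - stack A' C' = stack (A - A') (C - C')"
  and stack_add: "stack A C + stack A' C' = stack (A + A') (C + C')"
  unfolding vec_eq_iff_Plus by (simp_all add: vec_eq_iff)

lemma inner_stack: "stack A C \<bullet> stack A' C' = A \<bullet> A' + C \<bullet> C'"
  by (simp add: inner_matrix_eq sum_UNIV_Plus)

lemma inner_offdiag: "offdiag B \<bullet> offdiag B' = 2 * (B \<bullet> (B' :: 'a::hurwitz_algebra^'l^'k))"
proof -
  have "offdiag B \<bullet> offdiag B' = B \<bullet> B' + adj B \<bullet> adj B'"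
    by (simp add: inner_matrix_eq sum_UNIV_Plus offdiag_def)
  then show ?thesis
    by (simp add: inner_adj)
qed

text \<open>The upper block determines \<open>A\<close> and the lower one determines
  \<open>B\<close>, so the differential of the projection is injective on the distribution.\<close>

lemma velocity_at_Ink:
  "offdiag B ** Ink - Ink ** A = stack (- A) (- adj (B :: 'a::hurwitz_algebra^'l^'k))"
  by (simp add: offdiag_def block_mult_Ink Ink_mult stack_diff)

lemma stiefel_tangent_param:
  fixes v :: "'a::hurwitz_algebra^'k^('k::finite + 'l::finite)"
  assumes r: "r \<in> unitary" and s: "s \<in> unitary" and v: "v \<in> stiefel_tangent (r ** Ink ** adj s)"
  obtains A B where "A \<in> skew_hermitian" "v = r ** (offdiag B ** Ink - Ink ** A) ** adj s"
proof -
  obtain A C where AC: "adj r ** v ** s = stack A C"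
    using obtain_stack by blast
  \<comment> \<open>Translated back to \<open>Ink\<close>, the tangency condition says exactly that
    the upper block is skew.\<close>
  have "A = adj s ** (adj (r ** Ink ** adj s) ** v) ** s"
    using s by (simp add: adj_mult unitaryD matrix_mul_assoc adj_Ink_mult_stack[of A C, unfolded AC[symmetric], symmetric])
  moreover define W where "W = adj (r ** Ink ** adj s) ** v"
  ultimately have "A \<in> skew_hermitian"
    using v by (simp add: stiefel_tangent_def skew_hermitian_def adj_mult matrix_mult_linear_simps matrix_mul_assoc)
  moreover have "v = r ** (adj r ** v ** s) ** adj s"
    using r s by (simp add: matrix_mul_assoc unitaryD)
  ultimately show ?thesis
    by (intro that[of "- A" "- adj C"]) (simp_all add: AC velocity_at_Ink adj_minus skew_hermitian_def)
qed

lemma quasi_geodesic_0: "quasi_geodesic r s B A 0 = r ** Ink ** adj (s :: 'a::hurwitz_algebra^'k^'k)"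
  by (simp add: quasi_geodesic_def)

text \<open>Every vector satisfying the linearized constraint is the initial velocity of a
  quasi-geodesic, a curve that stays on the manifold for all times as \<open>tangent_space\<close>
  demands.\<close>

lemma tangent_space_stiefel:
  fixes m :: "'a::hurwitz_algebra^'k^('k::finite + 'l::finite)"
  assumes m: "m \<in> stiefel"
  shows "tangent_space stiefel m = stiefel_tangent m"
proof
  show "tangent_space stiefel m \<subseteq> stiefel_tangent m"
    unfolding tangent_space_def using velocity_in_stiefel_tangent by blast
  show "stiefel_tangent m \<subseteq> tangent_space stiefel m"
  proof
    fix v assume v: "v \<in> stiefel_tangent m"
    obtain r where r: "r \<in> unitary" "r ** Ink = m"
      using unitary_transitive[OF Ink_stiefel stiefelD[OF m]] by blast
    obtain A B where AB: "A \<in> skew_hermitian" "v = r ** (offdiag B ** Ink - Ink ** A)"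
      using stiefel_tangent_param[OF r(1) unitary_mat_1, of v] v r by auto
    let ?c = "quasi_geodesic r (mat 1) B A"
    have "(?c has_vector_derivative v) (at 0)"
      using quasi_geodesic_has_vector_derivative[OF r(1) unitary_mat_1, of B A 0]
        unitaryD(5)[OF r(1), of "r ** offdiag B"]
      by (simp add: AB quasi_geodesic_0 matrix_mult_linear_simps matrix_mul_assoc)
    moreover have "?c 0 = m"
      by (simp add: quasi_geodesic_0 r)
    ultimately show "v \<in> tangent_space stiefel m"
      unfolding tangent_space_def
      using quasi_geodesic_in_stiefel[OF r(1) unitary_mat_1 AB(1)] by blast
  qed
qed

section \<open>Closed form of the push-forward metric\<close>

text \<open>Known as the canonical metric of the Stiefel manifold: for \<open>v = m ** a + p\<close>
  with \<open>adj m ** p = 0\<close> the component along \<open>m\<close> counts only half.\<close>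

definition canonical_metric :: "'a::hurwitz_algebra^'k^'n \<Rightarrow> 'a^'k^'n \<Rightarrow> 'a^'k^'n \<Rightarrow> real" where
  "canonical_metric m v w = v \<bullet> w - 1 / 2 * ((adj m ** v) \<bullet> (adj m ** w))"

lemma canonical_metric_eq: "canonical_metric m v w = v \<bullet> (w - (1 / 2) *\<^sub>R (m ** (adj m ** w)))"
  by (simp add: canonical_metric_def inner_diff_right inner_matrix_mult_left)

lemma adj_translate_mult:
  assumes "r \<in> unitary"
  shows "adj (r ** x ** adj s) ** (r ** y ** adj s) = s ** (adj x ** y) ** adj s"
  using assms by (simp add: adj_mult unitaryD flip: matrix_mul_assoc)

lemma canonical_metric_unitary:
  assumes "r \<in> unitary" "s \<in> unitary"
  shows "canonical_metric (r ** m ** adj s) (r ** v ** adj s) (r ** w ** adj s) = canonical_metric m v w"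
  using assms by (simp add: canonical_metric_def adj_translate_mult inner_unitary_left inner_unitary_right unitary_adj)

text \<open>By invariance only \<open>Ink\<close> matters, where both sides equal
  \<open>B \<bullet> B' + 1 / 2 * (A \<bullet> A')\<close>: the block \<open>B\<close> occurs twice
  in \<open>offdiag B\<close>, which offsets the factor 1/2 of the trace form.\<close>

lemma canonical_metric_push_forward:
  fixes r :: "'a::hurwitz_algebra^('k::finite + 'l::finite)^('k + 'l)"
  assumes r: "r \<in> unitary" and s: "s \<in> unitary" and A: "A \<in> skew_hermitian"
  shows "canonical_metric (r ** Ink ** adj s) (r ** (offdiag B ** Ink - Ink ** A) ** adj s)
      (r ** (offdiag B' ** Ink - Ink ** A') ** adj s) = ptrace_form (offdiag B, A) (offdiag B', A')"
  unfolding canonical_metric_unitary[OF r s]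
  using A by (simp add: velocity_at_Ink canonical_metric_def adj_Ink_mult_stack inner_stack
      ptrace_form_def trace_form_skew offdiag_skew inner_offdiag inner_adj)

lemma stiefel_proj_has_derivative:
  fixes g :: "('a::hurwitz_algebra^('k::finite + 'l::finite)^('k + 'l)) \<times> ('a^'k^'k)"
  shows "(stiefel_proj has_derivative
    (\<lambda>h. fst h ** Ink ** adj (snd g) + fst g ** Ink ** adj (snd h))) (at g)"
proof -
  have "((\<lambda>g. fst g ** Ink ** adj (snd g)) has_derivative
      (\<lambda>h. fst g ** Ink ** adj (snd h) + fst h ** Ink ** adj (snd g))) (at g)"
    by (intro matrix_mult.FDERIV bounded_linear_imp_has_derivative bounded_linear_fst bounded_linear_snd
        bounded_linear_compose[OF bounded_linear_adj] bounded_linear_compose[OF matrix_mult.bounded_linear_left])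
  then show ?thesis
    by (simp add: stiefel_proj_def[abs_def] add.commute)
qed

lemma frechet_derivative_stiefel_proj:
  fixes g :: "('a::hurwitz_algebra^('k::finite + 'l::finite)^('k + 'l)) \<times> ('a^'k^'k)"
  assumes "A \<in> skew_hermitian"
  shows "frechet_derivative stiefel_proj (at g) (pmul g (offdiag B, A)) =
    fst g ** (offdiag B ** Ink - Ink ** A) ** adj (snd g)"
proof -
  have "frechet_derivative stiefel_proj (at g) (pmul g (offdiag B, A)) =
      fst g ** offdiag B ** Ink ** adj (snd g) + fst g ** Ink ** adj (snd g ** A)"
    by (simp add: frechet_derivative_at[OF stiefel_proj_has_derivative, symmetric] pmul_def)
  then show ?thesis
    using assms by (simp add: adj_mult skew_hermitianD matrix_mult_linear_simps matrix_mul_assoc)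
qed

text \<open>The description is well defined because each representative \<open>g\<close> of
  \<open>m\<close> leads to the same value, an expression in \<open>m\<close>, \<open>v\<close> and
  \<open>w\<close> alone.\<close>

lemma homogeneous_metric_eq:
  fixes m :: "'a::hurwitz_algebra^'k^('k::finite + 'l::finite)"
  assumes G: "Gn \<subseteq> unitary" "Gk \<subseteq> unitary" and g: "g \<in> Gn \<times> Gk" "stiefel_proj g = m"
    and v: "v \<in> stiefel_tangent m" and w: "w \<in> stiefel_tangent m"
  shows "homogeneous_metric Gn Gk m v w = canonical_metric m v w"
  unfolding homogeneous_metric_def
proof (rule the_equality)
  have m: "m = fst g ** Ink ** adj (snd g)" and u: "fst g \<in> unitary" "snd g \<in> unitary"
    using g G by (auto simp: stiefel_proj_def)
  obtain A B where AB: "A \<in> skew_hermitian" "v = fst g ** (offdiag B ** Ink - Ink ** A) ** adj (snd g)"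
    using stiefel_tangent_param[OF u v[unfolded m]] by blast
  obtain A' B' where AB': "A' \<in> skew_hermitian" "w = fst g ** (offdiag B' ** Ink - Ink ** A') ** adj (snd g)"
    using stiefel_tangent_param[OF u w[unfolded m]] by blast
  show "\<exists>g\<in>Gn \<times> Gk. \<exists>X\<in>pspace skew_hermitian. \<exists>Y\<in>pspace skew_hermitian. stiefel_proj g = m \<and>
      frechet_derivative stiefel_proj (at g) (pmul g X) = v \<and>
      frechet_derivative stiefel_proj (at g) (pmul g Y) = w \<and> canonical_metric m v w = ptrace_form X Y"
  proof (intro bexI conjI)
    show "canonical_metric m v w = ptrace_form (offdiag B, A) (offdiag B', A')"
      unfolding m AB(2) AB'(2) by (rule canonical_metric_push_forward[OF u AB(1)])
  qed (use AB AB' g in \<open>auto simp: frechet_derivative_stiefel_proj pspace_def\<close>)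
next
  fix d
  assume "\<exists>g\<in>Gn \<times> Gk. \<exists>X\<in>pspace skew_hermitian. \<exists>Y\<in>pspace skew_hermitian. stiefel_proj g = m \<and>
      frechet_derivative stiefel_proj (at g) (pmul g X) = v \<and>
      frechet_derivative stiefel_proj (at g) (pmul g Y) = w \<and> d = ptrace_form X Y"
  then obtain g X Y where h: "g \<in> Gn \<times> Gk" "X \<in> pspace skew_hermitian" "Y \<in> pspace skew_hermitian"
      "stiefel_proj g = m" "frechet_derivative stiefel_proj (at g) (pmul g X) = v"
      "frechet_derivative stiefel_proj (at g) (pmul g Y) = w" "d = ptrace_form X Y"
    by blast
  then obtain A B A' B' where X: "X = (offdiag B, A)" "A \<in> skew_hermitian" "Y = (offdiag B', A')" "A' \<in> skew_hermitian"
    by (auto simp: pspace_def)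
  have u: "fst g \<in> unitary" "snd g \<in> unitary"
    using h(1) G by auto
  show "d = canonical_metric m v w"
    using canonical_metric_push_forward[OF u X(2), of B B' A'] h X
    by (simp add: frechet_derivative_stiefel_proj stiefel_proj_def)
qed

section \<open>The Levi-Civita connection\<close>

definition hermitian :: "('a::hurwitz_algebra^'k^'k) set" where
  "hermitian = {S. adj S = S}"

lemma inner_hermitian_skew: "S \<in> hermitian \<Longrightarrow> c \<in> skew_hermitian \<Longrightarrow> S \<bullet> c = 0"
  using inner_adj[of S c] by (simp add: hermitian_def skew_hermitian_def)

text \<open>
  The symmetric bilinear form polarizing the geodesic equation
  \<open>m'' + m' m'\<^sup>* m + m m'\<^sup>* (1 - m m\<^sup>*) m' = 0\<close> of the metric \<open>\<langle>v, w\<rangle> - 1/2 \<langle>m\<^sup>* v, m\<^sup>* w\<rangle>\<close>.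
\<close>

definition christoffel :: "'a::hurwitz_algebra^'k^'n \<Rightarrow> 'a^'k^'n \<Rightarrow> 'a^'k^'n \<Rightarrow> 'a^'k^'n" where
  "christoffel m x y = (1 / 2) *\<^sub>R (x ** (adj y ** m) + y ** (adj x ** m)
    + m ** (adj x ** (y - m ** (adj m ** y)) + adj y ** (x - m ** (adj m ** x))))"

lemma christoffel_commute: "christoffel m x y = christoffel m y x"
  by (simp add: christoffel_def add.commute)

lemma christoffel_add_right: "christoffel m x (y + y') = christoffel m x y + christoffel m x y'"
  by (simp add: christoffel_def matrix_mult_linear_simps adj_simps scaleR_add_right scaleR_diff_right)

lemma christoffel_scaleR_right: "christoffel m x (c *\<^sub>R y) = c *\<^sub>R christoffel m x y"
  by (simp add: christoffel_def matrix_mult_linear_simps adj_simps scaleR_add_right scaleR_diff_right)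

lemma christoffel_sum_right: "christoffel m x (\<Sum>i\<in>I. f i) = (\<Sum>i\<in>I. christoffel m x (f i))"
proof -
  interpret linear "christoffel m x"
    by (rule linearI) (simp_all add: christoffel_add_right christoffel_scaleR_right)
  show ?thesis by (rule sum)
qed

text \<open>Tangent vectors are resolved into a skew part along \<open>m\<close> and a part
  orthogonal to the frame; in these coordinates the form has one hermitian component along
  \<open>m\<close> and one orthogonal component.\<close>

lemma christoffel_split:
  assumes m: "adj m ** m = mat 1" and a: "a \<in> skew_hermitian" and b: "b \<in> skew_hermitian"
    and p: "adj m ** p = 0" and q: "adj m ** q = 0"
  shows "christoffel m (m ** a + p) (m ** b + q) =
    (1 / 2) *\<^sub>R (m ** (adj p ** q + adj q ** p - (a ** b + b ** a)) - (p ** b + q ** a))"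
proof -
  have p': "adj p ** m = 0" and q': "adj q ** m = 0"
    using arg_cong[OF p, of adj] arg_cong[OF q, of adj] by (simp_all add: adj_mult)
  have mm: "adj m ** (m ** z) = z" for z
    by (simp add: matrix_mul_assoc m)
  have p0: "adj m ** (p ** z) = 0" and q0: "adj m ** (q ** z) = 0" for z
    by (simp_all add: matrix_mul_assoc p q)
  have *: "adj (m ** a + p) ** m = - a" "adj (m ** b + q) ** m = - b"
    using a b by (simp_all add: adj_simps matrix_mult_linear_simps skew_hermitianD p' q' m flip: matrix_mul_assoc)
  have **: "m ** a + p - m ** (adj m ** (m ** a + p)) = p" "m ** b + q - m ** (adj m ** (m ** b + q)) = q"
    by (simp_all add: matrix_mult_linear_simps mm p q)
  have ***: "adj (m ** a + p) ** q = adj p ** q" "adj (m ** b + q) ** p = adj q ** p"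
    by (simp_all add: adj_simps matrix_mult_linear_simps p q flip: matrix_mul_assoc)
  show ?thesis
    unfolding christoffel_def * ** ***
    by (simp add: matrix_mult_linear_simps matrix_mul_assoc algebra_simps)
qed

lemma stiefel_tangent_split:
  assumes m: "m \<in> stiefel" and v: "v \<in> stiefel_tangent m"
  obtains a p where "a \<in> skew_hermitian" "adj m ** p = 0" "v = m ** a + p" "adj m ** v = a"
proof
  show "v = m ** (adj m ** v) + (v - m ** (adj m ** v))"
    by simp
  show "adj m ** (v - m ** (adj m ** v)) = 0"
    using stiefelD[OF m] by (simp add: matrix_mult_linear_simps matrix_mul_assoc)
  show "adj m ** v \<in> skew_hermitian"
    using v by (simp add: stiefel_tangent_def)
qed simp

text \<open>The right-hand side is the second-order term of the constraint
  \<open>adj m ** m = mat 1\<close>, which a flat derivative misses.\<close>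

lemma christoffel_tangent:
  assumes m: "m \<in> stiefel" and x: "x \<in> stiefel_tangent m" and y: "y \<in> stiefel_tangent m"
  shows "adj m ** christoffel m x y + adj (christoffel m x y) ** m = adj x ** y + adj y ** x"
proof -
  obtain a p where a: "a \<in> skew_hermitian" "adj m ** p = 0" "x = m ** a + p"
    using stiefel_tangent_split[OF m x] by blast
  obtain b q where b: "b \<in> skew_hermitian" "adj m ** q = 0" "y = m ** b + q"
    using stiefel_tangent_split[OF m y] by blast
  note mm = stiefelD[OF m]
  have p': "adj p ** m = 0" and q': "adj q ** m = 0"
    using arg_cong[OF a(2), of adj] arg_cong[OF b(2), of adj] by (simp_all add: adj_mult)
  have m0: "adj m ** (m ** z) = z" "adj m ** (p ** z) = 0" "adj m ** (q ** z) = 0"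
      "adj p ** (m ** z) = 0" "adj q ** (m ** z) = 0" for z
    by (simp_all add: matrix_mul_assoc mm a b p' q')
  define S where "S = adj p ** q + adj q ** p - (a ** b + b ** a)"
  have S: "adj S = S"
    using a(1) b(1) by (simp add: S_def adj_simps skew_hermitianD matrix_mult_linear_simps)
  have G: "christoffel m x y = (1 / 2) *\<^sub>R (m ** S - (p ** b + q ** a))"
    using christoffel_split[OF mm a(1) b(1) a(2) b(2)] by (simp add: a b S_def)
  have "adj m ** christoffel m x y = (1 / 2) *\<^sub>R S"
    by (simp add: G matrix_mult_linear_simps m0)
  moreover from arg_cong[OF this, of adj] have "adj (christoffel m x y) ** m = (1 / 2) *\<^sub>R S"
    by (simp add: adj_simps S)
  moreover have "adj x ** y + adj y ** x = S"
    using a(1) b(1)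
    by (simp add: S_def a b adj_simps skew_hermitianD matrix_mult_linear_simps m0 flip: matrix_mul_assoc)
  ultimately show ?thesis
    by (simp flip: scaleR_add_left)
qed

text \<open>Compatibility with the metric: the right-hand side is the derivative of
  \<open>canonical_metric m y z\<close> in \<open>m\<close> along \<open>x\<close>, with
  \<open>y\<close> and \<open>z\<close> held fixed.\<close>

lemma canonical_metric_christoffel:
  fixes m :: "'a::hurwitz_algebra^'k^'n"
  assumes m: "m \<in> stiefel" and x: "x \<in> stiefel_tangent m" and y: "y \<in> stiefel_tangent m"
    and z: "z \<in> stiefel_tangent m"
  shows "canonical_metric m (christoffel m x y) z + canonical_metric m y (christoffel m x z) =
    - 1 / 2 * ((adj x ** y) \<bullet> (adj m ** z) + (adj m ** y) \<bullet> (adj x ** z))"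
proof -
  obtain a p where a: "a \<in> skew_hermitian" "adj m ** p = 0" "x = m ** a + p" "adj m ** x = a"
    using stiefel_tangent_split[OF m x] by blast
  obtain b q where b: "b \<in> skew_hermitian" "adj m ** q = 0" "y = m ** b + q" "adj m ** y = b"
    using stiefel_tangent_split[OF m y] by blast
  obtain c w where c: "c \<in> skew_hermitian" "adj m ** w = 0" "z = m ** c + w" "adj m ** z = c"
    using stiefel_tangent_split[OF m z] by blast
  note mm = stiefelD[OF m]
  have half: "canonical_metric m (christoffel m (m ** a + p) (m ** b + q)) (m ** c + w) =
      - 1 / 2 * ((p ** b) \<bullet> w + (q ** a) \<bullet> w)"
    if a: "a \<in> skew_hermitian" "adj m ** p = 0" and b: "b \<in> skew_hermitian" "adj m ** q = 0"
      and c: "c \<in> skew_hermitian" "adj m ** w = 0" for a b c :: "'a^'k^'k" and p q w :: "'a^'k^'n"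
  proof -
    \<comment> \<open>Hermitian matrices are orthogonal to skew ones, so the component
      \<open>m ** S\<close> contributes nothing when paired with a tangent vector.\<close>
    define S where "S = adj p ** q + adj q ** p - (a ** b + b ** a)"
    have S: "S \<in> hermitian"
      using a(1) b(1) by (simp add: hermitian_def S_def adj_simps skew_hermitianD matrix_mult_linear_simps)
    have mc: "adj m ** (m ** c + w) = c"
      using c by (simp add: matrix_mult_linear_simps matrix_mul_assoc mm)
    define Z where "Z = m ** c + w - (1 / 2) *\<^sub>R (m ** c)"
    have "(m ** S) \<bullet> Z = 0"
      using inner_hermitian_skew[OF S c(1)] c
      by (simp add: Z_def inner_matrix_mult_left matrix_mult_linear_simps matrix_mul_assoc mm inner_diff_right)
    moreover have "(n ** e) \<bullet> Z = (n ** e) \<bullet> w"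
      if "adj m ** n = 0" for n :: "'a^'k^'n" and e :: "'a^'k^'k"
    proof -
      have "(n ** e) \<bullet> (m ** c) = 0"
        using that by (simp add: inner_commute[of "n ** e"] inner_matrix_mult_left[of m] matrix_mul_assoc)
      then show ?thesis
        by (simp add: Z_def inner_add_right inner_diff_right)
    qed
    ultimately show ?thesis
      using a b
      unfolding canonical_metric_eq mc christoffel_split[OF mm a(1) b(1) a(2) b(2)] S_def[symmetric] Z_def[symmetric]
      by (simp add: inner_diff_left inner_add_left algebra_simps)
  qed
  have sym: "canonical_metric m y (christoffel m x z) = canonical_metric m (christoffel m x z) y"
    by (simp add: canonical_metric_def inner_commute)
  \<comment> \<open>Right multiplication by the skew matrix \<open>a\<close> is a skew operator, so
    the terms with \<open>a\<close> in the two halves cancel.\<close>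
  have "(q ** a) \<bullet> w + (w ** a) \<bullet> q = 0"
    using inner_matrix_mult_right[of q a w] a(1)
    by (simp add: skew_hermitianD matrix_mult_linear_simps inner_commute[of q])
  then have L: "canonical_metric m (christoffel m x y) z + canonical_metric m y (christoffel m x z) =
      - 1 / 2 * ((p ** b) \<bullet> w + (p ** c) \<bullet> q)"
    using half[OF a(1,2) b(1,2) c(1,2)] half[OF a(1,2) c(1,2) b(1,2)]
    unfolding sym by (simp add: a(3) b(3) c(3) algebra_simps)
  have xy: "adj x ** (m ** d + n) = - (a ** d) + adj p ** n" if "adj m ** n = 0" for d n
  proof -
    have "adj p ** m = 0"
      using arg_cong[OF a(2), of adj] by (simp add: adj_mult)
    then have *: "adj p ** (m ** d) = 0"
      by (simp add: matrix_mul_assoc)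
    have "adj m ** (m ** d) = d"
      by (simp add: matrix_mul_assoc mm)
    then show ?thesis
      using a(1) that by (simp add: a(3) adj_simps skew_hermitianD matrix_mult_linear_simps * flip: matrix_mul_assoc)
  qed
  have "(adj p ** q) \<bullet> c = (p ** c) \<bullet> q"
    by (simp add: inner_matrix_mult_left inner_commute[of q])
  moreover have "b \<bullet> (adj p ** w) = (p ** b) \<bullet> w"
    by (simp add: inner_matrix_mult_left)
  moreover have "(a ** b) \<bullet> c + b \<bullet> (a ** c) = 0"
    using a(1) by (simp add: inner_matrix_mult_left skew_hermitianD matrix_mult_linear_simps)
  ultimately have R: "(adj x ** y) \<bullet> (adj m ** z) + (adj m ** y) \<bullet> (adj x ** z) = (p ** b) \<bullet> w + (p ** c) \<bullet> q"
    unfolding b(4) c(4)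
    unfolding b(3) c(3) xy[OF b(2)] xy[OF c(2)]
    by (simp add: inner_diff_left inner_diff_right)
  show ?thesis
    unfolding L R ..
qed

lemma canonical_metric_pos:
  assumes m: "m \<in> stiefel" and v: "v \<in> stiefel_tangent m" and 0: "canonical_metric m v v = 0"
  shows "v = 0"
proof -
  obtain a p where a: "adj m ** p = 0" "v = m ** a + p" "adj m ** v = a"
    using stiefel_tangent_split[OF m v] by blast
  note mm = stiefelD[OF m]
  have "v \<bullet> v = a \<bullet> a + p \<bullet> p"
    using a(1) by (simp add: a(2) inner_add_left inner_add_right inner_matrix_mult_left matrix_mul_assoc mm
        inner_commute[of p "m ** a"])
  then have "1 / 2 * (a \<bullet> a) + p \<bullet> p = 0"
    using 0 by (simp add: canonical_metric_def a(3))
  then have "a \<bullet> a = 0 \<and> p \<bullet> p = 0"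
    using inner_ge_zero[of a] inner_ge_zero[of p] by linarith
  then show ?thesis
    by (simp add: a(2))
qed

text \<open>The form inherits the unitary symmetry of the metric; this lets accelerations be
  evaluated at \<open>Ink\<close>.\<close>

lemma christoffel_unitary:
  assumes r: "r \<in> unitary" and s: "s \<in> unitary"
  shows "christoffel (r ** m ** adj s) (r ** x ** adj s) (r ** y ** adj s) = r ** christoffel m x y ** adj s"
proof -
  have 2: "(r ** x ** adj s) ** (s ** w ** adj s) = r ** (x ** w) ** adj s" for x w
    using s by (simp add: unitaryD flip: matrix_mul_assoc)
  have 3: "r ** x ** adj s + r ** y ** adj s = r ** (x + y) ** adj s"
     "r ** x ** adj s - r ** y ** adj s = r ** (x - y) ** adj s"
     "c *\<^sub>R (r ** x ** adj s) = r ** (c *\<^sub>R x) ** adj s" for x y c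
    by (simp_all add: matrix_mult_linear_simps)
  have 4: "s ** x ** adj s + s ** y ** adj s = s ** (x + y) ** adj s" for x y
    by (simp_all add: matrix_mult_linear_simps)
  show ?thesis
    unfolding christoffel_def adj_translate_mult[OF r] 2 3 4 ..
qed

text \<open>The formula makes sense at every ambient point, as it must because vector fields are
  smooth maps of the whole ambient space.\<close>

definition christoffel_connection ::
  "('a::hurwitz_algebra^'k^'n \<Rightarrow> 'a^'k^'n) \<Rightarrow> ('a^'k^'n \<Rightarrow> 'a^'k^'n) \<Rightarrow> 'a^'k^'n \<Rightarrow> 'a^'k^'n" where
  "christoffel_connection X Y m = frechet_derivative Y (at m) (X m) + christoffel m (X m) (Y m)"

lemma smooth_christoffel_connection:
  fixes X Y :: "'a::hurwitz_algebra^'k^'n \<Rightarrow> 'a^'k^'n"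
  assumes X: "smooth X" and Y: "smooth Y"
  shows "smooth (christoffel_connection X Y)"
proof -
  have id: "smooth (\<lambda>m :: 'a^'k^'n. m)"
    by (rule smooth_bounded_linear) (rule bounded_linear_ident)
  note intros = smooth_add smooth_diff smooth_bilinear[OF bounded_bilinear_matrix_mult]
    smooth_linear_compose[OF bounded_linear_adj] smooth_linear_compose[OF bounded_linear_scaleR_right]
    id X Y
  have "smooth (\<lambda>m. frechet_derivative Y (at m) (X m) + christoffel m (X m) (Y m))"
    unfolding christoffel_def by (intro smooth_add smooth_frechet_derivative X Y) (intro intros)
  then show ?thesis
    by (simp add: christoffel_connection_def[abs_def])
qed

context
  fixes X Y :: "'a::hurwitz_algebra^'k^('k::finite + 'l::finite) \<Rightarrow> 'a^'k^('k + 'l)"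
begin

lemma vector_fields_stiefelD:
  assumes "X \<in> vector_fields stiefel"
  shows "smooth X" "m \<in> stiefel \<Longrightarrow> X m \<in> stiefel_tangent m"
  using assms by (auto simp: vector_fields_def tangent_space_stiefel)

lemma vector_fields_stiefelI:
  assumes "smooth X" "\<And>m. m \<in> stiefel \<Longrightarrow> X m \<in> stiefel_tangent m"
  shows "X \<in> vector_fields stiefel"
  using assms by (auto simp: vector_fields_def tangent_space_stiefel)

text \<open>Differentiating the tangency relation of \<open>Y\<close> along a curve with velocity
  \<open>X m\<close> shows how far the flat derivative is from tangent;
  \<open>christoffel_tangent\<close> cancels this defect.\<close>

lemma christoffel_connection_tangent:
  assumes X: "X m \<in> stiefel_tangent m"
    and Y: "Y \<in> vector_fields stiefel" and m: "m \<in> stiefel"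
  shows "christoffel_connection X Y m \<in> stiefel_tangent m"
proof -
  let ?x = "X m" and ?y = "Y m" and ?D = "frechet_derivative Y (at m) (X m)"
  have x: "?x \<in> stiefel_tangent m" and y: "?y \<in> stiefel_tangent m"
    using Y X m by (auto simp: vector_fields_def tangent_space_stiefel)
  obtain c where c: "\<And>t. c t \<in> stiefel" "c 0 = m" "(c has_vector_derivative ?x) (at 0)"
    using x m tangent_space_stiefel[OF m] unfolding tangent_space_def by blast
  have YD: "(Y has_derivative frechet_derivative Y (at m)) (at m)"
    using Y by (intro smooth_has_derivative) (simp add: vector_fields_def)
  have D: "((\<lambda>t. Y (c t)) has_vector_derivative ?D) (at 0)"
    using c(3) by (rule has_vector_derivative_chain) (simp add: c(2) YD)
  have "((\<lambda>t. adj (c t) ** Y (c t) + adj (Y (c t)) ** c t) has_vector_derivative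
      (adj ?x ** Y (c 0) + adj (c 0) ** ?D) + (adj ?D ** c 0 + adj (Y (c 0)) ** ?x)) (at 0)"
    by (intro has_vector_derivative_add has_vector_derivative_matrix_mult has_vector_derivative_adj c D)
  moreover have "(\<lambda>t. adj (c t) ** Y (c t) + adj (Y (c t)) ** c t) = (\<lambda>t. 0)"
  proof
    fix t
    have "Y (c t) \<in> stiefel_tangent (c t)"
      using Y c(1)[of t] by (auto simp: vector_fields_def tangent_space_stiefel)
    then show "adj (c t) ** Y (c t) + adj (Y (c t)) ** c t = 0"
      by (simp add: stiefel_tangent_iff)
  qed
  ultimately have "((\<lambda>t. 0) has_vector_derivative
      (adj ?x ** ?y + adj m ** ?D) + (adj ?D ** m + adj ?y ** ?x)) (at 0)"
    by (simp only: c(2))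
  then have "(adj ?x ** ?y + adj m ** ?D) + (adj ?D ** m + adj ?y ** ?x) = 0"
    by (rule vector_derivative_unique_at) (rule has_vector_derivative_const)
  moreover have "adj m ** christoffel_connection X Y m + adj (christoffel_connection X Y m) ** m =
      (adj m ** ?D + adj ?D ** m) + (adj m ** christoffel m ?x ?y + adj (christoffel m ?x ?y) ** m)"
    by (simp add: christoffel_connection_def adj_simps matrix_mult_linear_simps algebra_simps)
  ultimately have "adj m ** christoffel_connection X Y m + adj (christoffel_connection X Y m) ** m = 0"
    unfolding christoffel_tangent[OF m x y] by (simp add: algebra_simps)
  then show ?thesis
    by (simp add: stiefel_tangent_iff add_eq_0_iff)
qed

end

lemma levi_civitaD:
  assumes "levi_civita M met nabla" "X \<in> vector_fields M" "Y \<in> vector_fields M"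
  shows "nabla X Y \<in> vector_fields M"
    and "m \<in> M \<Longrightarrow> nabla X Y m - nabla Y X m = lie_bracket X Y m"
    and "m \<in> M \<Longrightarrow> Z \<in> vector_fields M \<Longrightarrow>
      has_derivative_along M (\<lambda>x. met x (Y x) (Z x)) m (X m)
        (met m (nabla X Y m) (Z m) + met m (Y m) (nabla X Z m))"
proof -
  note lc = assms(1)[unfolded levi_civita_def]
  show "nabla X Y \<in> vector_fields M"
    using lc[THEN conjunct1] assms(2,3) by blast
  show "nabla X Y m - nabla Y X m = lie_bracket X Y m" if "m \<in> M"
    using lc[THEN conjunct2, THEN conjunct2, THEN conjunct2, THEN conjunct1] assms(2,3) that by blast
  show "has_derivative_along M (\<lambda>x. met x (Y x) (Z x)) m (X m)
      (met m (nabla X Y m) (Z m) + met m (Y m) (nabla X Z m))" if "m \<in> M" "Z \<in> vector_fields M"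
    using lc[THEN conjunct2, THEN conjunct2, THEN conjunct2, THEN conjunct2] assms(2,3) that by blast
qed

text \<open>The homogeneous metric is given by a description whose value is known on tangent vectors
  only, so agreement is assumed there and nowhere else.\<close>

locale stiefel_metric =
  fixes met :: "'a::hurwitz_algebra^'k^('k::finite + 'l::finite) \<Rightarrow> 'a^'k^('k + 'l) \<Rightarrow> 'a^'k^('k + 'l) \<Rightarrow> real"
  assumes met_eq: "\<And>m v w. m \<in> stiefel \<Longrightarrow> v \<in> stiefel_tangent m \<Longrightarrow> w \<in> stiefel_tangent m \<Longrightarrow>
    met m v w = canonical_metric m v w"
begin

lemma christoffel_connection_metric:
  assumes X: "X \<in> vector_fields stiefel" and Y: "Y \<in> vector_fields stiefel"
    and Z: "Z \<in> vector_fields stiefel" and m: "m \<in> stiefel"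
  shows "has_derivative_along stiefel (\<lambda>x. met x (Y x) (Z x)) m (X m)
    (met m (christoffel_connection X Y m) (Z m) + met m (Y m) (christoffel_connection X Z m))"
  unfolding has_derivative_along_def
proof (intro allI impI, elim conjE)
  fix c assume c: "\<forall>t. c t \<in> stiefel" "c 0 = m" "(c has_vector_derivative X m) (at 0)"
  let ?x = "X m" and ?y = "Y m" and ?z = "Z m"
    and ?DY = "frechet_derivative Y (at m) (X m)" and ?DZ = "frechet_derivative Z (at m) (X m)"
  have t: "?x \<in> stiefel_tangent m" "?y \<in> stiefel_tangent m" "?z \<in> stiefel_tangent m"
    using X Y Z m by (auto intro: vector_fields_stiefelD)
  have D: "((\<lambda>t. W (c t)) has_vector_derivative frechet_derivative W (at m) (X m)) (at 0)"
    if "W \<in> vector_fields stiefel" for W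
    using c(3) by (rule has_vector_derivative_chain)
      (use that c(2) in \<open>auto intro: smooth_has_derivative vector_fields_stiefelD\<close>)
  have "((\<lambda>t. Y (c t) \<bullet> Z (c t) - 1 / 2 * ((adj (c t) ** Y (c t)) \<bullet> (adj (c t) ** Z (c t)))) has_vector_derivative
      (Y (c 0) \<bullet> ?DZ + ?DY \<bullet> Z (c 0)) - 1 / 2 *
        ((adj (c 0) ** Y (c 0)) \<bullet> (adj ?x ** Z (c 0) + adj (c 0) ** ?DZ) +
         (adj ?x ** Y (c 0) + adj (c 0) ** ?DY) \<bullet> (adj (c 0) ** Z (c 0)))) (at 0)"
    by (intro has_vector_derivative_diff bounded_linear.has_vector_derivative[OF bounded_linear_mult_right]
        bounded_bilinear.has_vector_derivative[OF bounded_bilinear_inner] D Y Z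
        has_vector_derivative_matrix_mult has_vector_derivative_adj c)
  moreover have "(\<lambda>t. met (c t) (Y (c t)) (Z (c t))) =
      (\<lambda>t. Y (c t) \<bullet> Z (c t) - 1 / 2 * ((adj (c t) ** Y (c t)) \<bullet> (adj (c t) ** Z (c t))))"
  proof
    fix t
    show "met (c t) (Y (c t)) (Z (c t)) =
      Y (c t) \<bullet> Z (c t) - 1 / 2 * ((adj (c t) ** Y (c t)) \<bullet> (adj (c t) ** Z (c t)))"
      using c(1) Y Z by (subst met_eq) (auto intro: vector_fields_stiefelD simp: canonical_metric_def)
  qed
  moreover have "met m (christoffel_connection X Y m) ?z + met m ?y (christoffel_connection X Z m) =
      (?y \<bullet> ?DZ + ?DY \<bullet> ?z) - 1 / 2 *
        ((adj m ** ?y) \<bullet> (adj ?x ** ?z + adj m ** ?DZ) +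
         (adj ?x ** ?y + adj m ** ?DY) \<bullet> (adj m ** ?z))"
  proof -
    have "met m (christoffel_connection X Y m) ?z + met m ?y (christoffel_connection X Z m) =
        canonical_metric m (christoffel_connection X Y m) ?z + canonical_metric m ?y (christoffel_connection X Z m)"
      using t Y Z m by (simp add: met_eq christoffel_connection_tangent)
    also have "\<dots> = canonical_metric m ?DY ?z + canonical_metric m ?y ?DZ +
        (canonical_metric m (christoffel m ?x ?y) ?z + canonical_metric m ?y (christoffel m ?x ?z))"
      by (simp add: christoffel_connection_def canonical_metric_def matrix_mult_linear_simps
          inner_add_left inner_add_right algebra_simps)
    also have "\<dots> = canonical_metric m ?DY ?z + canonical_metric m ?y ?DZ
        - 1 / 2 * ((adj ?x ** ?y) \<bullet> (adj m ** ?z) + (adj m ** ?y) \<bullet> (adj ?x ** ?z))"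
      unfolding canonical_metric_christoffel[OF m t] by simp
    finally show ?thesis
      by (simp add: canonical_metric_def inner_add_left inner_add_right algebra_simps)
  qed
  ultimately show "((\<lambda>t. met (c t) (Y (c t)) (Z (c t))) has_real_derivative
      met m (christoffel_connection X Y m) (Z m) + met m (Y m) (christoffel_connection X Z m)) (at 0)"
    by (simp add: has_real_derivative_iff_has_vector_derivative c(2))
qed

lemma levi_civita_christoffel_connection: "levi_civita stiefel met christoffel_connection"
  unfolding levi_civita_def
proof (intro conjI ballI allI impI)
  fix X Y :: "'a^'k^('k + 'l) \<Rightarrow> 'a^'k^('k + 'l)" and m :: "'a^'k^('k + 'l)"
  assume X: "X \<in> vector_fields stiefel" and Y: "Y \<in> vector_fields stiefel"
  have D: "(W has_derivative frechet_derivative W (at m)) (at m)" if "W \<in> vector_fields stiefel" for W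
    using that by (intro smooth_has_derivative vector_fields_stiefelD)
  show "christoffel_connection X Y \<in> vector_fields stiefel"
    using X Y by (intro vector_fields_stiefelI smooth_christoffel_connection christoffel_connection_tangent)
      (auto intro: vector_fields_stiefelD)
  show "christoffel_connection X Y m - christoffel_connection Y X m = lie_bracket X Y m"
    by (simp add: christoffel_connection_def lie_bracket_def christoffel_commute[of m "Y m"])
  show "has_derivative_along stiefel (\<lambda>x. met x (Y x) (Z x)) m (X m)
      (met m (christoffel_connection X Y m) (Z m) + met m (Y m) (christoffel_connection X Z m))"
    if "m \<in> stiefel" "Z \<in> vector_fields stiefel" for Z
    using X Y that by (intro christoffel_connection_metric)
  fix Z :: "'a^'k^('k + 'l) \<Rightarrow> 'a^'k^('k + 'l)"
  have lin: "linear (frechet_derivative W (at m))" if "W \<in> vector_fields stiefel" for W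
    using D[OF that] by (rule has_derivative_linear)
  show "christoffel_connection (\<lambda>x. X x + Y x) Z m = christoffel_connection X Z m + christoffel_connection Y Z m"
    if "Z \<in> vector_fields stiefel"
    using linear_add[OF lin[OF that]]
    by (simp add: christoffel_connection_def christoffel_commute[of m _ "Z m"] christoffel_add_right)
  show "christoffel_connection Z (\<lambda>x. X x + Y x) m = christoffel_connection Z X m + christoffel_connection Z Y m"
    by (simp add: christoffel_connection_def christoffel_add_right
        frechet_derivative_at[OF has_derivative_add[OF D[OF X] D[OF Y]], symmetric])
  fix f :: "'a^'k^('k + 'l) \<Rightarrow> real" assume f: "smooth f"
  show "christoffel_connection (\<lambda>x. f x *\<^sub>R X x) Y m = f m *\<^sub>R christoffel_connection X Y m"
    using linear_scale[OF lin[OF Y]]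
    by (simp add: christoffel_connection_def christoffel_commute[of m _ "Y m"] christoffel_scaleR_right scaleR_add_right)
  show "christoffel_connection X (\<lambda>x. f x *\<^sub>R Y x) m =
      frechet_derivative f (at m) (X m) *\<^sub>R Y m + f m *\<^sub>R christoffel_connection X Y m"
    by (simp add: christoffel_connection_def christoffel_scaleR_right scaleR_add_right
        frechet_derivative_at[OF has_derivative_scaleR[OF smooth_has_derivative[OF f] D[OF Y]], symmetric])
qed

text \<open>
  The difference of two Levi-Civita connections, paired with a third field, is symmetric in the first
  two slots and skew in the last two, hence zero.
\<close>

lemma levi_civita_unique:
  assumes nabla: "levi_civita stiefel met nabla"
    and X: "X \<in> vector_fields stiefel" and Y: "Y \<in> vector_fields stiefel" and m: "m \<in> stiefel"
  shows "nabla X Y m = christoffel_connection X Y m"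
proof -
  note lc = levi_civitaD[OF nabla] levi_civitaD[OF levi_civita_christoffel_connection]
  define S where "S X Y = nabla X Y m - christoffel_connection X Y m" for X Y
  have vf: "nabla X Y \<in> vector_fields stiefel" "christoffel_connection X Y \<in> vector_fields stiefel"
    if "X \<in> vector_fields stiefel" "Y \<in> vector_fields stiefel" for X Y
    using lc(1,4) that by blast+
  have sym: "S X Y = S Y X" if "X \<in> vector_fields stiefel" "Y \<in> vector_fields stiefel" for X Y
  proof -
    have "nabla X Y m - nabla Y X m = christoffel_connection X Y m - christoffel_connection Y X m"
      using lc(2,5)[OF that m] by simp
    then show ?thesis
      by (simp add: S_def algebra_simps)
  qed
  have tan: "S X Y \<in> stiefel_tangent m" if "X \<in> vector_fields stiefel" "Y \<in> vector_fields stiefel" for X Y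
    unfolding S_def using vf[OF that] m by (intro stiefel_tangent_diff vector_fields_stiefelD)
  define T where "T X Y Z = canonical_metric m (S X Y) (Z m)" for X Y Z
  have skew: "T X Y Z = - T X Z Y"
    if XYZ: "X \<in> vector_fields stiefel" "Y \<in> vector_fields stiefel" "Z \<in> vector_fields stiefel" for X Y Z
  proof -
    obtain c where c: "\<forall>t. c t \<in> stiefel" "c 0 = m" "(c has_vector_derivative X m) (at 0)"
      using XYZ(1) m unfolding vector_fields_def tangent_space_def by blast
    have "has_derivative_along stiefel (\<lambda>x. met x (Y x) (Z x)) m (X m)
          (met m (nabla X Y m) (Z m) + met m (Y m) (nabla X Z m))"
      "has_derivative_along stiefel (\<lambda>x. met x (Y x) (Z x)) m (X m)
          (met m (christoffel_connection X Y m) (Z m) + met m (Y m) (christoffel_connection X Z m))"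
      using lc(3,6)[OF XYZ(1,2) m XYZ(3)] by blast+
    then have "met m (nabla X Y m) (Z m) + met m (Y m) (nabla X Z m) =
        met m (christoffel_connection X Y m) (Z m) + met m (Y m) (christoffel_connection X Z m)"
      unfolding has_derivative_along_def using c DERIV_unique by blast
    then have "canonical_metric m (nabla X Y m) (Z m) + canonical_metric m (Y m) (nabla X Z m) =
        canonical_metric m (christoffel_connection X Y m) (Z m) + canonical_metric m (Y m) (christoffel_connection X Z m)"
      using XYZ vf m by (simp add: met_eq vector_fields_stiefelD)
    then show ?thesis
      by (simp add: T_def S_def canonical_metric_def matrix_mult_linear_simps inner_diff_left inner_diff_right
          inner_commute[of "Y m"] inner_commute[of "adj m ** Y m"] algebra_simps)
  qed
  have Tsym: "T X Y Z = T Y X Z" if "X \<in> vector_fields stiefel" "Y \<in> vector_fields stiefel" for X Y Z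
    unfolding T_def sym[OF that] ..
  have zero: "T X Y Z = 0"
    if "X \<in> vector_fields stiefel" "Y \<in> vector_fields stiefel" "Z \<in> vector_fields stiefel" for X Y Z
    using that skew[of X Y Z] Tsym[of X Z Y] skew[of Z X Y] Tsym[of Z Y X] skew[of Y Z X] Tsym[of Y X Z]
    by linarith
  \<comment> \<open>The difference of the connections is itself a vector field and can serve as test
    field, so no tangent vector has to be extended.\<close>
  define Z where "Z x = nabla X Y x - christoffel_connection X Y x" for x
  have "Z \<in> vector_fields stiefel"
    unfolding Z_def using vf[OF X Y]
    by (intro vector_fields_stiefelI smooth_diff stiefel_tangent_diff) (auto intro: vector_fields_stiefelD)
  from zero[OF X Y this] have "canonical_metric m (S X Y) (S X Y) = 0"
    by (simp add: T_def S_def Z_def)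
  then have "S X Y = 0"
    using canonical_metric_pos[OF m tan[OF X Y]] by simp
  then show ?thesis
    by (simp add: S_def)
qed

text \<open>The chosen connection, fields and coefficients disappear from the result, so the
  covariant derivative is unique and the description in \<open>geodesic_curvature\<close> is
  meaningful. Differentiability of \<open>V\<close> is part of the conclusion.\<close>

lemma has_covariant_derivative_imp:
  assumes "has_covariant_derivative stiefel met c V w t"
  obtains v V' where "(c has_vector_derivative v) (at t)" "(V has_vector_derivative V') (at t)"
    "w = V' + christoffel (c t) v (V t)"
proof -
  obtain nabla and N :: nat and f f' W X where h: "levi_civita stiefel met nabla"
      "X \<in> vector_fields stiefel" "(c has_vector_derivative X (c t)) (at t)"
      "\<And>i. i < N \<Longrightarrow> W i \<in> vector_fields stiefel" "\<And>i. i < N \<Longrightarrow> (f i has_real_derivative f' i) (at t)"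
      "\<forall>\<^sub>F \<tau> in nhds t. c \<tau> \<in> stiefel \<and> V \<tau> = (\<Sum>i<N. f i \<tau> *\<^sub>R W i (c \<tau>))"
      "w = (\<Sum>i<N. f' i *\<^sub>R W i (c t) + f i t *\<^sub>R nabla X (W i) (c t))"
    using assms unfolding has_covariant_derivative_def by blast
  have ct: "c t \<in> stiefel" and Vt: "V t = (\<Sum>i<N. f i t *\<^sub>R W i (c t))"
    using eventually_nhds_x_imp_x[OF h(6)] by auto
  let ?D = "\<lambda>i. frechet_derivative (W i) (at (c t)) (X (c t))"
  have "((\<lambda>\<tau>. \<Sum>i<N. f i \<tau> *\<^sub>R W i (c \<tau>)) has_vector_derivative
      (\<Sum>i<N. f i t *\<^sub>R ?D i + f' i *\<^sub>R W i (c t))) (at t)"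
    by (intro has_vector_derivative_sum has_vector_derivative_scaleR h has_vector_derivative_chain[OF h(3)]
        smooth_has_derivative vector_fields_stiefelD) auto
  then have "(V has_vector_derivative (\<Sum>i<N. f i t *\<^sub>R ?D i + f' i *\<^sub>R W i (c t))) (at t)"
    by (subst has_vector_derivative_cong_ev) (use h(6) in \<open>auto elim!: eventually_mono simp: Vt\<close>)
  moreover have "w = (\<Sum>i<N. f i t *\<^sub>R ?D i + f' i *\<^sub>R W i (c t)) + christoffel (c t) (X (c t)) (V t)"
    using h ct by (simp add: levi_civita_unique christoffel_connection_def Vt christoffel_sum_right
        christoffel_scaleR_right scaleR_add_right sum.distrib algebra_simps)
  ultimately show ?thesis
    using that h(3) by blast
qed

text \<open>An integral curve of \<open>X\<close> has velocity \<open>X (c t)\<close>: a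
  decomposition with one field and constant coefficient 1.\<close>

lemma has_covariant_derivativeI:
  assumes X: "X \<in> vector_fields stiefel" and c: "\<And>t. c t \<in> stiefel"
    "\<And>t. (c has_vector_derivative X (c t)) (at t)"
  shows "has_covariant_derivative stiefel met c (velocity c) (christoffel_connection X X (c t)) t"
  unfolding has_covariant_derivative_def
proof (intro exI conjI allI impI)
  show "levi_civita stiefel met christoffel_connection"
    by (rule levi_civita_christoffel_connection)
  show "((\<lambda>_. 1) has_real_derivative 0) (at t)"
    by simp
  show "X \<in> vector_fields stiefel" "X \<in> vector_fields stiefel" "(c has_vector_derivative X (c t)) (at t)"
    by (fact X X c)+
  have "velocity c \<tau> = X (c \<tau>)" for \<tau>
    unfolding velocity_def by (rule vector_derivative_at) (rule c)
  then show "\<forall>\<^sub>F \<tau> in nhds t. c \<tau> \<in> stiefel \<and> velocity c \<tau> = (\<Sum>i<Suc 0. 1 *\<^sub>R X (c \<tau>))"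
    by (simp add: c)
  show "christoffel_connection X X (c t) =
      (\<Sum>i<Suc 0. 0 *\<^sub>R X (c t) + 1 *\<^sub>R christoffel_connection X X (c t))"
    by simp
qed

lemma has_covariant_derivative_unique:
  assumes "has_covariant_derivative stiefel met c V w t" "has_covariant_derivative stiefel met c V w' t"
  shows "w = w'"
proof -
  obtain v V' where 1: "(c has_vector_derivative v) (at t)" "(V has_vector_derivative V') (at t)"
      "w = V' + christoffel (c t) v (V t)"
    using assms(1) by (rule has_covariant_derivative_imp)
  obtain u U' where 2: "(c has_vector_derivative u) (at t)" "(V has_vector_derivative U') (at t)"
      "w' = U' + christoffel (c t) u (V t)"
    using assms(2) by (rule has_covariant_derivative_imp)
  have "v = u" "V' = U'"
    using vector_derivative_unique_at 1 2 by blast+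
  then show ?thesis
    using 1 2 by simp
qed

end

section \<open>Quasi-geodesics and their covariant acceleration\<close>

text \<open>Presents the curve as \<open>Ink\<close> moved by unitary pairs, the shape to which the
  invariance lemmas apply.\<close>

lemma quasi_geodesic_eq:
  fixes r :: "'a::hurwitz_algebra^('k::finite + 'l::finite)^('k + 'l)"
  assumes A: "A \<in> skew_hermitian"
  shows "quasi_geodesic r s B A t = (r ** mexp (t *\<^sub>R offdiag B)) ** Ink ** adj (s ** mexp (t *\<^sub>R A))"
  using A by (simp add: quasi_geodesic_def adj_mult adj_mexp adj_scaleR skew_hermitianD matrix_mul_assoc)

lemma unitary_conj_skew:
  fixes A :: "'a::hurwitz_algebra^'n^'n"
  assumes "A \<in> skew_hermitian"
  shows "r ** A ** adj r \<in> skew_hermitian"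
  using assms by (simp add: skew_hermitian_def adj_mult matrix_mult_linear_simps matrix_mul_assoc)

lemma linear_field_in_vector_fields:
  fixes \<Psi> :: "'a::hurwitz_algebra^('k::finite + 'l::finite)^('k + 'l)"
  assumes \<Psi>: "\<Psi> \<in> skew_hermitian" and A: "A \<in> skew_hermitian"
  shows "(\<lambda>m :: 'a^'k^('k + 'l). \<Psi> ** m - m ** A) \<in> vector_fields stiefel"
proof (rule vector_fields_stiefelI)
  show "smooth (\<lambda>m :: 'a^'k^('k + 'l). \<Psi> ** m - m ** A)"
    by (intro smooth_bounded_linear bounded_linear_sub matrix_mult.bounded_linear_left
        matrix_mult.bounded_linear_right)
  show "\<Psi> ** m - m ** A \<in> stiefel_tangent m" if m: "m \<in> stiefel" for m
  proof -
    have "adj m ** (\<Psi> ** m - m ** A) = adj m ** \<Psi> ** m - A"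
      using stiefelD[OF m] by (simp add: matrix_mult_linear_simps matrix_mul_assoc)
    moreover have "A ** adj m ** m = A"
      using stiefelD[OF m] by (simp flip: matrix_mul_assoc)
    ultimately show ?thesis
      using \<Psi> A by (simp add: stiefel_tangent_def skew_hermitian_def adj_simps matrix_mult_linear_simps matrix_mul_assoc)
  qed
qed

text \<open>The flat acceleration has upper block \<open>A ** A - B ** adj B\<close> and lower block
  \<open>2 *\<^sub>R (adj B ** A)\<close>. The Christoffel term removes the first and half of the
  second.\<close>

lemma christoffel_connection_linear_field_at_Ink:
  fixes A :: "'a::hurwitz_algebra^'k^'k" and B :: "'a^'l^'k"
  defines "X \<equiv> \<lambda>m. offdiag B ** m - m ** A"
  assumes A: "A \<in> skew_hermitian"
  shows "X (X Ink) + christoffel Ink (X Ink) (X Ink) = stack 0 (adj B ** A)"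
proof -
  have X: "X (stack C D) = stack (B ** D - C ** A) (- (adj B ** C) - D ** A)" for C D
  proof -
    have 1: "offdiag B ** stack C D = stack (B ** D) (- (adj B ** C))"
      by (simp add: offdiag_def vec_eq_iff_Plus matrix_mult_nth sum_UNIV_Plus vec_eq_iff[where 'b = 'k] sum_negf)
    have 2: "stack C D ** A = stack (C ** A) (D ** A)"
      by (simp add: vec_eq_iff_Plus matrix_mult_nth vec_eq_iff[where 'b = 'k])
    show ?thesis
      by (simp add: X_def 1 2 stack_diff)
  qed
  define p where "p = stack (0 :: 'a^'k^'k) (- adj B)"
  have X0: "X Ink = Ink ** (- A) + p"
    unfolding X_def velocity_at_Ink p_def by (simp add: Ink_mult stack_add)
  have pp: "adj p ** p = B ** adj B"
    by (simp add: p_def vec_eq_iff matrix_mult_nth adj_nth sum_UNIV_Plus hconj_minus)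
  have "X (X Ink) = stack (A ** A - B ** adj B) (2 *\<^sub>R (adj B ** A))"
  proof -
    have "X Ink = stack (- A) (- adj B)"
      unfolding X_def by (rule velocity_at_Ink)
    then show ?thesis
      by (simp add: X matrix_mult_linear_simps scaleR_2)
  qed
  moreover have "christoffel Ink (X Ink) (X Ink) = stack (B ** adj B - A ** A) (- (adj B ** A))"
  proof -
    have "- A \<in> skew_hermitian"
      using A by (simp add: skew_hermitian_def adj_minus)
    moreover have "adj Ink ** p = 0"
      by (simp add: p_def adj_Ink_mult_stack)
    ultimately have "christoffel Ink (X Ink) (X Ink) = (1 / 2) *\<^sub>R
        (Ink ** (adj p ** p + adj p ** p - (- A ** - A + - A ** - A)) - (p ** - A + p ** - A))"
      unfolding X0 by (intro christoffel_split[OF Ink_stiefel])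
    also have "\<dots> = (1 / 2) *\<^sub>R (2 *\<^sub>R (Ink ** (B ** adj B - A ** A) + p ** A))"
      unfolding pp scaleR_2 by (simp add: matrix_mult_linear_simps algebra_simps)
    also have "\<dots> = Ink ** (B ** adj B - A ** A) + p ** A"
      by simp
    also have "p ** A = stack 0 (- (adj B ** A))"
      by (simp add: p_def vec_eq_iff_Plus matrix_mult_nth vec_eq_iff[where 'b = 'k] sum_negf)
    finally show ?thesis
      by (simp add: Ink_mult stack_add)
  qed
  ultimately show ?thesis
    by (simp add: stack_add scaleR_2)
qed

text \<open>A generator commutes with its exponential, so the unitary pair reached at time
  \<open>t\<close> carries the field generated by \<open>offdiag B\<close> and \<open>A\<close> to
  the conjugated field along the curve.\<close>

lemma linear_field_translate:
  fixes r :: "'a::hurwitz_algebra^('k::finite + 'l::finite)^('k + 'l)" and m :: "'a^'k^('k + 'l)"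
    and s A :: "'a^'k^'k" and B :: "'a^'l^'k" and t :: real
  defines "U \<equiv> r ** mexp (t *\<^sub>R offdiag B)" and "S \<equiv> s ** mexp (t *\<^sub>R A)"
  assumes r: "r \<in> unitary" and s: "s \<in> unitary" and A: "A \<in> skew_hermitian"
  shows "(r ** offdiag B ** adj r) ** (U ** m ** adj S) - (U ** m ** adj S) ** (s ** A ** adj s) =
    U ** (offdiag B ** m - m ** A) ** adj S"
proof -
  have "(r ** offdiag B ** adj r) ** (U ** m ** adj S) =
      r ** (offdiag B ** ((adj r ** r) ** mexp (t *\<^sub>R offdiag B))) ** m ** adj S"
    by (simp only: U_def matrix_mul_assoc)
  also have "\<dots> = r ** (mexp (t *\<^sub>R offdiag B) ** offdiag B) ** m ** adj S"
    using r by (simp add: unitaryD mexp_self_commute)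
  finally have 1: "(r ** offdiag B ** adj r) ** (U ** m ** adj S) = U ** (offdiag B ** m) ** adj S"
    by (simp only: U_def matrix_mul_assoc)
  have S: "adj S = mexp (t *\<^sub>R (- A)) ** adj s"
    using A by (simp add: S_def adj_mult adj_mexp adj_scaleR skew_hermitianD)
  have "mexp (t *\<^sub>R (- A)) ** A = A ** mexp (t *\<^sub>R (- A))"
    using mexp_self_commute[of t "- A"] by (simp add: matrix_mult_linear_simps)
  moreover have "(U ** m ** adj S) ** (s ** A ** adj s) =
      U ** m ** (mexp (t *\<^sub>R (- A)) ** (adj s ** s) ** A) ** adj s"
    by (simp only: S matrix_mul_assoc)
  ultimately have "(U ** m ** adj S) ** (s ** A ** adj s) = U ** m ** (A ** mexp (t *\<^sub>R (- A))) ** adj s"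
    using s by (simp add: unitaryD)
  then have 2: "(U ** m ** adj S) ** (s ** A ** adj s) = U ** (m ** A) ** adj S"
    by (simp only: S matrix_mul_assoc)
  show ?thesis
    unfolding 1 2 by (simp add: matrix_mult_linear_simps)
qed

lemma quasi_geodesic_velocity:
  fixes r :: "'a::hurwitz_algebra^('k::finite + 'l::finite)^('k + 'l)"
  assumes "r \<in> unitary" "s \<in> unitary" "A \<in> skew_hermitian"
  shows "velocity (quasi_geodesic r s B A) t =
    (r ** mexp (t *\<^sub>R offdiag B)) ** (offdiag B ** Ink - Ink ** A) ** adj (s ** mexp (t *\<^sub>R A))"
  using vector_derivative_at[OF quasi_geodesic_has_vector_derivative[OF assms(1,2), of B A t]]
  by (simp only: velocity_def quasi_geodesic_eq[OF assms(3)] linear_field_translate[OF assms])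

text \<open>The family is closed under linear reparametrization, hence contains the arc-length
  parametrizations.\<close>

lemma quasi_geodesic_rescale:
  "quasi_geodesic r s B A (c * t) = quasi_geodesic r s (c *\<^sub>R B) (c *\<^sub>R A) t"
  by (simp add: quasi_geodesic_def mult.commute flip: offdiag_scaleR)

context stiefel_metric
begin

lemma quasi_geodesic_covariant_derivative:
  assumes r: "r \<in> unitary" and s: "s \<in> unitary" and A: "A \<in> skew_hermitian"
  shows "has_covariant_derivative stiefel met (quasi_geodesic r s B A) (velocity (quasi_geodesic r s B A))
    ((r ** mexp (t *\<^sub>R offdiag B)) ** stack 0 (adj B ** A) ** adj (s ** mexp (t *\<^sub>R A))) t"
proof -
  let ?c = "quasi_geodesic r s B A" and ?U = "r ** mexp (t *\<^sub>R offdiag B)" and ?S = "s ** mexp (t *\<^sub>R A)"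
  define X where "X m = (r ** offdiag B ** adj r) ** m - m ** (s ** A ** adj s)" for m :: "'a^'k^('k + 'l)"
  define X0 where "X0 m = offdiag B ** m - m ** A" for m :: "'a^'k^('k + 'l)"
  have X: "X \<in> vector_fields stiefel"
    unfolding X_def using A by (intro linear_field_in_vector_fields unitary_conj_skew offdiag_skew)
  have U: "?U \<in> unitary" "?S \<in> unitary"
    using A r s by (auto intro: unitary_mult mexp_skew_unitary offdiag_skew)
  have XU: "X (?U ** m ** adj ?S) = ?U ** X0 m ** adj ?S" for m
    unfolding X_def X0_def by (rule linear_field_translate[OF r s A])
  have "(X has_derivative X) (at x)" for x
    unfolding X_def
    by (intro bounded_linear_imp_has_derivative bounded_linear_sub matrix_mult.bounded_linear_left
        matrix_mult.bounded_linear_right)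
  then have "christoffel_connection X X m = X (X m) + christoffel m (X m) (X m)" for m
    using frechet_derivative_at[of X X] by (simp add: christoffel_connection_def)
  then have "christoffel_connection X X (?c t) = ?U ** (X0 (X0 Ink) + christoffel Ink (X0 Ink) (X0 Ink)) ** adj ?S"
    unfolding quasi_geodesic_eq[OF A] by (simp only: XU christoffel_unitary[OF U]) (simp add: matrix_mult_linear_simps)
  also have "\<dots> = ?U ** stack 0 (adj B ** A) ** adj ?S"
    unfolding X0_def christoffel_connection_linear_field_at_Ink[OF A] ..
  finally show ?thesis
    using has_covariant_derivativeI[OF X, of ?c t] quasi_geodesic_in_stiefel[OF r s A]
      quasi_geodesic_has_vector_derivative[OF r s, of B A]
    by (simp add: X_def)
qed

lemma quasi_geodesic_riemannian_geodesic:
  assumes r: "r \<in> unitary" and s: "s \<in> unitary" and A: "A \<in> skew_hermitian"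
    and 0: "A = 0 \<or> B = 0"
  shows "riemannian_geodesic stiefel met (quasi_geodesic r s B A)"
proof -
  have "stack 0 (adj B ** A) = (0 :: 'a^'k^('k + 'l))"
    using 0 by (auto simp: Ink_mult[symmetric] matrix_mult.zero_right)
  then show ?thesis
    using quasi_geodesic_covariant_derivative[OF r s A, of B] quasi_geodesic_in_stiefel[OF r s A]
    by (auto simp: riemannian_geodesic_def)
qed

lemma quasi_geodesic_unit_speed:
  assumes r: "r \<in> unitary" and s: "s \<in> unitary" and A: "A \<in> skew_hermitian"
    and 1: "B \<bullet> B + 1 / 2 * (A \<bullet> A) = 1"
  shows "unit_speed stiefel met (quasi_geodesic r s B A)"
  unfolding unit_speed_def
proof (intro allI conjI)
  fix t
  let ?c = "quasi_geodesic r s B A" and ?U = "r ** mexp (t *\<^sub>R offdiag B)" and ?S = "s ** mexp (t *\<^sub>R A)"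
  show c: "?c t \<in> stiefel"
    by (rule quasi_geodesic_in_stiefel[OF r s A])
  show "?c differentiable (at t)"
    using quasi_geodesic_has_vector_derivative[OF r s] by (auto simp: has_vector_derivative_def differentiable_def)
  have U: "?U \<in> unitary" "?S \<in> unitary"
    using A r s by (auto intro: unitary_mult mexp_skew_unitary offdiag_skew)
  have "velocity ?c t \<in> stiefel_tangent (?c t)"
    using velocity_in_stiefel_tangent[of ?c, OF quasi_geodesic_in_stiefel[OF r s A]]
      quasi_geodesic_has_vector_derivative[OF r s] unfolding velocity_def
    by (metis vector_derivative_at)
  then have "met (?c t) (velocity ?c t) (velocity ?c t) = canonical_metric (?c t) (velocity ?c t) (velocity ?c t)"
    by (simp add: met_eq c)
  also have "\<dots> = ptrace_form (offdiag B, A) (offdiag B, A)"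
    unfolding quasi_geodesic_velocity[OF r s A]
    unfolding quasi_geodesic_eq[OF A] by (rule canonical_metric_push_forward[OF U A])
  also have "\<dots> = 1"
    using A 1 by (simp add: ptrace_form_def trace_form_skew offdiag_skew inner_offdiag)
  finally show "met (?c t) (velocity ?c t) (velocity ?c t) = 1" .
qed

text \<open>A non-constant curve has nonzero generator, so division by its norm
  \<open>\<sigma>\<close> yields unit speed. The curvature vector is then one fixed matrix moved by
  unitary pairs.\<close>

lemma quasi_geodesic_constant_curvature:
  assumes r: "r \<in> unitary" and s: "s \<in> unitary" and A: "A \<in> skew_hermitian"
    and nc: "\<not> quasi_geodesic r s B A constant_on UNIV"
  shows "constant_geodesic_curvature stiefel met (quasi_geodesic r s B A)"
proof -
  define \<sigma> where "\<sigma> = sqrt (B \<bullet> B + 1 / 2 * (A \<bullet> A))"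
  have "B \<bullet> B + 1 / 2 * (A \<bullet> A) > 0"
  proof (rule ccontr)
    assume "\<not> ?thesis"
    then have "B \<bullet> B = 0 \<and> A \<bullet> A = 0"
      using inner_ge_zero[of A] inner_ge_zero[of B] by linarith
    then have "A = 0" "offdiag B = (0 :: 'a^('k + 'l)^('k + 'l))"
      using inner_offdiag[of B B] by simp_all
    then have "quasi_geodesic r s B A constant_on UNIV"
      by (simp add: constant_on_def quasi_geodesic_def)
    with nc show False ..
  qed
  then have \<sigma>: "\<sigma> > 0" "B \<bullet> B + 1 / 2 * (A \<bullet> A) = \<sigma>\<^sup>2"
    by (simp_all add: \<sigma>_def)
  define c where "c = inverse \<sigma>"
  have c: "c > 0"
    using \<sigma> by (simp add: c_def)
  let ?B = "c *\<^sub>R B" and ?A = "c *\<^sub>R A"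
  let ?q = "quasi_geodesic r s ?B ?A"
  have A': "?A \<in> skew_hermitian"
    using A by (rule skew_hermitian_scaleR)
  have q: "quasi_geodesic r s B A \<circ> (\<lambda>t. c * t) = ?q"
    by (rule ext) (simp add: quasi_geodesic_rescale)
  have "?B \<bullet> ?B + 1 / 2 * (?A \<bullet> ?A) = c\<^sup>2 * (B \<bullet> B + 1 / 2 * (A \<bullet> A))"
    by (simp add: power2_eq_square algebra_simps)
  also have "\<dots> = 1"
    using \<sigma> by (simp add: c_def power_inverse)
  finally have speed: "unit_speed stiefel met ?q"
    by (intro quasi_geodesic_unit_speed r s A')
  let ?z = "stack 0 (adj ?B ** ?A) :: 'a^'k^('k + 'l)"
  have curv: "geodesic_curvature stiefel met ?q t = sqrt (canonical_metric Ink ?z ?z)" for t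
  proof -
    let ?U = "r ** mexp (t *\<^sub>R offdiag ?B)" and ?S = "s ** mexp (t *\<^sub>R ?A)"
    let ?w = "?U ** ?z ** adj ?S"
    have U: "?U \<in> unitary" "?S \<in> unitary"
      by (intro unitary_mult mexp_skew_unitary offdiag_skew r s A')+
    note w = quasi_geodesic_covariant_derivative[OF r s A', of ?B t]
    have the: "(THE w. has_covariant_derivative stiefel met ?q (velocity ?q) w t) = ?w"
      using w has_covariant_derivative_unique by blast
    \<comment> \<open>The upper block of \<open>?z\<close> is zero, so this product vanishes and
      \<open>?w\<close> is tangent; the metric may then be evaluated on it.\<close>
    have "adj (?q t) ** ?w = ?S ** (adj Ink ** ?z) ** adj ?S"
      unfolding quasi_geodesic_eq[OF A'] by (rule adj_translate_mult[OF U(1)])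
    then have "?w \<in> stiefel_tangent (?q t)"
      by (simp add: stiefel_tangent_def adj_Ink_mult_stack skew_hermitian_def)
    then have "met (?q t) ?w ?w = canonical_metric (?q t) ?w ?w"
      using quasi_geodesic_in_stiefel[OF r s A'] by (simp add: met_eq)
    also have "\<dots> = canonical_metric Ink ?z ?z"
      unfolding quasi_geodesic_eq[OF A'] by (rule canonical_metric_unitary[OF U])
    finally show ?thesis
      by (simp add: geodesic_curvature_def the Let_def)
  qed
  show ?thesis
    unfolding constant_geodesic_curvature_def
  proof (intro exI[of _ "\<lambda>t. c * t"] conjI)
    show "strict_mono (\<lambda>t. c * t)"
      using c by (simp add: strict_mono_def)
    show "surj (\<lambda>t. c * t)"
      using c by (intro surjI[of _ "\<lambda>t. t / c"]) simp
    show "\<forall>t. (\<lambda>t. c * t) differentiable (at t)"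
      by (simp add: differentiable_mult)
    show "unit_speed stiefel met (quasi_geodesic r s B A \<circ> (\<lambda>t. c * t))"
      unfolding q by (rule speed)
    show "\<exists>\<kappa>. \<forall>t. \<exists>w. has_covariant_derivative stiefel met (quasi_geodesic r s B A \<circ> (\<lambda>t. c * t))
        (velocity (quasi_geodesic r s B A \<circ> (\<lambda>t. c * t))) w t \<and>
      geodesic_curvature stiefel met (quasi_geodesic r s B A \<circ> (\<lambda>t. c * t)) t = \<kappa>"
      unfolding q using quasi_geodesic_covariant_derivative[OF r s A'] curv by blast
  qed
qed

end

section \<open>Absolutely continuous functions\<close>

text \<open>The straddle lemma of gauge integration: with \<open>x\<close> between \<open>u\<close>
  and \<open>v\<close>, the errors at the two ends add up to a multiple of
  \<open>v - u\<close>.\<close>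

lemma straddle_bound:
  fixes F :: "real \<Rightarrow> real"
  assumes F: "(F has_real_derivative g) (at x)" and e: "e > 0"
  obtains d where "d > 0"
    "\<And>u v. u \<le> x \<Longrightarrow> x \<le> v \<Longrightarrow> {u..v} \<subseteq> ball x d \<Longrightarrow> \<bar>(v - u) * g - (F v - F u)\<bar> \<le> e * (v - u)"
proof -
  obtain d where d: "d > 0" "\<And>y. \<bar>y - x\<bar> < d \<Longrightarrow> \<bar>F y - F x - g * (y - x)\<bar> \<le> e * \<bar>y - x\<bar>"
    using F e unfolding has_field_derivative_def has_derivative_at_alt by (metis real_norm_def)
  show ?thesis
  proof (rule that[OF d(1)])
    fix u v assume uv: "u \<le> x" "x \<le> v" "{u..v} \<subseteq> ball x d"
    then have "u \<in> ball x d" "v \<in> ball x d"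
      by (auto simp del: mem_ball)
    then have "\<bar>F u - F x - g * (u - x)\<bar> \<le> e * \<bar>u - x\<bar>" "\<bar>F v - F x - g * (v - x)\<bar> \<le> e * \<bar>v - x\<bar>"
      by (auto simp: dist_real_def intro!: d(2))
    moreover have "e * \<bar>u - x\<bar> + e * \<bar>v - x\<bar> = e * (v - u)"
      using uv by (simp flip: distrib_left)
    moreover have "(v - u) * g - (F v - F u) = (F u - F x - g * (u - x)) - (F v - F x - g * (v - x))"
      by (simp add: algebra_simps)
    ultimately show "\<bar>(v - u) * g - (F v - F u)\<bar> \<le> e * (v - u)"
      by linarith
  qed
qed

text \<open>
  The Henstock--Kurzweil integral needs no integrability hypothesis on \<open>g\<close>: the gauge confines the
  subintervals with a tag in \<open>N\<close> to an open set of small measure, where \<open>F\<close> varies little.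
\<close>

lemma absolutely_continuous_has_integral:
  fixes F g :: "real \<Rightarrow> real"
  assumes ab: "a \<le> b" and ac: "absolutely_continuous_curve a b F" and N: "negligible N"
    and der: "\<And>t. t \<in> {a..b} \<Longrightarrow> t \<notin> N \<Longrightarrow> (F has_real_derivative g t) (at t)"
    and zero: "\<And>t. t \<in> N \<Longrightarrow> g t = 0"
  shows "(g has_integral F b - F a) {a..b}"
  unfolding has_integral_real
proof (intro allI impI)
  fix e :: real assume e: "e > 0"
  from e have "e / 2 > 0"
    by simp
  with ac obtain \<delta> where \<delta>: "\<delta> > 0"
    "\<forall>D :: (real \<times> real) set. finite D \<and> (\<forall>(u, v)\<in>D. a \<le> u \<and> u < v \<and> v \<le> b) \<and>
      pairwise (\<lambda>(u, v) (u', v'). {u<..<v} \<inter> {u'<..<v'} = {}) D \<and>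
      (\<Sum>(u, v)\<in>D. v - u) < \<delta> \<longrightarrow> (\<Sum>(u, v)\<in>D. dist (F u) (F v)) < e / 2"
    unfolding absolutely_continuous_curve_def by blast
  have N': "N \<in> null_sets lebesgue"
    using N by (simp add: negligible_iff_null_sets)
  obtain T where T: "open T" "N \<subseteq> T" "emeasure lebesgue (T - N) < ennreal \<delta>"
    using sets_lebesgue_outer_open[OF null_setsD2[OF N'] \<delta>(1)] by metis
  have T': "emeasure lebesgue T < ennreal \<delta>" "T \<in> sets lebesgue"
    using T(3) emeasure_Diff_null_set[OF N', of T] T(1) by auto
  \<comment> \<open>The summand 1 covers \<open>a = b\<close> and makes the bound
    \<open>e' * (b - a) < e / 2\<close> strict.\<close>
  define e' where "e' = e / (2 * (b - a + 1))"
  have e': "e' > 0" "e' * (b - a) < e / 2"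
    using e ab by (auto simp: e'_def field_simps)
  have "\<exists>d>0. if x \<in> N then ball x d \<subseteq> T else x \<in> {a..b} \<longrightarrow>
      (\<forall>u v. u \<le> x \<longrightarrow> x \<le> v \<longrightarrow> {u..v} \<subseteq> ball x d \<longrightarrow> \<bar>(v - u) * g x - (F v - F u)\<bar> \<le> e' * (v - u))" for x
  proof (cases "x \<in> N")
    case True
    then have "x \<in> T"
      using T(2) by auto
    then obtain d where "d > 0" "ball x d \<subseteq> T"
      using openE[OF T(1)] by blast
    then show ?thesis
      using True by auto
  next
    case False
    show ?thesis
    proof (cases "x \<in> {a..b}")
      case True
      obtain d where "d > 0" "\<And>u v. u \<le> x \<Longrightarrow> x \<le> v \<Longrightarrow> {u..v} \<subseteq> ball x d \<Longrightarrow>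
          \<bar>(v - u) * g x - (F v - F u)\<bar> \<le> e' * (v - u)"
        using straddle_bound[OF der[OF True False] e'(1)] by metis
      then show ?thesis
        using False by auto
    qed (use False in \<open>auto intro!: exI[of _ 1]\<close>)
  qed
  then obtain d where d: "\<And>x. d x > 0" "\<And>x. x \<in> N \<Longrightarrow> ball x (d x) \<subseteq> T"
    "\<And>x u v. x \<notin> N \<Longrightarrow> x \<in> {a..b} \<Longrightarrow> u \<le> x \<Longrightarrow> x \<le> v \<Longrightarrow> {u..v} \<subseteq> ball x (d x) \<Longrightarrow>
      \<bar>(v - u) * g x - (F v - F u)\<bar> \<le> e' * (v - u)"
    by metis
  show "\<exists>\<gamma>. gauge \<gamma> \<and> (\<forall>\<D>. \<D> tagged_division_of {a..b} \<and> \<gamma> fine \<D> \<longrightarrow>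
      norm ((\<Sum>(x, k)\<in>\<D>. measure lborel k *\<^sub>R g x) - (F b - F a)) < e)"
  proof (rule exI[of _ "\<lambda>x. ball x (d x)"], rule conjI)
    show "gauge (\<lambda>x. ball x (d x))"
      using d(1) by (intro gaugeI) auto
    show "\<forall>D. D tagged_division_of {a..b} \<and> (\<lambda>x. ball x (d x)) fine D \<longrightarrow>
      norm ((\<Sum>(x, k)\<in>D. measure lborel k *\<^sub>R g x) - (F b - F a)) < e"
    proof (intro allI impI, elim conjE)
      fix D assume D: "D tagged_division_of {a..b}" and fine: "(\<lambda>x. ball x (d x)) fine D"
      note tag = tagged_division_ofD[OF D]
      have fin: "finite D"
        by (rule tag(1))
      have K: "\<exists>u v. K = {u..v} \<and> u \<le> x \<and> x \<le> v \<and> a \<le> u \<and> v \<le> b \<and> {u..v} \<subseteq> ball x (d x)"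
        if xK: "(x, K) \<in> D" for x K
      proof -
        obtain u v where "K = {u..v}"
          using tag(4)[OF xK] by auto
        moreover have "x \<in> K" "K \<subseteq> {a..b}" "K \<subseteq> ball x (d x)"
          using tag(2,3)[OF xK] fine xK by (auto simp: fine_def)
        ultimately show ?thesis
          by auto
      qed
      \<comment> \<open>Degenerate intervals are left out because absolute continuity is formulated
        for \<open>u < v\<close>; they contribute no increment of \<open>F\<close>.\<close>
      define D' where "D' = {(x, K) \<in> D. x \<in> N \<and> Inf K < Sup K}"
      define P where "P = (\<lambda>(x, K). (Inf K, Sup K)) ` D'"
      have fin': "finite D'"
        using fin by (rule finite_subset[rotated]) (auto simp: D'_def)
      have disj: "{Inf K<..<Sup K} \<inter> {Inf K'<..<Sup K'} = {}"
        if "(x, K) \<in> D'" "(x', K') \<in> D'" "(x, K) \<noteq> (x', K')" for x K x' K'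
      proof -
        have *: "(x, K) \<in> D" "(x', K') \<in> D"
          using that by (auto simp: D'_def)
        obtain u v u' v' where "K = {u..v}" "u \<le> v" "K' = {u'..v'}" "u' \<le> v'"
          using K[OF *(1)] K[OF *(2)] by force
        moreover have "interior K \<inter> interior K' = {}"
          using tag(5)[OF *] that(3) by auto
        ultimately show ?thesis
          by simp
      qed
      have inj: "inj_on (\<lambda>(x, K). (Inf K, Sup K)) D'"
      proof (rule inj_onI, rule ccontr)
        fix p q assume pq: "p \<in> D'" "q \<in> D'" "(case p of (x, K) \<Rightarrow> (Inf K, Sup K)) = (case q of (x, K) \<Rightarrow> (Inf K, Sup K))"
          "p \<noteq> q"
        obtain x K x' K' where *: "p = (x, K)" "q = (x', K')"
          by (cases p; cases q)
        have "{Inf K<..<Sup K} = {}" "Inf K < Sup K"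
          using disj[of x K x' K'] pq by (auto simp: * D'_def)
        then show False
          by simp
      qed
      have pw: "pairwise (\<lambda>(u, v) (u', v'). {u<..<v} \<inter> {u'<..<v'} = {}) P"
        unfolding P_def by (rule pairwise_imageI) (use disj in auto)
      have sub: "{Inf K<..<Sup K} \<subseteq> T" if xK: "(x, K) \<in> D'" for x K
      proof -
        have "(x, K) \<in> D" "x \<in> N"
          using xK by (auto simp: D'_def)
        then obtain u v where "K = {u..v}" "u \<le> v" "{u..v} \<subseteq> ball x (d x)"
          using K by force
        then show ?thesis
          using d(2)[OF \<open>x \<in> N\<close>] by force
      qed
      \<comment> \<open>The open intervals are disjoint and contained in \<open>T\<close>, so their
        total length is below \<open>\<delta>\<close>.\<close>
      have "ennreal (\<Sum>(u, v)\<in>P. v - u) = (\<Sum>(u, v)\<in>P. ennreal (v - u))"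
        by (subst sum_ennreal[symmetric]) (auto simp: P_def D'_def case_prod_unfold)
      also have "\<dots> = (\<Sum>p\<in>P. emeasure lebesgue (case p of (u, v) \<Rightarrow> {u<..<v}))"
        by (intro sum.cong) (auto simp: P_def D'_def)
      also have "\<dots> = emeasure lebesgue (\<Union>p\<in>P. case p of (u, v) \<Rightarrow> {u<..<v})"
      proof (rule sum_emeasure)
        show "disjoint_family_on (\<lambda>p. case p of (u, v) \<Rightarrow> {u<..<v}) P"
          using pw by (simp add: disjoint_family_on_def pairwise_def case_prod_unfold)
      qed (use fin' in \<open>auto simp: P_def\<close>)
      also have "\<dots> \<le> emeasure lebesgue T"
        using sub T'(2) by (intro emeasure_mono) (auto simp: P_def)
      also have "\<dots> < ennreal \<delta>"
        by (rule T')
      finally have "(\<Sum>(u, v)\<in>P. v - u) < \<delta>"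
      proof (subst (asm) ennreal_less_iff)
        show "0 \<le> (\<Sum>(u, v)\<in>P. v - u)"
          by (intro sum_nonneg) (auto simp: P_def D'_def)
      qed
      moreover have "\<forall>(u, v)\<in>P. a \<le> u \<and> u < v \<and> v \<le> b"
      proof -
        have "a \<le> Inf K \<and> Sup K \<le> b" if "(x, K) \<in> D" for x K
          using K[OF that] by auto
        then show ?thesis
          by (auto simp: P_def D'_def)
      qed
      ultimately have "(\<Sum>(u, v)\<in>P. dist (F u) (F v)) < e / 2"
        using fin' pw by (intro \<delta>(2)[THEN spec, THEN mp] conjI) (auto simp: P_def)
      also have "(\<Sum>(u, v)\<in>P. dist (F u) (F v)) = (\<Sum>(x, K)\<in>D'. \<bar>F (Sup K) - F (Inf K)\<bar>)"
        unfolding P_def by (subst sum.reindex[OF inj]) (simp add: case_prod_unfold dist_real_def abs_minus_commute)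
      also have "\<dots> = (\<Sum>(x, K)\<in>D. if x \<in> N then \<bar>F (Sup K) - F (Inf K)\<bar> else 0)"
      proof (rule sum.mono_neutral_cong_left[OF fin])
        show "\<forall>i\<in>D - D'. (case i of (x, K) \<Rightarrow> if x \<in> N then \<bar>F (Sup K) - F (Inf K)\<bar> else 0) = 0"
        proof
          fix p assume p: "p \<in> D - D'"
          obtain x K where xK: "p = (x, K)"
            by (cases p)
          then have "x \<in> N \<Longrightarrow> \<not> Inf K < Sup K" "(x, K) \<in> D"
            using p by (auto simp: D'_def)
          then have "x \<in> N \<Longrightarrow> Inf K = Sup K"
            using K[of x K] by fastforce
          then show "(case p of (x, K) \<Rightarrow> if x \<in> N then \<bar>F (Sup K) - F (Inf K)\<bar> else 0) = 0"
            by (simp add: xK)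
        qed
      qed (auto simp: D'_def)
      finally have small: "(\<Sum>(x, K)\<in>D. if x \<in> N then \<bar>F (Sup K) - F (Inf K)\<bar> else 0) < e / 2" .
      \<comment> \<open>The increment of \<open>F\<close> telescopes over the division. Tags outside
        \<open>N\<close> are handled by the straddle estimate; for tags in \<open>N\<close> the term
        with \<open>g\<close> is zero and the variation of \<open>F\<close> remains.\<close>
      have "norm ((\<Sum>(x, K)\<in>D. measure lborel K *\<^sub>R g x) - (F b - F a)) =
          norm (\<Sum>(x, K)\<in>D. measure lborel K *\<^sub>R g x - (F (Sup K) - F (Inf K)))"
        unfolding additive_tagged_division_1[OF ab D, of F, symmetric]
        by (simp add: sum_subtractf case_prod_unfold)
      also have "\<dots> \<le> (\<Sum>(x, K)\<in>D. e' * (Sup K - Inf K) + (if x \<in> N then \<bar>F (Sup K) - F (Inf K)\<bar> else 0))"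
      proof (rule sum_norm_le, clarify)
        fix x K assume xK: "(x, K) \<in> D"
        then obtain u v where uv: "K = {u..v}" "u \<le> x" "x \<le> v" "a \<le> u" "v \<le> b" "{u..v} \<subseteq> ball x (d x)"
          using K by blast
        then show "norm (measure lborel K *\<^sub>R g x - (F (Sup K) - F (Inf K))) \<le>
            e' * (Sup K - Inf K) + (if x \<in> N then \<bar>F (Sup K) - F (Inf K)\<bar> else 0)"
          using d(3)[of x u v] zero[of x] e'(1) by (auto simp: mult.commute abs_minus_commute[of "F u"])
      qed
      also have "\<dots> = e' * (\<Sum>(x, K)\<in>D. Sup K - Inf K) + (\<Sum>(x, K)\<in>D. if x \<in> N then \<bar>F (Sup K) - F (Inf K)\<bar> else 0)"
        by (simp add: sum.distrib sum_distrib_left case_prod_unfold)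
      also have "(\<Sum>(x, K)\<in>D. Sup K - Inf K) = b - a"
        using additive_tagged_division_1[OF ab D, of "\<lambda>x. x"] .
      finally show "norm ((\<Sum>(x, K)\<in>D. measure lborel K *\<^sub>R g x) - (F b - F a)) < e"
        using small e'(2) by linarith
    qed
  qed
qed

text \<open>If the right-hand side is finite, the gauge-integrable \<open>g\<close> is measurable
  and absolutely integrable, so gauge and Lebesgue integrals coincide.\<close>

lemma has_integral_le_nn_integral:
  fixes g :: "real \<Rightarrow> real"
  assumes g: "(g has_integral I) {a..b}"
  shows "ennreal I \<le> (\<integral>\<^sup>+t\<in>{a..b}. ennreal \<bar>g t\<bar> \<partial>lebesgue)"
proof (cases "(\<integral>\<^sup>+t\<in>{a..b}. ennreal \<bar>g t\<bar> \<partial>lebesgue) = \<infinity>")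
  case False
  define h where "h t = indicator {a..b} t *\<^sub>R g t" for t
  have meas: "h \<in> borel_measurable lebesgue"
    unfolding h_def using has_integral_implies_lebesgue_measurable[OF g] by simp
  have eq: "(\<integral>\<^sup>+t. ennreal (norm (h t)) \<partial>lebesgue) = (\<integral>\<^sup>+t\<in>{a..b}. ennreal \<bar>g t\<bar> \<partial>lebesgue)"
    by (intro nn_integral_cong) (auto simp: h_def indicator_def)
  have int: "integrable lebesgue h"
    using meas False by (intro integrableI_bounded) (simp_all add: eq less_top del: real_norm_def)
  have "(h has_integral I) UNIV"
  proof -
    have "h = (\<lambda>t. if t \<in> {a..b} then g t else 0)"
      by (auto simp: h_def indicator_def)
    then show ?thesis
      using g has_integral_restrict_UNIV[of "{a..b}" g I] by simp
  qed
  then have "I = integral\<^sup>L lebesgue h"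
    using has_integral_integral_lebesgue[OF int] by (rule has_integral_unique)
  also have "\<dots> \<le> (\<integral>t. norm (h t) \<partial>lebesgue)"
    using int by (intro integral_mono) auto
  finally have "ennreal I \<le> ennreal (\<integral>t. norm (h t) \<partial>lebesgue)"
    by (rule ennreal_leI)
  also have "\<dots> = (\<integral>\<^sup>+t. ennreal (norm (h t)) \<partial>lebesgue)"
    using int by (intro nn_integral_eq_integral[symmetric]) auto
  finally show ?thesis
    unfolding eq .
qed simp

text \<open>The nonnegative integral is monotone on arbitrary functions, so a pointwise bound by the
  speed in \<open>sr_length\<close> is enough and measurability of that speed never has to be
  shown.\<close>

lemma absolutely_continuous_diff_le:
  fixes F :: "real \<Rightarrow> real" and l :: "real \<Rightarrow> ennreal"
  assumes ab: "a \<le> b" and ac: "absolutely_continuous_curve a b F"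
    and der: "AE t in lebesgue. t \<in> {a..b} \<longrightarrow> (\<exists>d. (F has_real_derivative d) (at t) \<and> ennreal \<bar>d\<bar> \<le> l t)"
  shows "ennreal (F b - F a) \<le> (\<integral>\<^sup>+t\<in>{a..b}. l t \<partial>lebesgue)"
proof -
  obtain N where N: "N \<in> null_sets lebesgue"
    "{t \<in> space lebesgue. \<not> (t \<in> {a..b} \<longrightarrow> (\<exists>d. (F has_real_derivative d) (at t) \<and> ennreal \<bar>d\<bar> \<le> l t))} \<subseteq> N"
    using der unfolding eventually_ae_filter by blast
  then have "\<forall>t. \<exists>d. t \<in> {a..b} - N \<longrightarrow> (F has_real_derivative d) (at t) \<and> ennreal \<bar>d\<bar> \<le> l t"
    by auto
  then obtain d where d: "\<And>t. t \<in> {a..b} - N \<Longrightarrow> (F has_real_derivative d t) (at t) \<and> ennreal \<bar>d t\<bar> \<le> l t"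
    by metis
  define g where "g t = (if t \<in> N then 0 else d t)" for t
  have "(g has_integral F b - F a) {a..b}"
    by (rule absolutely_continuous_has_integral[OF ab ac, of N])
      (use N(1) d in \<open>auto simp: g_def negligible_iff_null_sets\<close>)
  from has_integral_le_nn_integral[OF this]
  have "ennreal (F b - F a) \<le> (\<integral>\<^sup>+t\<in>{a..b}. ennreal \<bar>g t\<bar> \<partial>lebesgue)" .
  also have "\<dots> \<le> (\<integral>\<^sup>+t\<in>{a..b}. l t \<partial>lebesgue)"
    using d by (intro nn_integral_mono) (auto simp: g_def indicator_def)
  finally show ?thesis .
qed

lemma absolutely_continuous_curve_lipschitz:
  fixes c :: "real \<Rightarrow> 'b::metric_space" and F :: "real \<Rightarrow> 'c::metric_space"
  assumes c: "absolutely_continuous_curve a b c"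
    and L: "\<And>s t. s \<in> {a..b} \<Longrightarrow> t \<in> {a..b} \<Longrightarrow> dist (F s) (F t) \<le> L * dist (c s) (c t)"
  shows "absolutely_continuous_curve a b F"
  unfolding absolutely_continuous_curve_def
proof (intro allI impI)
  fix e :: real assume "e > 0"
  then have "e / (\<bar>L\<bar> + 1) > 0"
    by simp
  with c obtain \<delta> where \<delta>: "\<delta> > 0"
    "\<forall>D :: (real \<times> real) set. finite D \<and> (\<forall>(u, v)\<in>D. a \<le> u \<and> u < v \<and> v \<le> b) \<and>
      pairwise (\<lambda>(u, v) (u', v'). {u<..<v} \<inter> {u'<..<v'} = {}) D \<and>
      (\<Sum>(u, v)\<in>D. v - u) < \<delta> \<longrightarrow> (\<Sum>(u, v)\<in>D. dist (c u) (c v)) < e / (\<bar>L\<bar> + 1)"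
    unfolding absolutely_continuous_curve_def by blast
  show "\<exists>\<delta>>0. \<forall>D :: (real \<times> real) set. finite D \<and> (\<forall>(u, v)\<in>D. a \<le> u \<and> u < v \<and> v \<le> b) \<and>
      pairwise (\<lambda>(u, v) (u', v'). {u<..<v} \<inter> {u'<..<v'} = {}) D \<and>
      (\<Sum>(u, v)\<in>D. v - u) < \<delta> \<longrightarrow> (\<Sum>(u, v)\<in>D. dist (F u) (F v)) < e"
  proof (intro exI[of _ \<delta>] conjI allI impI \<delta>(1))
    fix D :: "(real \<times> real) set"
    assume D: "finite D \<and> (\<forall>(u, v)\<in>D. a \<le> u \<and> u < v \<and> v \<le> b) \<and>
      pairwise (\<lambda>(u, v) (u', v'). {u<..<v} \<inter> {u'<..<v'} = {}) D \<and> (\<Sum>(u, v)\<in>D. v - u) < \<delta>"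
    have "(\<Sum>(u, v)\<in>D. dist (F u) (F v)) \<le> (\<Sum>(u, v)\<in>D. (\<bar>L\<bar> + 1) * dist (c u) (c v))"
    proof (rule sum_mono, clarify)
      fix u v assume "(u, v) \<in> D"
      then have "dist (F u) (F v) \<le> L * dist (c u) (c v)"
        using D by (intro L) auto
      also have "\<dots> \<le> (\<bar>L\<bar> + 1) * dist (c u) (c v)"
        by (intro mult_right_mono) auto
      finally show "dist (F u) (F v) \<le> (\<bar>L\<bar> + 1) * dist (c u) (c v)" .
    qed
    also have "\<dots> = (\<bar>L\<bar> + 1) * (\<Sum>(u, v)\<in>D. dist (c u) (c v))"
      by (simp add: sum_distrib_left case_prod_unfold)
    also have "\<dots> < e"
      using \<delta>(2)[THEN spec, THEN mp, OF D] by (simp add: field_simps)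
    finally show "(\<Sum>(u, v)\<in>D. dist (F u) (F v)) < e" .
  qed
qed

lemma absolutely_continuous_curve_id: "absolutely_continuous_curve a b (\<lambda>t. t)"
  unfolding absolutely_continuous_curve_def dist_real_def
proof (intro allI impI)
  fix e :: real assume "e > 0"
  have *: "(\<Sum>(u, v)\<in>D. \<bar>u - v\<bar>) = (\<Sum>(u, v)\<in>D. v - u)"
    if "\<forall>(u, v)\<in>D. a \<le> u \<and> u < v \<and> v \<le> b" for D :: "(real \<times> real) set"
    using that by (intro sum.cong) auto
  then show "\<exists>\<delta>>0. \<forall>D :: (real \<times> real) set. finite D \<and> (\<forall>(u, v)\<in>D. a \<le> u \<and> u < v \<and> v \<le> b) \<and>
      pairwise (\<lambda>(u, v) (u', v'). {u<..<v} \<inter> {u'<..<v'} = {}) D \<and>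
      (\<Sum>(u, v)\<in>D. v - u) < \<delta> \<longrightarrow> (\<Sum>(u, v)\<in>D. \<bar>u - v\<bar>) < e"
    using \<open>e > 0\<close> by (intro exI[of _ e]) (simp add: *)
qed

section \<open>One-parameter subgroups minimize length\<close>

text \<open>A maximizer \<open>v\<close> of the quadratic form on the unit sphere of
  \<open>U\<close> is an eigenvector: \<open>T = \<mu> - S\<close> is positive semidefinite on
  \<open>U\<close> and vanishes quadratically at \<open>v\<close>, which forces
  \<open>T v = 0\<close>.\<close>

lemma self_adjoint_max_eigenvector:
  fixes S :: "'e::euclidean_space \<Rightarrow> 'e"
  assumes S: "linear S" "\<And>x y. S x \<bullet> y = x \<bullet> S y" and U: "subspace U" "S ` U \<subseteq> U" and z: "z \<in> U" "z \<noteq> 0"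
  obtains v \<mu> where "v \<in> U" "norm v = 1" "S v = \<mu> *\<^sub>R v"
proof -
  define K where "K = U \<inter> sphere 0 1"
  have "compact K"
    unfolding K_def using closed_subspace[OF U(1)] by (intro closed_Int_compact) auto
  moreover have "z /\<^sub>R norm z \<in> K"
    using z U(1) by (simp add: K_def subspace_scale)
  moreover have "continuous_on K (\<lambda>x. x \<bullet> S x)"
    by (intro continuous_intros linear_continuous_on S(1)[unfolded linear_conv_bounded_linear])
  ultimately obtain v where v: "v \<in> K" "\<And>y. y \<in> K \<Longrightarrow> y \<bullet> S y \<le> v \<bullet> S v"
    using continuous_attains_sup[of K "\<lambda>x. x \<bullet> S x"] by blast
  define \<mu> where "\<mu> = v \<bullet> S v"
  define T where "T x = \<mu> *\<^sub>R x - S x" for x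
  interpret S: linear S by (rule S)
  have vU: "v \<in> U" "norm v = 1"
    using v(1) by (auto simp: K_def)
  have pos: "y \<bullet> T y \<ge> 0" if "y \<in> U" for y
  proof (cases "y = 0")
    case False
    have "y /\<^sub>R norm y \<in> K"
      using that U(1) False by (simp add: K_def subspace_scale)
    from v(2)[OF this] have "(y \<bullet> S y) / (norm y)\<^sup>2 \<le> \<mu>"
      by (simp add: \<mu>_def S.scale field_simps power2_eq_square)
    then have "y \<bullet> S y \<le> \<mu> * (norm y)\<^sup>2"
      using False by (simp add: field_simps)
    then show ?thesis
      by (simp add: T_def inner_diff_right dot_square_norm)
  qed simp
  have Tsym: "T x \<bullet> y = x \<bullet> T y" for x y
    by (simp add: T_def inner_diff_left inner_diff_right S(2))
  have Tlin: "T (x + c *\<^sub>R y) = T x + c *\<^sub>R T y" for x y c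
    by (simp add: T_def S.add S.scale algebra_simps)
  have vTv: "v \<bullet> T v = 0"
    using vU by (simp add: T_def \<mu>_def inner_diff_right dot_square_norm)
  define w where "w = T v"
  have wU: "w \<in> U"
    using vU U by (auto simp: w_def T_def intro!: subspace_diff subspace_scale)
  define q where "q = w \<bullet> T w"
  have q: "q \<ge> 0"
    using pos[OF wU] by (simp add: q_def)
  \<comment> \<open>A step along \<open>- w\<close> short enough for the linear decrease to outweigh
    the quadratic term; the summand 1 covers \<open>q = 0\<close>.\<close>
  define s where "s = (w \<bullet> w) / (q + 1)"
  have "v + (- s) *\<^sub>R w \<in> U"
    using vU wU U(1) by (intro subspace_add subspace_scale)
  from pos[OF this] have "0 \<le> (v + (- s) *\<^sub>R w) \<bullet> (w + (- s) *\<^sub>R T w)"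
    unfolding Tlin w_def[symmetric] .
  also have "\<dots> = s * (s * q) - 2 * s * (w \<bullet> w)"
    using vTv Tsym[of v w] by (simp add: inner_add_left inner_add_right w_def[symmetric] q_def inner_commute[of v] algebra_simps)
  finally have 1: "2 * s * (w \<bullet> w) \<le> s * (s * q)"
    by simp
  have "w = 0"
  proof (rule ccontr)
    assume "w \<noteq> 0"
    then have ww: "w \<bullet> w > 0"
      by simp
    then have s: "s > 0"
      using q by (simp add: s_def)
    then have "2 * (w \<bullet> w) \<le> s * q"
      using 1 by simp
    also have "\<dots> \<le> w \<bullet> w"
      using ww q by (simp add: s_def field_simps)
    finally show False
      using ww by simp
  qed
  then have "S v = \<mu> *\<^sub>R v"
    by (simp add: w_def T_def)
  then show ?thesis
    using that vU by blast
qed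

text \<open>The orthogonal complement of an eigenvector within \<open>U\<close> is again invariant
  by self-adjointness, and has smaller dimension.\<close>

lemma self_adjoint_eigenbasis_subspace:
  fixes S :: "'e::euclidean_space \<Rightarrow> 'e"
  assumes S: "linear S" "\<And>x y. S x \<bullet> y = x \<bullet> S y" and U: "subspace U" "S ` U \<subseteq> U"
  shows "\<exists>V. finite V \<and> pairwise orthogonal V \<and> (\<forall>v\<in>V. norm v = 1 \<and> (\<exists>\<mu>. S v = \<mu> *\<^sub>R v)) \<and> span V = U"
  using U
proof (induction "dim U" arbitrary: U rule: less_induct)
  case less
  note U = less.prems
  show ?case
  proof (cases "U = {0}")
    case True
    then show ?thesis
      by (intro exI[of _ "{}"]) simp
  next
    case False
    then obtain z where "z \<in> U" "z \<noteq> 0"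
      using subspace_0[OF U(1)] by blast
    then obtain v \<mu> where v: "v \<in> U" "norm v = 1" "S v = \<mu> *\<^sub>R v"
      using self_adjoint_max_eigenvector[OF S U] by metis
    define U' where "U' = U \<inter> {x. orthogonal v x}"
    have U': "subspace U'"
      unfolding U'_def by (intro subspace_inter U subspace_orthogonal_to_vector)
    have inv: "S ` U' \<subseteq> U'"
    proof -
      have "v \<bullet> S x = \<mu> * (v \<bullet> x)" for x
        using S(2)[of v x] v(3) by simp
      then show ?thesis
        using U(2) by (auto simp: U'_def orthogonal_def)
    qed
    have "v \<notin> U'"
      using v(2) by (auto simp: U'_def orthogonal_def)
    then have "U' \<subset> U"
      using v(1) by (auto simp: U'_def)
    then have "dim U' < dim U"
      using U(1) U' by (intro dim_psubset) (simp add: span_eq_iff[THEN iffD2])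
    from less.hyps[OF this U' inv] obtain V where V: "finite V" "pairwise orthogonal V"
      "\<And>v. v \<in> V \<Longrightarrow> norm v = 1 \<and> (\<exists>\<mu>. S v = \<mu> *\<^sub>R v)" "span V = U'"
      by blast
    have VU': "V \<subseteq> U'"
      using V(4) span_superset by blast
    have "span (insert v V) = U"
    proof
      show "span (insert v V) \<subseteq> U"
        using v(1) VU' U(1) by (intro span_minimal) (auto simp: U'_def)
      show "U \<subseteq> span (insert v V)"
      proof
        fix x assume x: "x \<in> U"
        have "x - (x \<bullet> v) *\<^sub>R v \<in> U'"
          using x v U(1) by (auto simp: U'_def orthogonal_def inner_diff_right dot_square_norm inner_commute
              intro!: subspace_diff subspace_scale)
        then show "x \<in> span (insert v V)"
          unfolding span_insert V(4) by blast
      qed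
    qed
    moreover have "pairwise orthogonal (insert v V)"
      using V(2) VU' by (auto simp: pairwise_insert U'_def orthogonal_commute)
    ultimately show ?thesis
      using V(1,3) v(2,3) by (intro exI[of _ "insert v V"]) auto
  qed
qed

lemma self_adjoint_eigenbasis:
  fixes S :: "'e::euclidean_space \<Rightarrow> 'e"
  assumes "linear S" "\<And>x y. S x \<bullet> y = x \<bullet> S y"
  obtains V where "finite V" "pairwise orthogonal V" "\<And>v. v \<in> V \<Longrightarrow> norm v = 1"
    "\<And>v. v \<in> V \<Longrightarrow> \<exists>\<mu>. S v = \<mu> *\<^sub>R v" "span V = UNIV"
  using self_adjoint_eigenbasis_subspace[OF assms, of UNIV] by auto

lemma orthonormal_basis_norm:
  fixes V :: "'e::euclidean_space set"
  assumes "finite V" "pairwise orthogonal V" "\<And>v. v \<in> V \<Longrightarrow> norm v = 1" "span V = UNIV"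
  shows "(norm x)\<^sup>2 = (\<Sum>v\<in>V. (x \<bullet> v)\<^sup>2)"
proof -
  have "x \<bullet> x = x \<bullet> (\<Sum>v\<in>V. (x \<bullet> v) *\<^sub>R v)"
    using orthonormal_basis_expand[of V x] assms by simp
  then show ?thesis
    by (simp add: dot_square_norm inner_sum_right power2_eq_square)
qed

text \<open>Over any orthonormal basis the sum equals the one for \<open>adjoint Y\<close> over
  \<open>Basis\<close>, so it does not depend on the basis.\<close>

lemma orthonormal_basis_hilbert_schmidt:
  fixes V :: "'e::euclidean_space set" and Y :: "'e \<Rightarrow> 'f::euclidean_space"
  assumes V: "finite V" "pairwise orthogonal V" "\<And>v. v \<in> V \<Longrightarrow> norm v = 1" "span V = UNIV" and Y: "linear Y"
  shows "(\<Sum>v\<in>V. (norm (Y v))\<^sup>2) = (\<Sum>b\<in>Basis. (norm (Y b))\<^sup>2)"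
proof -
  have *: "(\<Sum>v\<in>W. (norm (Y v))\<^sup>2) = (\<Sum>b\<in>Basis. (norm (adjoint Y b))\<^sup>2)"
    if W: "finite W" "pairwise orthogonal W" "\<And>v. v \<in> W \<Longrightarrow> norm v = 1" "span W = UNIV" for W :: "'e set"
  proof -
    have "(\<Sum>v\<in>W. (norm (Y v))\<^sup>2) = (\<Sum>v\<in>W. \<Sum>b\<in>Basis. (Y v \<bullet> b)\<^sup>2)"
      unfolding power2_norm_eq_inner by (subst euclidean_inner) (simp add: power2_eq_square)
    also have "\<dots> = (\<Sum>b\<in>Basis. \<Sum>v\<in>W. (adjoint Y b \<bullet> v)\<^sup>2)"
      by (subst sum.swap) (simp add: adjoint_works[OF Y, symmetric] inner_commute[of "adjoint Y _"])
    also have "\<dots> = (\<Sum>b\<in>Basis. (norm (adjoint Y b))\<^sup>2)"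
      using orthonormal_basis_norm[OF W] by simp
    finally show ?thesis .
  qed
  have "pairwise orthogonal (Basis :: 'e set)"
    by (auto simp: pairwise_def orthogonal_def inner_not_same_Basis)
  with *[OF V] *[of Basis] show ?thesis
    by simp
qed

text \<open>The derivative of arcsin blows up at 1 and -1, so it is capped once
  \<open>1 - x\<^sup>2\<close> falls below 1/2. The primitive stays Lipschitz, grows no faster than
  arcsin, and agrees with it up to angle pi / 4.\<close>

lemma arcsin_c1_extension:
  obtains \<psi> q :: "real \<Rightarrow> real" where
    "\<And>x. \<bar>x\<bar> \<le> 1 \<Longrightarrow> (\<psi> has_real_derivative q x) (at x)"
    "\<And>x. 0 \<le> q x" "\<And>x. \<bar>x\<bar> \<le> 1 \<Longrightarrow> q x * sqrt (1 - x\<^sup>2) \<le> 1" "\<And>x y. \<bar>x\<bar> \<le> 1 \<Longrightarrow> \<bar>y\<bar> \<le> 1 \<Longrightarrow> \<bar>\<psi> x - \<psi> y\<bar> \<le> 2 * \<bar>x - y\<bar>"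
    "\<psi> 0 = 0" "\<And>y. 0 \<le> y \<Longrightarrow> y \<le> pi / 4 \<Longrightarrow> \<psi> (sin y) = y"
proof -
  define q where "q x = 1 / sqrt (max (1 - x\<^sup>2) (1 / 2))" for x :: real
  have m: "max (1 - x\<^sup>2) (1 / 2) > 0" for x :: real
    by (simp add: less_max_iff_disj)
  \<comment> \<open>An interval larger than \<open>{- 1..1}\<close> gives two-sided derivatives at 1
    and -1.\<close>
  have "continuous_on {- 2..2} q"
    unfolding q_def using m by (intro continuous_intros) (simp add: less_le)
  then obtain f where f: "\<And>x. x \<in> {- 2..2} \<Longrightarrow> (f has_vector_derivative q x) (at x within {- 2..2})"
    using antiderivative_continuous by blast
  define \<psi> where "\<psi> x = f x - f 0" for x
  have der: "(\<psi> has_real_derivative q x) (at x)" if "\<bar>x\<bar> \<le> 1" for x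
  proof -
    have "(f has_vector_derivative q x) (at x)"
      using f[of x] that at_within_Icc_at[of "-2" x 2] by (simp add: abs_le_iff)
    then show ?thesis
      unfolding \<psi>_def by (auto simp: has_real_derivative_iff_has_vector_derivative intro!: derivative_eq_intros)
  qed
  have q0: "0 \<le> q x" for x
    using m[of x] by (simp add: q_def)
  have q2: "q x \<le> 2" for x
  proof -
    have "sqrt (1 / 4) \<le> sqrt (max (1 - x\<^sup>2) (1 / 2))"
      by (intro real_sqrt_le_mono) (simp add: le_max_iff_disj)
    then have "1 / 2 \<le> sqrt (max (1 - x\<^sup>2) (1 / 2))"
      by (simp add: real_sqrt_divide)
    then show ?thesis
      using m[of x] by (simp add: q_def divide_simps)
  qed
  have lip: "\<bar>\<psi> x - \<psi> y\<bar> \<le> 2 * \<bar>x - y\<bar>" if xy: "\<bar>x\<bar> \<le> 1" "\<bar>y\<bar> \<le> 1" for x y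
  proof -
    have "(\<psi> has_field_derivative q z) (at z within {- 1..1})" if "z \<in> {- 1..1}" for z
      by (rule has_field_derivative_at_within, rule der) (use that in \<open>simp add: abs_le_iff\<close>)
    moreover have "norm (q z) \<le> 2" for z
      using q0[of z] q2[of z] by simp
    moreover have "x \<in> {- 1..1}" "y \<in> {- 1..1}"
      using xy by (simp_all add: abs_le_iff)
    ultimately have "norm (\<psi> x - \<psi> y) \<le> 2 * norm (x - y)"
      by (rule field_differentiable_bound[OF convex_real_interval(5)])
    then show ?thesis
      by simp
  qed
  show ?thesis
  proof (rule that[OF der])
    show "0 \<le> q x" for x
      by (rule q0)
    show "\<bar>x\<bar> \<le> 1 \<Longrightarrow> \<bar>y\<bar> \<le> 1 \<Longrightarrow> \<bar>\<psi> x - \<psi> y\<bar> \<le> 2 * \<bar>x - y\<bar>" for x y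
      by (rule lip)
    show "q x * sqrt (1 - x\<^sup>2) \<le> 1" for x
      using m[of x] by (simp add: q_def divide_simps)
    show "\<psi> 0 = 0"
      by (simp add: \<psi>_def)
    show "\<psi> (sin y) = y" if y: "0 \<le> y" "y \<le> pi / 4" for y
    proof -
      have "((\<lambda>y. \<psi> (sin y) - y) has_real_derivative 0) (at t within {0..pi / 4})" if t: "t \<in> {0..pi / 4}" for t
      proof -
        have "cos (pi / 4) \<le> cos t"
          using t pi_gt_zero by (intro cos_monotone_0_pi_le) auto
        then have c: "cos t \<ge> sqrt 2 / 2"
          by (simp add: cos_45)
        then have "(sqrt 2 / 2)\<^sup>2 \<le> (cos t)\<^sup>2"
          by (intro power_mono) auto
        then have "1 / 2 \<le> (cos t)\<^sup>2"
          by (simp add: power_divide)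
        then have "max (1 - (sin t)\<^sup>2) (1 / 2) = (cos t)\<^sup>2"
          by (simp add: cos_squared_eq)
        moreover have "cos t > 0"
          using c by (meson half_gt_zero less_le_trans real_sqrt_gt_zero zero_less_numeral)
        ultimately have "q (sin t) * cos t = 1"
          by (simp add: q_def)
        moreover have "((\<lambda>y. \<psi> (sin y) - y) has_real_derivative q (sin t) * cos t - 1) (at t)"
          by (intro DERIV_diff DERIV_chain2[of \<psi>] der DERIV_sin DERIV_ident) simp
        ultimately show ?thesis
          by (simp add: has_field_derivative_at_within)
      qed
      then obtain k where "\<forall>t\<in>{0..pi / 4}. \<psi> (sin t) - t = k"
        using has_field_derivative_zero_constant[of "{0..pi / 4}" "\<lambda>y. \<psi> (sin y) - y"] by auto
      then have "\<psi> (sin y) - y = \<psi> (sin 0) - 0"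
        using y by (metis atLeastAtMost_iff order_refl order_trans)
      then show ?thesis
        by (simp add: \<psi>_def)
    qed
  qed
qed

section \<open>Orthogonal action of group pairs on pairs of columns\<close>

type_synonym ('a, 'n, 'k) group_pair = "('a^'n^'n) \<times> ('a^'k^'k)"
type_synonym ('a, 'n, 'k) column_pair = "('a^1^'n) \<times> ('a^1^'k)"

text \<open>A real representation in which unitary pairs are isometries and skew pairs are skew
  operators.\<close>

definition act :: "('a::hurwitz_algebra, 'n::finite, 'k::finite) group_pair \<Rightarrow> ('a, 'n, 'k) column_pair \<Rightarrow> ('a, 'n, 'k) column_pair" where
  "act g x = (fst g ** fst x, snd g ** snd x)"

lemma bounded_bilinear_act: "bounded_bilinear (act :: ('a::hurwitz_algebra, 'n::finite, 'k::finite) group_pair \<Rightarrow> _)"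
  unfolding bilinear_conv_bounded_bilinear [symmetric] bilinear_def
  by (intro conjI allI linearI) (simp_all add: act_def matrix_mult_linear_simps)

interpretation act: bounded_bilinear "act :: ('a::hurwitz_algebra, 'n::finite, 'k::finite) group_pair \<Rightarrow> _"
  by (rule bounded_bilinear_act)

lemma act_pmul: "act (pmul g h) x = act g (act h x)"
  by (simp add: act_def pmul_def matrix_mul_assoc)

definition unitary_pairs :: "('a::hurwitz_algebra, 'n::finite, 'k::finite) group_pair set" where
  "unitary_pairs = unitary \<times> unitary"

definition skew_pairs :: "('a::hurwitz_algebra, 'n::finite, 'k::finite) group_pair set" where
  "skew_pairs = skew_hermitian \<times> skew_hermitian"

lemma inner_act_unitary: "g \<in> unitary_pairs \<Longrightarrow> act g x \<bullet> act g y = x \<bullet> y"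
  by (auto simp: unitary_pairs_def act_def inner_prod_def inner_unitary_left)

lemma norm_act_unitary: "g \<in> unitary_pairs \<Longrightarrow> norm (act g x) = norm x"
  by (simp add: norm_eq_sqrt_inner inner_act_unitary)

lemma inner_act_skew: "X \<in> skew_pairs \<Longrightarrow> act X x \<bullet> y = - (x \<bullet> act X y)"
  by (auto simp: skew_pairs_def act_def inner_prod_def inner_matrix_mult_left skew_hermitianD matrix_mult_linear_simps)

lemma pmul_padj: "g \<in> unitary_pairs \<Longrightarrow> pmul (padj g) (pmul g X) = X"
  by (auto simp: unitary_pairs_def pmul_def padj_def unitaryD)

lemma norm_pmul_unitary: "g \<in> unitary_pairs \<Longrightarrow> norm (pmul g X) = norm X"
  by (auto simp: unitary_pairs_def pmul_def norm_eq_sqrt_inner inner_prod_def inner_unitary_left)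

lemma ptrace_form_skew:
  "X \<in> skew_pairs \<Longrightarrow> ptrace_form X X = (norm X)\<^sup>2 / 2"
  by (auto simp: skew_pairs_def ptrace_form_def trace_form_skew norm_eq_sqrt_inner inner_prod_def)

lemma sum_Basis_vec:
  fixes f :: "'b::euclidean_space^'n \<Rightarrow> 'c::comm_monoid_add"
  shows "(\<Sum>b\<in>Basis. f b) = (\<Sum>i\<in>UNIV. \<Sum>u\<in>Basis. f (axis i u))"
proof -
  have "(\<Sum>b\<in>Basis. f b) = (\<Sum>i\<in>UNIV. \<Sum>b\<in>(\<Union>u\<in>Basis. {axis i u}). f b)"
    unfolding Basis_vec_def by (rule sum.UNION_disjoint) (auto simp: axis_eq_axis)
  also have "\<dots> = (\<Sum>i\<in>UNIV. \<Sum>u\<in>Basis. f (axis i u))"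
  proof (intro sum.cong refl)
    fix i :: 'n
    have "(\<Union>u\<in>Basis. {axis i u :: 'b^'n}) = axis i ` Basis"
      by auto
    moreover have "inj_on (axis i :: 'b \<Rightarrow> 'b^'n) Basis"
      by (auto simp: inj_on_def axis_eq_axis)
    ultimately show "(\<Sum>b\<in>(\<Union>u\<in>Basis. {axis i u}). f b) = (\<Sum>u\<in>Basis. f (axis i u))"
      by (simp add: sum.reindex)
  qed
  finally show ?thesis .
qed

text \<open>Multiplication by a unit scalar preserves the norm of each entry, so every real basis
  direction of the scalars contributes one full Frobenius norm; hence the factor
  \<open>DIM('a)\<close>.\<close>

lemma sum_Basis_matrix_mult:
  fixes M :: "'a::hurwitz_algebra^'p^'m"
  shows "(\<Sum>b\<in>Basis. (norm (M ** (b :: 'a^1^'p)))\<^sup>2) = DIM('a) * (norm M)\<^sup>2"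
proof -
  have n2: "(norm x)\<^sup>2 = (\<Sum>i\<in>UNIV. (norm (x $ i))\<^sup>2)" for x :: "'b::real_inner^'i"
    by (simp add: power2_norm_eq_inner inner_vec_def)
  have "(norm (M ** axis i (axis (1::1) u)))\<^sup>2 = (\<Sum>j\<in>UNIV. (norm (M $ j $ i))\<^sup>2)" if "u \<in> Basis" for i u
  proof -
    have "(M ** axis i (axis (1::1) u)) $ j $ 1 = M $ j $ i * u" for j
      by (simp add: matrix_mult_nth axis_def if_distrib[of "\<lambda>x. x $ _"] if_distrib[of "\<lambda>x. _ * x"] cong: if_cong)
    then show ?thesis
      using that by (simp add: n2 norm_mult UNIV_1)
  qed
  then have "(\<Sum>b\<in>Basis. (norm (M ** (b :: 'a^1^'p)))\<^sup>2) = (\<Sum>i\<in>UNIV. \<Sum>u\<in>(Basis :: 'a set). \<Sum>j\<in>UNIV. (norm (M $ j $ i))\<^sup>2)"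
    by (simp add: sum_Basis_vec)
  also have "\<dots> = DIM('a) * (\<Sum>i\<in>UNIV. \<Sum>j\<in>UNIV. (norm (M $ j $ i))\<^sup>2)"
    by (simp add: sum_distrib_left)
  also have "\<dots> = DIM('a) * (\<Sum>j\<in>UNIV. \<Sum>i\<in>UNIV. (norm (M $ j $ i))\<^sup>2)"
    by (subst sum.swap) simp
  finally show ?thesis
    by (simp add: n2)
qed

text \<open>Up to the factor \<open>DIM('a)\<close> the squared Frobenius norm is a squared
  Hilbert-Schmidt norm, and can be computed in any orthonormal basis of the column space.\<close>

lemma sum_Basis_act:
  fixes X :: "('a::hurwitz_algebra, 'n::finite, 'k::finite) group_pair"
  shows "(\<Sum>b\<in>Basis. (norm (act X b))\<^sup>2) = DIM('a) * (norm X)\<^sup>2"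
proof -
  have "(\<Sum>b\<in>Basis. (norm (act X b))\<^sup>2) =
      (\<Sum>b\<in>Basis. (norm (act X (b, 0)))\<^sup>2) + (\<Sum>b\<in>Basis. (norm (act X (0, b)))\<^sup>2)"
    unfolding Basis_prod_def by (subst sum.union_disjoint) (auto simp: sum.reindex inj_on_def)
  then show ?thesis
    by (simp add: act_def norm_Pair matrix_mult.zero_right sum_Basis_matrix_mult norm_prod_def algebra_simps)
qed

lemma pexp_has_vector_derivative:
  fixes Z :: "('a::hurwitz_algebra, 'n::finite, 'k::finite) group_pair"
  shows "((\<lambda>t. pexp (t *\<^sub>R Z)) has_vector_derivative pmul (pexp (t *\<^sub>R Z)) Z) (at t)"
  using has_vector_derivative_Pair[OF mexp_has_vector_derivative[of "fst Z" t] mexp_has_vector_derivative[of "snd Z" t]]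
  by (simp add: pexp_def pmul_def mexp_self_commute)

lemma bounded_linear_pmul: "bounded_linear (pmul (g :: ('a::hurwitz_algebra, 'n::finite, 'k::finite) group_pair))"
  unfolding linear_conv_bounded_linear [symmetric]
  by (rule linearI) (simp_all add: pmul_def matrix_mult_linear_simps)

lemma pmul_assoc: "pmul g (pmul h k) = pmul (pmul g h) k"
  by (simp add: pmul_def matrix_mul_assoc)

lemma one_parameter_has_vector_derivative:
  fixes g :: "('a::hurwitz_algebra, 'n::finite, 'k::finite) group_pair"
  shows "((\<lambda>t. pmul g (pexp (t *\<^sub>R Z))) has_vector_derivative pmul (pmul g (pexp (t *\<^sub>R Z))) Z) (at t)"
  unfolding pmul_assoc[symmetric]
  by (rule bounded_linear.has_vector_derivative[OF bounded_linear_pmul pexp_has_vector_derivative])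

lemma pexp_skew_unitary: "Z \<in> skew_pairs \<Longrightarrow> pexp (t *\<^sub>R Z) \<in> unitary_pairs"
  by (auto simp: skew_pairs_def unitary_pairs_def pexp_def mexp_skew_unitary)

lemma pmul_unitary: "g \<in> unitary_pairs \<Longrightarrow> h \<in> unitary_pairs \<Longrightarrow> pmul g h \<in> unitary_pairs"
  by (auto simp: unitary_pairs_def pmul_def unitary_mult)

lemma pexp_add:
  fixes Z :: "('a::hurwitz_algebra, 'n::finite, 'k::finite) group_pair"
  shows "pexp ((s + t) *\<^sub>R Z) = pmul (pexp (s *\<^sub>R Z)) (pexp (t *\<^sub>R Z))"
  by (simp add: pexp_def pmul_def mexp_add)

lemma act_pexp_eigenvector:
  fixes Z :: "('a::hurwitz_algebra, 'n::finite, 'k::finite) group_pair"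
  assumes "\<theta> \<noteq> 0" and v: "act Z (act Z v) = - (\<theta>\<^sup>2 *\<^sub>R v)"
  shows "act (pexp (t *\<^sub>R Z)) v = cos (t * \<theta>) *\<^sub>R v + (sin (t * \<theta>) / \<theta>) *\<^sub>R act Z v"
proof -
  define Y where "Y t = cos (t * \<theta>) *\<^sub>R v + (sin (t * \<theta>) / \<theta>) *\<^sub>R act Z v" for t
  have "(Y has_vector_derivative (- sin (t * \<theta>) * \<theta>) *\<^sub>R v + (cos (t * \<theta>) * \<theta> / \<theta>) *\<^sub>R act Z v) (at t)" for t
    unfolding Y_def by (auto intro!: derivative_eq_intros simp: algebra_simps)
  moreover have "act Z (Y t) = (- sin (t * \<theta>) * \<theta>) *\<^sub>R v + (cos (t * \<theta>) * \<theta> / \<theta>) *\<^sub>R act Z v" for t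
    using \<open>\<theta> \<noteq> 0\<close> by (simp add: Y_def act.add_right act.scaleR_right v power2_eq_square)
  ultimately have Y: "(Y has_vector_derivative act Z (Y t)) (at t)" for t
    by simp
  have "((\<lambda>t. fst (Y t)) has_vector_derivative fst Z ** fst (Y t)) (at t)"
       "((\<lambda>t. snd (Y t)) has_vector_derivative snd Z ** snd (Y t)) (at t)" for t
    using bounded_linear.has_vector_derivative[OF bounded_linear_fst Y]
      bounded_linear.has_vector_derivative[OF bounded_linear_snd Y] by (simp_all add: act_def)
  from mexp_ode_unique[OF this(1), of t] mexp_ode_unique[OF this(2), of t]
  have "Y t = act (pexp (t *\<^sub>R Z)) (Y 0)"
    by (simp add: act_def pexp_def prod_eq_iff)
  then show ?thesis
    by (simp add: Y_def)
qed

text \<open>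
  A calibration argument.  On the plane through a unit eigenvector \<open>v\<close> of \<open>Z\<^sup>2\<close> and \<open>Z v\<close>, the curve
  \<open>t \<mapsto> exp (t Z) v\<close> is a great circle run with speed \<open>\<theta> = |Z v|\<close>.  Along any other curve \<open>c\<close> the
  function \<open>\<Sum>\<^sub>v \<theta> \<psi> (c v \<bullet> w)\<close>, with \<open>w\<close> a quarter turn ahead on that circle and \<open>\<psi>\<close> an extension of
  \<open>arcsin\<close>, grows at most at the rate \<open>\<Sum>\<^sub>v \<theta> |c' v|\<close>, hence by Cauchy--Schwarz at most like \<open>|Z| |c'|\<close>.
\<close>

lemma one_parameter_subgroup_minimizing:
  fixes Z :: "('a::hurwitz_algebra, 'n::finite, 'k::finite) group_pair"
  assumes Z: "Z \<in> skew_pairs" and h: "h \<in> unitary_pairs"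
    and \<tau>: "0 \<le> \<tau>" "\<tau> * (sqrt DIM('a) * norm Z) \<le> pi / 4"
    and ab: "a \<le> b" and ac: "absolutely_continuous_curve a b c"
    and cU: "\<And>t. t \<in> {a..b} \<Longrightarrow> c t \<in> unitary_pairs"
    and hor: "AE t in lebesgue. t \<in> {a..b} \<longrightarrow> (\<exists>X\<in>skew_pairs. (c has_vector_derivative pmul (c t) X) (at t))"
    and ca: "c a = h" and cb: "c b = pmul h (pexp (\<tau> *\<^sub>R Z))"
  shows "ennreal (\<tau> * norm Z / sqrt 2) \<le> sr_length a b c"
proof (cases "Z = 0")
  case False
  define D where "D = real DIM('a)"
  have D: "D > 0"
    by (simp add: D_def)
  have n: "norm Z > 0"
    using False by simp
  \<comment> \<open>A skew \<open>Z\<close> need not have a real eigenbasis; its square is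
    self-adjoint and has one.\<close>
  have lin: "linear (\<lambda>x. act Z (act Z x))"
    by (rule linearI) (simp_all add: act.add_right act.scaleR_right)
  have sym: "act Z (act Z x) \<bullet> y = x \<bullet> act Z (act Z y)" for x y
    using Z by (simp add: inner_act_skew)
  obtain V where V: "finite V" "pairwise orthogonal V" "\<And>v. v \<in> V \<Longrightarrow> norm v = 1"
    "\<And>v. v \<in> V \<Longrightarrow> \<exists>\<mu>. act Z (act Z v) = \<mu> *\<^sub>R v" "span V = UNIV"
    using self_adjoint_eigenbasis[OF lin sym] by blast
  have HS: "(\<Sum>v\<in>V. (norm (act X v))\<^sup>2) = D * (norm X)\<^sup>2" for X :: "('a, 'n, 'k) group_pair"
    using orthonormal_basis_hilbert_schmidt[OF V(1,2,3,5), of "act X"]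
    by (simp add: sum_Basis_act D_def linear_conv_bounded_linear act.bounded_linear_right)
  define \<theta> where "\<theta> v = norm (act Z v)" for v
  have eig: "act Z (act Z v) = - ((\<theta> v)\<^sup>2 *\<^sub>R v)" if v: "v \<in> V" for v
  proof -
    obtain \<mu> where \<mu>: "act Z (act Z v) = \<mu> *\<^sub>R v"
      using V(4)[OF v] by blast
    have "act Z (act Z v) \<bullet> v = - (\<theta> v)\<^sup>2"
      using Z by (simp add: inner_act_skew[of Z "act Z v"] \<theta>_def power2_norm_eq_inner)
    moreover have "act Z (act Z v) \<bullet> v = \<mu>"
      using V(3)[OF v] by (simp add: \<mu> dot_square_norm)
    ultimately have "\<mu> = - (\<theta> v)\<^sup>2"
      by simp
    then show ?thesis
      unfolding \<mu> by simp
  qed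
  have \<theta>sum: "(\<Sum>v\<in>V. (\<theta> v)\<^sup>2) = D * (norm Z)\<^sup>2"
    unfolding \<theta>_def by (rule HS)
  \<comment> \<open>Each squared speed is at most the total \<open>D * (norm Z)\<^sup>2\<close>, so
    the time bound keeps every angle where \<open>\<psi>\<close> inverts the sine.\<close>
  have \<theta>le: "\<tau> * \<theta> v \<le> pi / 4" if "v \<in> V" for v
  proof -
    have "(\<theta> v)\<^sup>2 \<le> D * (norm Z)\<^sup>2"
      unfolding \<theta>sum[symmetric] using that V(1) by (intro member_le_sum) auto
    then have "\<theta> v \<le> sqrt (D * (norm Z)\<^sup>2)"
      by (rule real_le_rsqrt)
    also have "\<dots> = sqrt D * norm Z"
      by (simp add: real_sqrt_mult)
    finally show ?thesis
      using \<tau> by (metis D_def mult_left_mono order_trans)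
  qed
  define w where "w v = act h ((1 / \<theta> v) *\<^sub>R act Z v)" for v
  have w: "norm (w v) = 1" if "\<theta> v \<noteq> 0" for v
    using that h by (simp add: w_def norm_act_unitary \<theta>_def)
  obtain \<psi> q :: "real \<Rightarrow> real" where \<psi>:
    "\<And>x. \<bar>x\<bar> \<le> 1 \<Longrightarrow> (\<psi> has_real_derivative q x) (at x)"
    "\<And>x. 0 \<le> q x" "\<And>x. \<bar>x\<bar> \<le> 1 \<Longrightarrow> q x * sqrt (1 - x\<^sup>2) \<le> 1" "\<And>x y. \<bar>x\<bar> \<le> 1 \<Longrightarrow> \<bar>y\<bar> \<le> 1 \<Longrightarrow> \<bar>\<psi> x - \<psi> y\<bar> \<le> 2 * \<bar>x - y\<bar>"
    "\<psi> 0 = 0" "\<And>y. 0 \<le> y \<Longrightarrow> y \<le> pi / 4 \<Longrightarrow> \<psi> (sin y) = y"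
    using arcsin_c1_extension by metis
  \<comment> \<open>Vectors killed by \<open>Z\<close> do not move and span no rotation plane with
    \<open>act Z v\<close>; their weight \<open>\<theta> v\<close> is zero.\<close>
  define V' where "V' = {v \<in> V. \<theta> v \<noteq> 0}"
  have V': "finite V'" "\<And>v. v \<in> V' \<Longrightarrow> v \<in> V \<and> \<theta> v > 0"
    using V(1) by (auto simp: V'_def \<theta>_def)
  \<comment> \<open>The weighted angles sum to \<open>\<tau> * D * (norm Z)\<^sup>2\<close>; this
    factor normalizes the total to the length of the subgroup segment.\<close>
  define K where "K = 1 / (sqrt 2 * D * norm Z)"
  have K: "K > 0"
    using D n by (simp add: K_def)
  define F where "F t = K * (\<Sum>v\<in>V'. \<theta> v * \<psi> (act (c t) v \<bullet> w v))" for t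
  have xle: "\<bar>act (c t) v \<bullet> w v\<bar> \<le> 1" if "t \<in> {a..b}" "v \<in> V'" for t v
    using Cauchy_Schwarz_ineq2[of "act (c t) v" "w v"] V'(2)[OF that(2)] V(3) w[of v] cU[OF that(1)]
    by (simp add: norm_act_unitary)
  have Fa: "F a = 0"
  proof -
    have "act (c a) v \<bullet> w v = 0" for v
    proof -
      have "act Z v \<bullet> v = 0"
        using inner_act_skew[OF Z, of v v] by (simp add: inner_commute)
      then show ?thesis
        using h by (simp add: ca w_def act.scaleR_right inner_act_unitary inner_commute)
    qed
    then show ?thesis
      by (simp add: F_def \<psi>(5))
  qed
  have Fb: "F b = \<tau> * norm Z / sqrt 2"
  proof -
    have "\<psi> (act (c b) v \<bullet> w v) = \<tau> * \<theta> v" if "v \<in> V'" for v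
    proof -
      have v: "v \<in> V" "\<theta> v > 0"
        using V'(2)[OF that] by auto
      have 0: "v \<bullet> act Z v = 0"
        using inner_act_skew[OF Z, of v v] by (simp add: inner_commute)
      have "act (c b) v \<bullet> w v = act (pexp (\<tau> *\<^sub>R Z)) v \<bullet> ((1 / \<theta> v) *\<^sub>R act Z v)"
        using h by (simp only: cb w_def act_pmul inner_act_unitary)
      also have "\<dots> = sin (\<tau> * \<theta> v) / \<theta> v * (1 / \<theta> v) * (norm (act Z v))\<^sup>2"
        using v(2) by (simp add: act_pexp_eigenvector[OF _ eig[OF v(1)]] inner_add_left 0 power2_norm_eq_inner)
      also have "\<dots> = sin (\<tau> * \<theta> v)"
        using v(2) by (simp add: \<theta>_def[symmetric] power2_eq_square)
      finally show ?thesis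
        using \<psi>(6)[of "\<tau> * \<theta> v"] \<theta>le[OF v(1)] \<tau>(1) v(2) by simp
    qed
    then have "F b = K * (\<Sum>v\<in>V'. \<tau> * (\<theta> v)\<^sup>2)"
      by (simp add: F_def power2_eq_square mult_ac)
    also have "(\<Sum>v\<in>V'. \<tau> * (\<theta> v)\<^sup>2) = (\<Sum>v\<in>V. \<tau> * (\<theta> v)\<^sup>2)"
      using V(1) by (intro sum.mono_neutral_left) (auto simp: V'_def)
    also have "\<dots> = \<tau> * (D * (norm Z)\<^sup>2)"
      by (simp add: sum_distrib_left[symmetric] \<theta>sum)
    finally show ?thesis
      using D n by (simp add: K_def power2_eq_square)
  qed
  have "absolutely_continuous_curve a b F"
  proof -
    obtain M where M: "\<And>x y. norm (act x y :: ('a, 'n, 'k) column_pair) \<le> norm x * norm y * M"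
      using act.bounded by blast
    show ?thesis
    proof (rule absolutely_continuous_curve_lipschitz[OF ac])
      fix s t assume st: "s \<in> {a..b}" "t \<in> {a..b}"
      have "dist (F s) (F t) = K * \<bar>\<Sum>v\<in>V'. \<theta> v * (\<psi> (act (c s) v \<bullet> w v) - \<psi> (act (c t) v \<bullet> w v))\<bar>"
      proof -
        have "F s - F t = K * (\<Sum>v\<in>V'. \<theta> v * (\<psi> (act (c s) v \<bullet> w v) - \<psi> (act (c t) v \<bullet> w v)))"
          by (simp add: F_def right_diff_distrib sum_subtractf)
        then show ?thesis
          using K by (simp add: dist_real_def abs_mult)
      qed
      also have "\<dots> \<le> K * (\<Sum>v\<in>V'. \<theta> v * (2 * (\<bar>M\<bar> * dist (c s) (c t))))"
      proof (intro mult_left_mono order_trans[OF sum_abs] sum_mono)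
        fix v assume v: "v \<in> V'"
        have "\<bar>\<psi> (act (c s) v \<bullet> w v) - \<psi> (act (c t) v \<bullet> w v)\<bar> \<le> 2 * \<bar>act (c s) v \<bullet> w v - act (c t) v \<bullet> w v\<bar>"
          using xle st v by (intro \<psi>(4)) auto
        also have "act (c s) v \<bullet> w v - act (c t) v \<bullet> w v = act (c s - c t) v \<bullet> w v"
          by (simp add: act.diff_left inner_diff_left)
        also have "\<bar>act (c s - c t) v \<bullet> w v\<bar> \<le> norm (act (c s - c t) v)"
          using Cauchy_Schwarz_ineq2[of "act (c s - c t) v" "w v"] w[of v] V'(2)[OF v] by simp
        also have "\<dots> \<le> norm (c s - c t) * norm v * M"
          by (rule M)
        also have "\<dots> \<le> \<bar>M\<bar> * dist (c s) (c t)"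
          using V(3)[of v] V'(2)[OF v] by (simp add: dist_norm mult.commute mult_right_mono)
        finally show "\<bar>\<theta> v * (\<psi> (act (c s) v \<bullet> w v) - \<psi> (act (c t) v \<bullet> w v))\<bar> \<le>
            \<theta> v * (2 * (\<bar>M\<bar> * dist (c s) (c t)))"
          using V'(2)[OF v] by (simp add: abs_mult)
      qed (use K in simp)
      also have "\<dots> = K * (\<Sum>v\<in>V'. \<theta> v * (2 * \<bar>M\<bar>)) * dist (c s) (c t)"
        by (simp add: sum_distrib_right mult.assoc)
      finally show "dist (F s) (F t) \<le> K * (\<Sum>v\<in>V'. \<theta> v * (2 * \<bar>M\<bar>)) * dist (c s) (c t)" .
    qed
  qed
  moreover have "\<exists>d. (F has_real_derivative d) (at t) \<and>
      ennreal \<bar>d\<bar> \<le> (let X = pmul (padj (c t)) (vector_derivative c (at t)) in ennreal (sqrt (ptrace_form X X)))"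
    if t: "t \<in> {a..b}" and X: "X \<in> skew_pairs" and der: "(c has_vector_derivative pmul (c t) X) (at t)" for t X
  proof -
    let ?x = "\<lambda>v t. act (c t) v \<bullet> w v" and ?dx = "\<lambda>v. act (pmul (c t) X) v \<bullet> w v"
    have dx: "(?x v has_real_derivative ?dx v) (at t)" for v
      unfolding has_real_derivative_iff_has_vector_derivative
      by (intro bounded_linear.has_vector_derivative[OF bounded_linear_inner_left]
          bounded_linear.has_vector_derivative[OF act.bounded_linear_left] der)
    define d where "d = K * (\<Sum>v\<in>V'. \<theta> v * (q (?x v t) * ?dx v))"
    have "(F has_real_derivative d) (at t)"
      unfolding F_def d_def using xle[OF t]
      by (intro DERIV_cmult DERIV_sum DERIV_chain2[of \<psi>] \<psi>(1) dx) auto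
    moreover have "\<bar>d\<bar> \<le> norm X / sqrt 2"
    proof -
      have qdx: "\<bar>q (?x v t) * ?dx v\<bar> \<le> norm (act X v)" if v: "v \<in> V'" for v
      proof -
        define x where "x = ?x v t"
        define y where "y = act (c t) v"
        define dy where "dy = act (c t) (act X v)"
        have vV: "v \<in> V" "\<theta> v > 0"
          using V'(2)[OF v] by auto
        have ww: "w v \<bullet> w v = 1" and yy: "y \<bullet> y = 1"
          using w[of v] vV V(3)[of v] cU[OF t] by (simp_all add: dot_square_norm y_def norm_act_unitary)
        \<comment> \<open>Skewness of \<open>X\<close> makes the velocity of \<open>y\<close>
          orthogonal to \<open>y\<close>. Hence only the part of \<open>w v\<close> orthogonal to
          \<open>y\<close> counts; its length \<open>sqrt (1 - x\<^sup>2)\<close> is absorbed by the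
          factor \<open>q x\<close>.\<close>
        have "act X v \<bullet> v = 0"
          using inner_act_skew[OF X, of v v] by (simp add: inner_commute)
        then have "dy \<bullet> y = 0"
          using cU[OF t] by (simp add: dy_def y_def inner_act_unitary)
        then have "?dx v = dy \<bullet> (w v - x *\<^sub>R y)"
          by (simp add: dy_def act_pmul inner_diff_right)
        also have "\<bar>\<dots>\<bar> \<le> norm dy * norm (w v - x *\<^sub>R y)"
          by (rule Cauchy_Schwarz_ineq2)
        also have "norm (w v - x *\<^sub>R y) = sqrt (1 - x\<^sup>2)"
          by (simp add: norm_eq_sqrt_inner inner_diff_left inner_diff_right ww yy power2_eq_square)
            (simp add: x_def y_def inner_commute)
        also have "norm dy = norm (act X v)"
          using cU[OF t] by (simp add: dy_def norm_act_unitary)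
        finally have *: "\<bar>?dx v\<bar> \<le> norm (act X v) * sqrt (1 - x\<^sup>2)" .
        have "\<bar>q x * ?dx v\<bar> = q x * \<bar>?dx v\<bar>"
          using \<psi>(2)[of x] by (simp add: abs_mult)
        also have "\<dots> \<le> q x * (norm (act X v) * sqrt (1 - x\<^sup>2))"
          using * \<psi>(2)[of x] by (rule mult_left_mono)
        also have "\<dots> = norm (act X v) * (q x * sqrt (1 - x\<^sup>2))"
          by simp
        also have "\<dots> \<le> norm (act X v)"
          using \<psi>(3)[of x] xle[OF t v] by (intro mult_left_le) (auto simp: x_def)
        finally show ?thesis
          by (simp add: x_def)
      qed
      have "\<bar>d\<bar> \<le> K * (\<Sum>v\<in>V'. \<theta> v * norm (act X v))"
      proof -
        have "\<bar>\<theta> v * (q (?x v t) * ?dx v)\<bar> \<le> \<theta> v * norm (act X v)" if "v \<in> V'" for v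
          using mult_left_mono[OF qdx[OF that], of "\<theta> v"] V'(2)[OF that] by (simp add: abs_mult)
        then have "\<bar>\<Sum>v\<in>V'. \<theta> v * (q (?x v t) * ?dx v)\<bar> \<le> (\<Sum>v\<in>V'. \<theta> v * norm (act X v))"
          by (intro order_trans[OF sum_abs] sum_mono)
        then show ?thesis
          using K by (simp add: d_def abs_mult mult_left_mono)
      qed
      also have "\<dots> \<le> K * (\<Sum>v\<in>V. \<theta> v * norm (act X v))"
        using K V(1) by (intro mult_left_mono sum_mono2) (auto simp: V'_def \<theta>_def)
      \<comment> \<open>Cauchy-Schwarz over the eigenbasis: both factors are Hilbert-Schmidt norms,
        which turns the bound into one by \<open>norm Z * norm X\<close>.\<close>
      also have "\<dots> \<le> K * (L2_set \<theta> V * L2_set (\<lambda>v. norm (act X v)) V)"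
        using K L2_set_mult_ineq[of \<theta> "\<lambda>v. norm (act X v)" V] by (intro mult_left_mono) (auto simp: \<theta>_def)
      also have "\<dots> = K * ((sqrt D * sqrt D) * norm Z * norm X)"
        by (simp add: L2_set_def \<theta>sum HS real_sqrt_mult mult_ac)
      also have "\<dots> = norm X / sqrt 2"
        using D n by (simp add: K_def)
      finally show ?thesis .
    qed
    moreover have "pmul (padj (c t)) (vector_derivative c (at t)) = X"
      using vector_derivative_at[OF der] cU[OF t] by (simp add: pmul_padj)
    moreover have "sqrt (ptrace_form X X) = norm X / sqrt 2"
      using X by (simp add: ptrace_form_skew real_sqrt_divide)
    ultimately show ?thesis
      by (auto simp: Let_def intro!: exI[of _ d] ennreal_leI)
  qed
  ultimately have "ennreal (F b - F a) \<le> sr_length a b c"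
    unfolding sr_length_def
    by (intro absolutely_continuous_diff_le ab) (use hor in \<open>auto elim!: eventually_mono\<close>)
  then show ?thesis
    by (simp add: Fa Fb)
qed simp

section \<open>The classical groups\<close>

lemma sr_curve_0: "sr_curve g P 0 = (\<lambda>t. pmul g (pexp (t *\<^sub>R (P :: ('a::hurwitz_algebra, 'n::finite, 'k::finite) group_pair))))"
  by (rule ext) (simp add: sr_curve_def pexp_def pmul_def)

lemma sr_length_one_parameter:
  fixes g Z :: "('a::hurwitz_algebra, 'n::finite, 'k::finite) group_pair"
  assumes g: "g \<in> unitary_pairs" and Z: "Z \<in> skew_pairs" and ab: "a \<le> b"
  shows "sr_length a b (\<lambda>t. pmul g (pexp (t *\<^sub>R Z))) = ennreal ((b - a) * norm Z / sqrt 2)"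
proof -
  have "pmul (padj (pmul g (pexp (t *\<^sub>R Z)))) (vector_derivative (\<lambda>t. pmul g (pexp (t *\<^sub>R Z))) (at t)) = Z" for t
    using vector_derivative_at[OF one_parameter_has_vector_derivative[of g Z t]]
      pmul_unitary[OF g pexp_skew_unitary[OF Z]] by (simp add: pmul_padj)
  then have "sr_length a b (\<lambda>t. pmul g (pexp (t *\<^sub>R Z))) = (\<integral>\<^sup>+t\<in>{a..b}. ennreal (sqrt (ptrace_form Z Z)) \<partial>lebesgue)"
    by (simp add: sr_length_def)
  also have "\<dots> = ennreal (norm Z / sqrt 2) * ennreal (b - a)"
    using Z ab by (simp add: nn_integral_cmult_indicator ptrace_form_skew real_sqrt_divide)
  also have "\<dots> = ennreal (norm Z / sqrt 2 * (b - a))"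
    using ab by (intro ennreal_mult[symmetric]) auto
  finally show ?thesis
    by (simp add: mult.commute)
qed

text \<open>Horizontal competitors in \<open>G\<close> are among the curves of unitary pairs with
  skew velocity, so minimality in the larger class is inherited.\<close>

lemma sr_geodesic_one_parameter:
  fixes Z :: "('a::hurwitz_algebra, 'n::finite, 'k::finite) group_pair"
  assumes G: "G \<subseteq> unitary_pairs" and p: "p \<subseteq> skew_pairs" and Z: "Z \<in> p"
    and gG: "\<And>t. pmul g (pexp (t *\<^sub>R Z)) \<in> G"
  shows "sr_geodesic G p (\<lambda>t. pmul g (pexp (t *\<^sub>R Z)))"
  unfolding sr_geodesic_def
proof (intro conjI allI impI)
  let ?g = "\<lambda>t. pmul g (pexp (t *\<^sub>R Z))"
  have gU: "?g t \<in> unitary_pairs" for t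
    using gG G by blast
  have g: "g \<in> unitary_pairs"
    using gU[of 0] by (simp add: pexp_def pmul_def)
  have ZS: "Z \<in> skew_pairs"
    using Z p by blast
  show "horizontal G p a b ?g" if "a \<le> b" for a b
    unfolding horizontal_def
  proof (intro conjI)
    have "norm (?g s - ?g t) \<le> norm Z * norm (s - t)" for s t
    proof (rule differentiable_bound)
      show "(?g has_derivative (\<lambda>h. h *\<^sub>R pmul (?g t) Z)) (at t within UNIV)" for t
        using one_parameter_has_vector_derivative by (simp add: has_vector_derivative_def)
      show "onorm (\<lambda>h. h *\<^sub>R pmul (?g t) Z) \<le> norm Z" for t
        using gU by (intro onorm_le) (simp add: norm_pmul_unitary)
    qed auto
    then show "absolutely_continuous_curve a b ?g"
      by (intro absolutely_continuous_curve_lipschitz[OF absolutely_continuous_curve_id]) (simp add: dist_norm)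
    show "AE t in lebesgue. t \<in> {a..b} \<longrightarrow> (\<exists>X\<in>p. (?g has_vector_derivative pmul (?g t) X) (at t))"
      by (intro AE_I2 impI bexI[OF one_parameter_has_vector_derivative Z])
  qed (use gG in auto)
  fix t
  \<comment> \<open>The summand 1 keeps \<open>L\<close> positive for \<open>Z = 0\<close>; with
    \<open>\<epsilon> = pi / (8 * L)\<close> a segment of duration at most
    \<open>2 * \<epsilon>\<close> meets the angle bound pi / 4.\<close>
  define L where "L = 1 + sqrt DIM('a) * norm Z"
  have pos: "L > 0"
    by (simp add: L_def add_pos_nonneg)
  define \<epsilon> where "\<epsilon> = pi / (8 * L)"
  show "\<exists>\<epsilon>>0. \<forall>a b. t - \<epsilon> \<le> a \<and> a \<le> b \<and> b \<le> t + \<epsilon> \<longrightarrow>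
      (\<forall>c a' b'. a' \<le> b' \<and> horizontal G p a' b' c \<and> c a' = ?g a \<and> c b' = ?g b \<longrightarrow>
        sr_length a b ?g \<le> sr_length a' b' c)"
  proof (intro exI[of _ \<epsilon>] conjI allI impI; (elim conjE)?)
    show "\<epsilon> > 0"
      using pos by (simp add: \<epsilon>_def)
    fix a b c a' b'
    assume ab: "t - \<epsilon> \<le> a" "a \<le> b" "b \<le> t + \<epsilon>" and ab': "a' \<le> b'" and c: "horizontal G p a' b' c"
      "c a' = ?g a" "c b' = ?g b"
    have "(b - a) * (sqrt DIM('a) * norm Z) \<le> (2 * \<epsilon>) * L"
      using ab by (intro mult_mono) (auto simp: L_def)
    also have "\<dots> = pi / 4"
      using pos by (simp add: \<epsilon>_def)
    finally have "ennreal ((b - a) * norm Z / sqrt 2) \<le> sr_length a' b' c"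
    proof (intro one_parameter_subgroup_minimizing[OF ZS gU _ _ ab'])
      have "AE t in lebesgue. t \<in> {a'..b'} \<longrightarrow> (\<exists>X\<in>p. (c has_vector_derivative pmul (c t) X) (at t))"
        using c(1) unfolding horizontal_def by blast
      then show "AE t in lebesgue. t \<in> {a'..b'} \<longrightarrow> (\<exists>X\<in>skew_pairs. (c has_vector_derivative pmul (c t) X) (at t))"
        by (rule eventually_mono) (use p in blast)
      \<comment> \<open>By the addition law the segment is a one-parameter curve restarted at
        \<open>?g a\<close>.\<close>
      show "c b' = pmul (?g a) (pexp ((b - a) *\<^sub>R Z))"
        by (simp only: c(3) pmul_assoc[symmetric] pexp_add[symmetric]) simp
    qed (use c G ab in \<open>auto simp: horizontal_def\<close>)
    then show "sr_length a b ?g \<le> sr_length a' b' c"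
      by (simp add: sr_length_one_parameter[OF g ZS ab(2)])
  qed
qed

lemma quasi_geodesic_eq_sr_curve:
  fixes r :: "'a::hurwitz_algebra^('k::finite + 'l::finite)^('k + 'l)"
  assumes "A \<in> skew_hermitian"
  shows "quasi_geodesic r s B A = stiefel_proj \<circ> sr_curve (r, s) (offdiag B, A) 0"
  by (rule ext) (simp add: sr_curve_0 stiefel_proj_def pmul_def pexp_def quasi_geodesic_eq[OF assms])

lemma sr_curve_block:
  fixes B :: "'a::hurwitz_algebra^'l^'k"
  shows "sr_curve g0 (offdiag B, A) (block E 0 0 F, 0) t =
    pmul g0 (mexp (t *\<^sub>R block E B (- adj B) F) ** block (mexp (- t *\<^sub>R E)) 0 0 (mexp (- t *\<^sub>R F)),
      mexp (t *\<^sub>R A))"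
proof -
  have "- t *\<^sub>R block E 0 0 F = block (- t *\<^sub>R E) 0 0 (- t *\<^sub>R F)"
    unfolding block_scaleR by simp
  then have "mexp (- t *\<^sub>R block E 0 0 F) = block (mexp (- t *\<^sub>R E)) 0 0 (mexp (- t *\<^sub>R F))"
    by (simp only: mexp_block_diag)
  moreover have "offdiag B + block E 0 0 F = block E B (- adj B) F"
    by (simp add: offdiag_def block_add)
  ultimately show ?thesis
    by (simp add: sr_curve_def pmul_def pexp_def matrix_mul_assoc)
qed

text \<open>The common interface of the three cases: transitivity on frames, and closure under the
  exponentials of the distribution. \<open>zero\<close> places \<open>Q = 0\<close> in
  \<open>pperp gk gl\<close>.\<close>

locale quasi_geodesic_groups =
  fixes Gn :: "('a::hurwitz_algebra^('k::finite + 'l::finite)^('k + 'l)) set"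
    and Gk :: "('a^'k^'k) set" and gk :: "('a^'k^'k) set" and gl :: "('a^'l^'l) set"
  assumes Gn: "Gn \<subseteq> unitary" and Gk: "Gk \<subseteq> unitary" and gk: "gk \<subseteq> skew_hermitian"
    and zero: "0 \<in> gk" "0 \<in> gl"
    and transitive: "\<And>m. m \<in> stiefel \<Longrightarrow> \<exists>g\<in>Gn \<times> Gk. stiefel_proj g = m"
    and mexp_Gn: "\<And>r B t. r \<in> Gn \<Longrightarrow> r ** mexp (t *\<^sub>R offdiag B) \<in> Gn"
    and mexp_Gk: "\<And>s A t. s \<in> Gk \<Longrightarrow> A \<in> gk \<Longrightarrow> s ** mexp (t *\<^sub>R A) \<in> Gk"
begin

sublocale stiefel_metric "homogeneous_metric Gn Gk"
proof unfold_locales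
  fix m v w :: "'a^'k^('k + 'l)"
  assume m: "m \<in> stiefel" and vw: "v \<in> stiefel_tangent m" "w \<in> stiefel_tangent m"
  obtain g where "g \<in> Gn \<times> Gk" "stiefel_proj g = m"
    using transitive[OF m] by blast
  then show "homogeneous_metric Gn Gk m v w = canonical_metric m v w"
    by (rule homogeneous_metric_eq[OF Gn Gk _ _ vw])
qed

lemma sr_geodesic_sr_curve:
  assumes g: "g \<in> Gn \<times> Gk" and P: "P \<in> pspace gk"
  shows "sr_geodesic (Gn \<times> Gk) (pspace gk) (sr_curve g P 0)"
  unfolding sr_curve_0
proof (rule sr_geodesic_one_parameter[OF _ _ P])
  show "Gn \<times> Gk \<subseteq> unitary_pairs"
    using Gn Gk by (auto simp: unitary_pairs_def)
  show "pspace gk \<subseteq> skew_pairs"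
    using gk by (auto simp: pspace_def skew_pairs_def offdiag_skew)
  show "pmul g (pexp (t *\<^sub>R P)) \<in> Gn \<times> Gk" for t
    using g P mexp_Gn mexp_Gk by (auto simp: pspace_def pmul_def pexp_def)
qed

lemma quasi_geodesic_properties:
  "(quasi_geodesics Gn Gk gk :: (real \<Rightarrow> 'a^'k^('k + 'l)) set) =
      {stiefel_proj \<circ> sr_curve g0 P Q | g0 P Q.
        g0 \<in> Gn \<times> Gk \<and> P \<in> pspace gk \<and> Q \<in> pperp gk gl \<and>
        sr_geodesic (Gn \<times> Gk) (pspace gk) (sr_curve g0 P Q) \<and> Q = 0} \<and>
   (\<forall>g0 \<in> Gn \<times> Gk. \<forall>B :: 'a^'l^'k. \<forall>A \<in> gk. \<forall>E \<in> gk. \<forall>F \<in> gl. \<forall>t.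
      sr_curve g0 (offdiag B, A) (block E 0 0 F, 0) t =
      pmul g0 (mexp (t *\<^sub>R block E B (- adj B) F) **
                 block (mexp (- t *\<^sub>R E)) 0 0 (mexp (- t *\<^sub>R F)),
               mexp (t *\<^sub>R A))) \<and>
   (\<forall>\<gamma> \<in> (quasi_geodesics Gn Gk gk :: (real \<Rightarrow> 'a^'k^('k + 'l)) set).
      \<not> \<gamma> constant_on UNIV \<longrightarrow>
      constant_geodesic_curvature stiefel (homogeneous_metric Gn Gk) \<gamma>) \<and>
   (\<forall>r \<in> Gn. \<forall>s \<in> Gk. \<forall>B :: 'a^'l^'k. \<forall>A \<in> gk.
      (offdiag B, A) = (0, A) \<or> (offdiag B, A) = (offdiag B, 0) \<longrightarrow>
      riemannian_geodesic stiefel (homogeneous_metric Gn Gk) (quasi_geodesic r s B A))"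
proof (intro conjI)
  have eq: "quasi_geodesic r s B A = stiefel_proj \<circ> sr_curve (r, s) (offdiag B, A) 0" if "A \<in> gk" for r s B A
    using that gk by (intro quasi_geodesic_eq_sr_curve) auto
  have Q: "0 \<in> pperp gk gl"
  proof -
    have "(0, 0) = (block 0 0 0 0, 0)"
      by (simp add: block_0)
    then show ?thesis
      unfolding pperp_def zero_prod_def using zero by blast
  qed
  show "(quasi_geodesics Gn Gk gk :: (real \<Rightarrow> 'a^'k^('k + 'l)) set) =
      {stiefel_proj \<circ> sr_curve g0 P Q | g0 P Q.
        g0 \<in> Gn \<times> Gk \<and> P \<in> pspace gk \<and> Q \<in> pperp gk gl \<and>
        sr_geodesic (Gn \<times> Gk) (pspace gk) (sr_curve g0 P Q) \<and> Q = 0}" (is "?L = ?R")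
  proof
    show "?L \<subseteq> ?R"
    proof
      fix \<gamma> assume "\<gamma> \<in> ?L"
      then obtain r s B A where h: "\<gamma> = quasi_geodesic r s B A" "r \<in> Gn" "s \<in> Gk" "A \<in> gk"
        by (auto simp: quasi_geodesics_def)
      have "(r, s) \<in> Gn \<times> Gk" "(offdiag B, A) \<in> pspace gk"
        using h by (auto simp: pspace_def)
      then show "\<gamma> \<in> ?R"
        using h(1,4) eq Q sr_geodesic_sr_curve by blast
    qed
    show "?R \<subseteq> ?L"
    proof
      fix \<gamma> assume "\<gamma> \<in> ?R"
      then obtain g0 P where h: "\<gamma> = stiefel_proj \<circ> sr_curve g0 P 0" "g0 \<in> Gn \<times> Gk" "P \<in> pspace gk"
        by blast
      then obtain r s B A where h': "g0 = (r, s)" "r \<in> Gn" "s \<in> Gk" "P = (offdiag B, A)" "A \<in> gk"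
        by (auto simp: pspace_def)
      then have "\<gamma> = quasi_geodesic r s B A"
        by (simp add: h(1) eq)
      then show "\<gamma> \<in> ?L"
        using h' by (auto simp: quasi_geodesics_def)
    qed
  qed
  show "\<forall>g0 \<in> Gn \<times> Gk. \<forall>B :: 'a^'l^'k. \<forall>A \<in> gk. \<forall>E \<in> gk. \<forall>F \<in> gl. \<forall>t.
      sr_curve g0 (offdiag B, A) (block E 0 0 F, 0) t =
      pmul g0 (mexp (t *\<^sub>R block E B (- adj B) F) **
                 block (mexp (- t *\<^sub>R E)) 0 0 (mexp (- t *\<^sub>R F)),
               mexp (t *\<^sub>R A))"
    by (intro ballI allI sr_curve_block)
  show "\<forall>\<gamma> \<in> (quasi_geodesics Gn Gk gk :: (real \<Rightarrow> 'a^'k^('k + 'l)) set).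
      \<not> \<gamma> constant_on UNIV \<longrightarrow>
      constant_geodesic_curvature stiefel (homogeneous_metric Gn Gk) \<gamma>"
    using Gn Gk gk by (auto simp: quasi_geodesics_def intro!: quasi_geodesic_constant_curvature)
  show "\<forall>r \<in> Gn. \<forall>s \<in> Gk. \<forall>B :: 'a^'l^'k. \<forall>A \<in> gk.
      (offdiag B, A) = (0, A) \<or> (offdiag B, A) = (offdiag B, 0) \<longrightarrow>
      riemannian_geodesic stiefel (homogeneous_metric Gn Gk) (quasi_geodesic r s B A)"
  proof (intro ballI allI impI)
    fix r s A and B :: "'a^'l^'k"
    assume h: "r \<in> Gn" "s \<in> Gk" "A \<in> gk"
      "(offdiag B, A) = (0, A) \<or> (offdiag B, A) = (offdiag B, 0)"
    \<comment> \<open>\<open>offdiag B = 0\<close> gives \<open>B = 0\<close>, since the squared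
      norm of \<open>offdiag B\<close> is twice that of \<open>B\<close>.\<close>
    then have "A = 0 \<or> B = 0"
      using inner_offdiag[of B B] by auto
    then show "riemannian_geodesic stiefel (homogeneous_metric Gn Gk) (quasi_geodesic r s B A)"
      using h Gn Gk gk by (intro quasi_geodesic_riemannian_geodesic) auto
  qed
qed

end

section \<open>Determinants and the three families of groups\<close>

text \<open>Determinants call for commutative scalars, hence the class
  \<open>real_normed_field\<close>. \<open>SO\<close> and \<open>SU\<close> are both instances,
  because \<open>hconj\<close> is the identity on the reals and the complex conjugation on the
  complex numbers.\<close>

definition special_unitary :: "('a::{hurwitz_algebra, real_normed_field}^'n^'n) set" where
  "special_unitary = {r \<in> unitary. det r = 1}"

lemma det_adj:
  fixes A :: "'a::{hurwitz_algebra, real_normed_field}^'n^'n"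
  shows "det (adj A) = hconj (det A)"
proof -
  have prod: "hconj (\<Prod>i\<in>I. f i) = (\<Prod>i\<in>I. hconj (f i))" for I :: "'n set" and f :: "'n \<Rightarrow> 'a"
    by (induction I rule: infinite_finite_induct) (simp_all add: hconj_mult mult.commute)
  have int: "hconj (of_int k :: 'a) = of_int k" for k
    using hconj_scaleR[of "of_int k" "1::'a"] by (simp add: scaleR_conv_of_real)
  have "hconj (det A) = (\<Sum>p | p permutes UNIV. of_int (sign p) * (\<Prod>i\<in>UNIV. hconj (A $ i $ p i)))"
    by (simp add: det_def hconj_sum hconj_mult prod int mult.commute)
  also have "\<dots> = det (transpose (adj A))"
    by (simp add: det_def transpose_def adj_nth)
  finally show ?thesis
    by (simp add: det_transpose)
qed

text \<open>Jacobi's formula at the identity. A permutation other than \<open>id\<close> moves at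
  least two indices, so after one factor is differentiated an off-diagonal entry of
  \<open>mat 1\<close> remains and kills the term.\<close>

lemma det_has_vector_derivative_at_mat_1:
  fixes M :: "real \<Rightarrow> 'a::{hurwitz_algebra, real_normed_field}^'n^'n"
  assumes M: "(M has_vector_derivative A) (at 0)" and M0: "M 0 = mat 1"
  shows "((\<lambda>t. det (M t)) has_vector_derivative trace A) (at 0)"
proof -
  have entry: "((\<lambda>t. M t $ i $ j) has_derivative (\<lambda>h. h *\<^sub>R A $ i $ j)) (at 0)" for i j
    using bounded_linear.has_vector_derivative[OF bounded_linear_compose[OF bounded_linear_vec_nth bounded_linear_vec_nth] M]
    by (simp add: has_vector_derivative_def)
  have "((\<lambda>t. \<Sum>p | p permutes UNIV. of_int (sign p) * (\<Prod>i\<in>UNIV. M t $ i $ p i)) has_derivative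
      (\<lambda>h. \<Sum>p | p permutes UNIV. of_int (sign p) * (\<Sum>i\<in>UNIV. h *\<^sub>R A $ i $ p i * (\<Prod>j\<in>UNIV - {i}. M 0 $ j $ p j)))) (at 0)"
    by (intro has_derivative_sum has_derivative_mult_right has_derivative_prod entry)
  moreover have "(\<Sum>p | p permutes UNIV. of_int (sign p) * (\<Sum>i\<in>UNIV. h *\<^sub>R A $ i $ p i * (\<Prod>j\<in>UNIV - {i}. M 0 $ j $ p j))) =
      h *\<^sub>R trace A" for h
  proof -
    have zero: "(\<Prod>j\<in>UNIV - {i}. M 0 $ j $ p j) = 0" if p: "p permutes UNIV" "p \<noteq> id" for p :: "'n \<Rightarrow> 'n" and i
    proof -
      have "\<exists>j. j \<noteq> i \<and> p j \<noteq> j"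
      proof (rule ccontr)
        assume "\<not> ?thesis"
        then have fixed: "p j = j" if "j \<noteq> i" for j
          using that by blast
        moreover have "p i = i"
        proof (rule ccontr)
          assume "p i \<noteq> i"
          from fixed[OF this] show False
            using \<open>p i \<noteq> i\<close> permutes_inj[OF p(1)] by (auto dest: injD)
        qed
        ultimately show False
          using p(2) by (metis eq_id_iff)
      qed
      then obtain j where "j \<noteq> i" "p j \<noteq> j"
        by blast
      then show ?thesis
        by (intro prod_zero bexI[of _ j]) (auto simp: M0 mat_def)
    qed
    have "(\<Sum>p | p permutes UNIV. of_int (sign p) * (\<Sum>i\<in>UNIV. h *\<^sub>R A $ i $ p i * (\<Prod>j\<in>UNIV - {i}. M 0 $ j $ p j))) =
        (\<Sum>p\<in>{id}. of_int (sign p) * (\<Sum>i\<in>UNIV. h *\<^sub>R A $ i $ p i * (\<Prod>j\<in>UNIV - {i}. M 0 $ j $ p j)))"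
    proof (rule sum.mono_neutral_right)
      show "finite {p :: 'n \<Rightarrow> 'n. p permutes UNIV}"
        by (rule finite_permutations) simp
      show "\<forall>p\<in>{p. p permutes UNIV} - {id}.
          of_int (sign p) * (\<Sum>i\<in>UNIV. h *\<^sub>R A $ i $ p i * (\<Prod>j\<in>UNIV - {i}. M 0 $ j $ p j)) = 0"
      proof
        fix p :: "'n \<Rightarrow> 'n" assume p: "p \<in> {p. p permutes UNIV} - {id}"
        have "(\<Sum>i\<in>UNIV. h *\<^sub>R A $ i $ p i * (\<Prod>j\<in>UNIV - {i}. M 0 $ j $ p j)) = 0"
          by (intro sum.neutral ballI, subst zero) (use p in auto)
        then show "of_int (sign p) * (\<Sum>i\<in>UNIV. h *\<^sub>R A $ i $ p i * (\<Prod>j\<in>UNIV - {i}. M 0 $ j $ p j)) = 0"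
          by (simp only: mult_zero_right)
      qed
    qed (simp add: permutes_id)
    then show ?thesis
      by (simp add: M0 mat_def trace_def scaleR_sum_right sign_id)
  qed
  ultimately show ?thesis
    by (simp add: det_def has_vector_derivative_def)
qed

text \<open>The derivative at 0 suffices: the addition law and multiplicativity of the determinant
  carry it to every time.\<close>

lemma det_mexp_traceless:
  fixes A :: "'a::{hurwitz_algebra, real_normed_field}^'n^'n"
  assumes A: "trace A = 0"
  shows "det (mexp (t *\<^sub>R A)) = 1"
proof -
  let ?h = "\<lambda>t. det (mexp (t *\<^sub>R A))"
  have 0: "(?h has_vector_derivative 0) (at 0)"
    using det_has_vector_derivative_at_mat_1[OF mexp_has_vector_derivative[of A 0, simplified]] A by simp
  have "(?h has_vector_derivative 0) (at s)" for s
  proof -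
    have "((\<lambda>t. ?h s * ?h (t - s)) has_vector_derivative ?h s * 0) (at s)"
    proof (intro bounded_linear.has_vector_derivative[OF bounded_linear_mult_right])
      have "((\<lambda>t. t - s) has_vector_derivative 1) (at s)"
        by (auto intro!: derivative_eq_intros)
      from vector_diff_chain_at[OF this, of ?h 0] show "((\<lambda>t. ?h (t - s)) has_vector_derivative 0) (at s)"
        using 0 by (simp add: o_def)
    qed
    moreover have "?h s * ?h (t - s) = ?h t" for t
      using mexp_add[of s "t - s" A] by (simp add: det_mul)
    ultimately show ?thesis
      by simp
  qed
  from has_vector_derivative_0_imp_const[of ?h, OF this, of t 0] show ?thesis
    by (simp add: det_I)
qed

lemma special_unitary_mult_mexp:
  assumes "r \<in> special_unitary" "A \<in> skew_hermitian" "trace A = 0"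
  shows "r ** mexp (t *\<^sub>R A) \<in> special_unitary"
  using assms by (simp add: special_unitary_def unitary_mult mexp_skew_unitary det_mul det_mexp_traceless)

lemma trace_offdiag: "trace (offdiag B) = 0"
  by (simp add: trace_def sum_UNIV_Plus offdiag_def)

text \<open>A unitary \<open>r\<close> with \<open>r ** Ink = m\<close> is corrected by a diagonal
  matrix carrying the conjugate of \<open>det r\<close> in one lower coordinate. \<open>Ink\<close>
  vanishes there, so the projection is unchanged.\<close>

lemma stiefel_proj_special_unitary:
  fixes m :: "'a::{hurwitz_algebra, real_normed_field}^'k^('k::finite + 'l::finite)"
  assumes m: "m \<in> stiefel"
  shows "\<exists>g\<in>special_unitary \<times> special_unitary. stiefel_proj g = m"
proof -
  obtain r where r: "r \<in> unitary" "r ** Ink = m"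
    using unitary_transitive[OF Ink_stiefel stiefelD[OF m]] by blast
  define c where "c = hconj (det r)"
  have c: "c * det r = 1"
    using arg_cong[OF unitaryD(1)[OF r(1)], of det] by (simp add: det_mul det_adj det_I c_def)
  \<comment> \<open>Any lower index will do; one exists because types are nonempty, that is, k <
    n.\<close>
  define l :: 'l where "l = undefined"
  define q :: "'a^('k + 'l)^('k + 'l)" where
    "q = (\<chi> i j. if i = j then (if i = Inr l then c else 1) else 0)"
  have cc: "hconj c * c = 1" "c * hconj c = 1"
    using c by (simp_all add: c_def mult.commute)
  have "adj q ** q = mat 1" "q ** adj q = mat 1"
    by (simp_all add: vec_eq_iff matrix_mult_nth adj_nth q_def mat_def if_distrib[of hconj]
        if_distrib[of "\<lambda>x. x * _"] cc cong: if_cong)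
  then have q: "q \<in> unitary"
    by (simp add: unitary_def)
  have "det q = (\<Prod>i\<in>(UNIV :: ('k + 'l) set). if i = Inr l then c else 1)"
    by (subst det_diagonal) (auto simp: q_def)
  then have "det (r ** q) = 1"
    using c by (simp add: det_mul mult.commute)
  then have "r ** q \<in> special_unitary"
    using r q by (simp add: special_unitary_def unitary_mult)
  moreover have "(mat 1 :: 'a^'k^'k) \<in> special_unitary"
    by (simp add: special_unitary_def unitary_mat_1 det_I)
  moreover have "q ** Ink = (Ink :: 'a^'k^('k + 'l))"
    by (simp add: vec_eq_iff_Plus vec_eq_iff[where 'b = 'k] matrix_mult_nth q_def Ink_nth sum_UNIV_Plus
        if_distrib[of "\<lambda>x. x * _"] cong: if_cong)
  then have "stiefel_proj (r ** q, mat 1) = m"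
    using r by (simp add: stiefel_proj_def flip: matrix_mul_assoc)
  ultimately show ?thesis
    by blast
qed

lemma quasi_geodesic_groups_special_unitary:
  fixes gk :: "('a::{hurwitz_algebra, real_normed_field}^'k::finite^'k) set" and gl :: "('a^'l::finite^'l) set"
  assumes "gk \<subseteq> skew_hermitian" "\<And>A. A \<in> gk \<Longrightarrow> trace A = 0" "0 \<in> gk" "0 \<in> gl"
  shows "quasi_geodesic_groups special_unitary special_unitary gk gl"
proof
  show "r ** mexp (t *\<^sub>R offdiag B) \<in> special_unitary" if "r \<in> special_unitary"
    for r :: "'a^('k + 'l)^('k + 'l)" and B :: "'a^'l^'k" and t
    using that by (rule special_unitary_mult_mexp) (rule offdiag_skew trace_offdiag)+
  show "s ** mexp (t *\<^sub>R A) \<in> special_unitary" if "s \<in> special_unitary" "A \<in> gk" for s A t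
    using that assms by (intro special_unitary_mult_mexp) auto
qed (use assms stiefel_proj_special_unitary in \<open>auto simp: special_unitary_def\<close>)

lemma quasi_geodesic_groups_unitary:
  "quasi_geodesic_groups (unitary :: ('a::hurwitz_algebra^('k::finite + 'l::finite)^('k + 'l)) set)
    unitary skew_hermitian skew_hermitian"
proof
  show "\<exists>g\<in>unitary \<times> unitary. stiefel_proj g = m" if m: "m \<in> stiefel" for m :: "'a^'k^('k + 'l)"
  proof -
    obtain r where r: "r \<in> unitary" "r ** Ink = m"
      using unitary_transitive[OF Ink_stiefel stiefelD[OF m]] by blast
    then show ?thesis
      by (intro bexI[of _ "(r, mat 1)"]) (auto simp: stiefel_proj_def unitary_mat_1)
  qed
  show "(0 :: 'a^'k^'k) \<in> skew_hermitian" "(0 :: 'a^'l^'l) \<in> skew_hermitian"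
    by (simp_all add: skew_hermitian_def)
qed (auto intro: unitary_mult mexp_skew_unitary offdiag_skew)

lemma SO_eq: "SO = special_unitary" and SU_eq: "SU = special_unitary" and Sp_eq: "Sp = unitary"
  by (auto simp: SO_def SU_def Sp_def special_unitary_def unitary_def)

text \<open>Brings \<open>so\<close> under the traceless condition that \<open>su\<close> has by
  definition.\<close>

lemma trace_real_skew:
  assumes A: "A \<in> skew_hermitian"
  shows "trace (A :: real^'n^'n) = 0"
proof -
  have "A $ i $ i = 0" for i
    using arg_cong[OF skew_hermitianD[OF A], of "\<lambda>M. M $ i $ i"] by (simp add: adj_nth hconj_real)
  then show ?thesis
    by (simp add: trace_def)
qed

theorem proposition6:
  shows
    "((quasi_geodesics SO SO so :: (real \<Rightarrow> real^'k^('k::finite + 'l::finite)) set) =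
         {stiefel_proj \<circ> sr_curve g0 P Q | g0 P Q.
            g0 \<in> SO \<times> SO \<and> P \<in> pspace so \<and> Q \<in> pperp so so \<and>
            sr_geodesic (SO \<times> SO) (pspace so) (sr_curve g0 P Q) \<and> Q = 0} \<and>
      (\<forall>g0 \<in> SO \<times> SO. \<forall>B :: real^'l^'k. \<forall>A \<in> (so :: (real^'k^'k) set).
         \<forall>E \<in> so. \<forall>F \<in> so. \<forall>t.
         sr_curve g0 (offdiag B, A) (block E 0 0 F, 0) t =
         pmul g0 (mexp (t *\<^sub>R block E B (- adj B) F) **
                    block (mexp (- t *\<^sub>R E)) 0 0 (mexp (- t *\<^sub>R F)),
                  mexp (t *\<^sub>R A))) \<and>
      (\<forall>\<gamma> \<in> (quasi_geodesics SO SO so :: (real \<Rightarrow> real^'k^('k::finite + 'l::finite)) set).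
         \<not> \<gamma> constant_on UNIV \<longrightarrow>
         constant_geodesic_curvature stiefel (homogeneous_metric SO SO) \<gamma>) \<and>
      (\<forall>r \<in> SO. \<forall>s \<in> SO. \<forall>B :: real^'l^'k. \<forall>A \<in> so.
         (offdiag B, A) = (0, A) \<or> (offdiag B, A) = (offdiag B, 0) \<longrightarrow>
         riemannian_geodesic stiefel (homogeneous_metric SO SO) (quasi_geodesic r s B A))) \<and>

     ((quasi_geodesics SU SU su :: (real \<Rightarrow> complex^'k^('k::finite + 'l::finite)) set) =
         {stiefel_proj \<circ> sr_curve g0 P Q | g0 P Q.
            g0 \<in> SU \<times> SU \<and> P \<in> pspace su \<and> Q \<in> pperp su su \<and>
            sr_geodesic (SU \<times> SU) (pspace su) (sr_curve g0 P Q) \<and> Q = 0} \<and>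
      (\<forall>g0 \<in> SU \<times> SU. \<forall>B :: complex^'l^'k. \<forall>A \<in> (su :: (complex^'k^'k) set).
         \<forall>E \<in> su. \<forall>F \<in> su. \<forall>t.
         sr_curve g0 (offdiag B, A) (block E 0 0 F, 0) t =
         pmul g0 (mexp (t *\<^sub>R block E B (- adj B) F) **
                    block (mexp (- t *\<^sub>R E)) 0 0 (mexp (- t *\<^sub>R F)),
                  mexp (t *\<^sub>R A))) \<and>
      (\<forall>\<gamma> \<in> (quasi_geodesics SU SU su :: (real \<Rightarrow> complex^'k^('k::finite + 'l::finite)) set).
         \<not> \<gamma> constant_on UNIV \<longrightarrow>
         constant_geodesic_curvature stiefel (homogeneous_metric SU SU) \<gamma>) \<and>
      (\<forall>r \<in> SU. \<forall>s \<in> SU. \<forall>B :: complex^'l^'k. \<forall>A \<in> su.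
         (offdiag B, A) = (0, A) \<or> (offdiag B, A) = (offdiag B, 0) \<longrightarrow>
         riemannian_geodesic stiefel (homogeneous_metric SU SU) (quasi_geodesic r s B A))) \<and>

     ((quasi_geodesics Sp Sp sp :: (real \<Rightarrow> quat^'k^('k::finite + 'l::finite)) set) =
         {stiefel_proj \<circ> sr_curve g0 P Q | g0 P Q.
            g0 \<in> Sp \<times> Sp \<and> P \<in> pspace sp \<and> Q \<in> pperp sp sp \<and>
            sr_geodesic (Sp \<times> Sp) (pspace sp) (sr_curve g0 P Q) \<and> Q = 0} \<and>
      (\<forall>g0 \<in> Sp \<times> Sp. \<forall>B :: quat^'l^'k. \<forall>A \<in> (sp :: (quat^'k^'k) set).
         \<forall>E \<in> sp. \<forall>F \<in> sp. \<forall>t.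
         sr_curve g0 (offdiag B, A) (block E 0 0 F, 0) t =
         pmul g0 (mexp (t *\<^sub>R block E B (- adj B) F) **
                    block (mexp (- t *\<^sub>R E)) 0 0 (mexp (- t *\<^sub>R F)),
                  mexp (t *\<^sub>R A))) \<and>
      (\<forall>\<gamma> \<in> (quasi_geodesics Sp Sp sp :: (real \<Rightarrow> quat^'k^('k::finite + 'l::finite)) set).
         \<not> \<gamma> constant_on UNIV \<longrightarrow>
         constant_geodesic_curvature stiefel (homogeneous_metric Sp Sp) \<gamma>) \<and>
      (\<forall>r \<in> Sp. \<forall>s \<in> Sp. \<forall>B :: quat^'l^'k. \<forall>A \<in> sp.
         (offdiag B, A) = (0, A) \<or> (offdiag B, A) = (offdiag B, 0) \<longrightarrow>
         riemannian_geodesic stiefel (homogeneous_metric Sp Sp) (quasi_geodesic r s B A)))"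
proof -
  note properties = quasi_geodesic_groups.quasi_geodesic_properties
  have SO: "quasi_geodesic_groups (SO :: (real^('k + 'l)^('k + 'l)) set) SO so so"
    unfolding SO_eq by (rule quasi_geodesic_groups_special_unitary)
      (auto simp: so_def trace_real_skew, simp_all add: skew_hermitian_def)
  have SU: "quasi_geodesic_groups (SU :: (complex^('k + 'l)^('k + 'l)) set) SU su su"
    unfolding SU_eq by (rule quasi_geodesic_groups_special_unitary)
      (auto simp: su_def, simp_all add: skew_hermitian_def trace_def)
  have Sp: "quasi_geodesic_groups (Sp :: (quat^('k + 'l)^('k + 'l)) set) Sp sp sp"
    unfolding Sp_eq sp_def by (rule quasi_geodesic_groups_unitary)
  show ?thesis
    by (rule conjI[OF properties[OF SO] conjI[OF properties[OF SU] properties[OF Sp]]])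
qed

end
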